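(* With $J_k=\prod_{m\ge1}(1-q^{km})$, let $t=\frac{qJ_1^2J_{10}^4}{J_2^4J_5^2}$, $P_A=\frac{J_{10}^2J_5J_2^6}{J_{20}J_4^3J_1^5}-4\frac{qJ_{20}J_5^2J_4^3}{J_{10}J_2^3J_1^2}$, $P_B=\frac{J_{10}^6J_2^2J_1}{qJ_{20}^3J_5^5J_4}+4\frac{qJ_{20}^3J_4J_1^2}{J_{10}^3J_5^2J_2}$, $A=\frac{J_{50}^2J_1^4}{J_{25}^4J_2^2}$, $B=\frac{qJ_{25}}{J_1}$, $U_A(g)=U_5(Ag)$, $U_B(g)=U_5(Bg)$, and define $L_0=P_A$, $L_{2\alpha+1}=U_A(L_{2\alpha})$, $L_{2\alpha+2}=U_B(L_{2\alpha+1})$ for $\alpha\ge0$. There exists a discrete array $\ell$ such that for all $\alpha\ge1$ $$L_{2\alpha}=P_A\sum_{n\ge1}\ell(2\alpha,n)t^n,\quad \nu_5(\ell(2\alpha,n))\ge\alpha+\left\lfloor\frac{3n-3}{4}\right\rfloor,$$ $$L_{2\alpha+1}=P_B\sum_{n\ge2}\ell(2\alpha+1,n)t^n,\quad \nu_5(\ell(2\alpha+1,n))\ge\alpha+1+\left\lfloor\frac{3n-6}{4}\right\rfloor.$$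
   Context: A discrete array is a map $\ell:\mathbb Z\times\mathbb Z\to\mathbb Z$ such that for each $i$, $j\mapsto\ell(i,j)$ has finite support. $U_5(\sum_m c(m)q^m)=\sum_m c(5m)q^m$ on formal Laurent series. $\nu_5$ is the $5$-adic valuation ($\nu_5(0)=\infty$). *)

theory Defs
  imports "HOL-Analysis.Analysis"
    "HOL-Computational_Algebra.Formal_Laurent_Series"
begin

text \<open>
  All series have integer coefficients, but they are formalised over the field of rationals,
  so that the quotients below are quotients in the field \<^typ>\<open>rat fls\<close>. The variable
  \<open>q\<close> is \<^const>\<open>fls_X\<close>.
\<close>

abbreviation q :: "rat fls" where "q \<equiv> fls_X"

text \<open>The infinite product is taken in the topology of \<^typ>\<open>rat fps\<close>; meant for \<open>k \<ge> 1\<close>.\<close>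

definition J :: "nat \<Rightarrow> rat fls" where
  "J k = fps_to_fls (\<Prod>m. 1 - fps_X ^ (k * Suc m))"

lemma J_product_has_prod:
  assumes k: "k \<ge> 1"
  defines "f \<equiv> \<lambda>m. 1 - fps_X ^ (k * Suc m) :: rat fps"
  shows "f has_prod (\<Prod>m. f m)"
proof -
  have nth_f: "fps_nth (g * f m) n = fps_nth g n" if "n \<le> m" for g m n
  proof -
    have "n < k * Suc m"
      using that k by (metis less_le_trans less_Suc_eq_le mult_le_mono1 nat_mult_1)
    then show ?thesis
      by (simp add: f_def algebra_simps fps_X_power_mult_right_nth)
  qed
  have stable: "fps_nth (prod f {..n + d}) n = fps_nth (prod f {..n}) n" for n d
    by (induction d) (auto simp: nth_f)
  define P where "P = Abs_fps (\<lambda>n. fps_nth (prod f {..n}) n)"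
  have "(\<lambda>n. \<Prod>i\<le>n. f i) \<longlonglongrightarrow> P"
  proof (rule tendsto_fpsI)
    fix n
    show "eventually (\<lambda>N. fps_nth (prod f {..N}) n = fps_nth P n) at_top"
      using eventually_ge_at_top[of n]
      by eventually_elim (metis P_def fps_nth_Abs_fps le_iff_add stable)
  qed
  moreover have "fps_nth P 0 = 1"
    using k by (simp add: P_def f_def)
  then have "P \<noteq> 0"
    by auto
  ultimately have "f has_prod P"
    by (simp add: has_prod_def raw_has_prod_def)
  then show ?thesis
    using has_prod_unique by blast
qed

definition t :: "rat fls" where
  "t = (q * J 1 ^ 2 * J 10 ^ 4) / (J 2 ^ 4 * J 5 ^ 2)"

definition P_A :: "rat fls" where
  "P_A = (J 10 ^ 2 * J 5 * J 2 ^ 6) / (J 20 * J 4 ^ 3 * J 1 ^ 5)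
     - 4 * ((q * J 20 * J 5 ^ 2 * J 4 ^ 3) / (J 10 * J 2 ^ 3 * J 1 ^ 2))"

definition P_B :: "rat fls" where
  "P_B = (J 10 ^ 6 * J 2 ^ 2 * J 1) / (q * J 20 ^ 3 * J 5 ^ 5 * J 4)
     + 4 * ((q * J 20 ^ 3 * J 4 * J 1 ^ 2) / (J 10 ^ 3 * J 5 ^ 2 * J 2))"

definition A :: "rat fls" where
  "A = (J 50 ^ 2 * J 1 ^ 4) / (J 25 ^ 4 * J 2 ^ 2)"

definition B :: "rat fls" where
  "B = (q * J 25) / J 1"

lift_definition U\<^sub>5 :: "rat fls \<Rightarrow> rat fls" is "\<lambda>c m. c (5 * m)"
proof -
  fix c :: "int \<Rightarrow> rat"
  assume "\<forall>\<^sub>\<infinity>n::nat. c (- int n) = 0"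
  then obtain N where N: "\<And>n. n \<ge> N \<Longrightarrow> c (- int n) = 0"
    unfolding MOST_nat_le by blast
  have "c (5 * - int n) = 0" if "n \<ge> N" for n
    using N[of "5 * n"] that by simp
  then show "\<forall>\<^sub>\<infinity>n::nat. c (5 * - int n) = 0"
    unfolding MOST_nat_le by blast
qed

definition U_A :: "rat fls \<Rightarrow> rat fls" where "U_A g = U\<^sub>5 (A * g)"

definition U_B :: "rat fls \<Rightarrow> rat fls" where "U_B g = U\<^sub>5 (B * g)"

primrec L :: "nat \<Rightarrow> rat fls" where
  "L 0 = P_A"
| "L (Suc n) = (if even n then U_A (L n) else U_B (L n))"

lemma L_odd: "L (2 * \<alpha> + 1) = U_A (L (2 * \<alpha>))"
  and L_even: "L (2 * \<alpha> + 2) = U_B (L (2 * \<alpha> + 1))"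
  by simp_all

definition discrete_array :: "(int \<times> int \<Rightarrow> int) \<Rightarrow> bool" where
  "discrete_array l \<longleftrightarrow> (\<forall>i. finite {j. l (i, j) \<noteq> 0})"

text \<open>
  The value lies in \<^typ>\<open>ereal\<close> so that it can be compared with an arbitrary integer,
  in particular when the argument is \<open>0\<close>.
\<close>

definition \<nu>\<^sub>5 :: "int \<Rightarrow> ereal" where
  "\<nu>\<^sub>5 x = (if x = 0 then \<infinity> else ereal (real (multiplicity 5 x)))"

text \<open>
  The series \<open>\<Sum>n\<ge>n0. l(i,n) t^n\<close>. For a discrete array only finitely many terms are
  nonzero, and the sum is the finite sum over those; integer powers of \<^const>\<open>t\<close> are taken
  in the field \<^typ>\<open>rat fls\<close>.
\<close>

definition t_sum :: "(int \<times> int \<Rightarrow> int) \<Rightarrow> int \<Rightarrow> int \<Rightarrow> rat fls" where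
  "t_sum l i n0 = (\<Sum>n | n \<ge> n0 \<and> l (i, n) \<noteq> 0. of_int (l (i, n)) * t powi n)"

end

theory Submission
  imports Defs
begin

text \<open>
  Let \<open>s = 1/t\<close>, \<open>\<phi> = J\<^sub>1\<^sup>2/J\<^sub>2\<close>, and let \<open>V\<^sub>5\<close> be the substitution of \<open>q\<^sup>5\<close> for \<open>q\<close>. By the triple product,
  \<open>J\<^sub>1\<close> and \<open>\<phi>\<close> are theta series, so their terms can be sorted by the residue of the exponent
  modulo 5. Comparing residue classes in \<open>J\<^sub>1\<^sup>2 = J\<^sub>2 \<phi>\<close> yields Ramanujan's parametrisation of level 10;
  as a consequence \<open>\<phi>/V\<^sub>2\<^sub>5 \<phi> = 1 + 2 x\<close>, where \<open>x\<close> is a root of an explicit quintic over the rational functions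
  in \<open>\<sigma> = V\<^sub>5 (J\<^sub>2 J\<^sub>5\<^sup>5 / (q J\<^sub>1 J\<^sub>1\<^sub>0\<^sup>5))\<close>, and \<open>J\<^sub>1/(q J\<^sub>2\<^sub>5)\<close> is a polynomial in \<open>x\<close>. Norms over the fifth roots of unity
  identify \<open>\<sigma>\<close> with \<open>V\<^sub>5 s - 1\<close>.

  The series \<open>P_A\<close> and \<open>P_B\<close> have level 20, but the relation between \<open>s\<close> and \<open>V\<^sub>2 s\<close> shows that
  \<open>P_A\<^sup>2\<close> and \<open>P_B / P_A\<close> are rational in \<open>t\<close>. Hence \<open>A P_A s / V\<^sub>5 P_B\<close> and \<open>B P_B / V\<^sub>5 P_A\<close> lie in the
  quintic extension, where \<open>U\<^sub>5\<close> is a linear functional known on the powers of \<open>x\<close>. This gives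
  \<open>U_A (P_A t\<^sup>n)\<close> and \<open>U_B (P_B t\<^sup>n)\<close> for five consecutive \<open>n\<close>; the other \<open>n\<close> follow from the modular
  equation of \<open>t\<close>, a recurrence of order 5 along which lower bounds for the 5-adic valuations
  of the coefficients propagate with a gain.
\<close>

section \<open>Infinite products\<close>

text \<open>\<open>P_A\<close> and \<open>P_B\<close> are square roots over the rational functions
  in \<open>t\<close>, so \<open>U\<^sub>5\<close> cannot be computed on them directly. It is,
  however, linear over series in q^5: a factor \<open>V 5 P_B\<close> or \<open>V 5 P_A\<close> can
  be split off, and the square root that remains turns out to exist in the quintic extension. There
  \<open>U\<^sub>5\<close> is easy on powers of x, because x is the sum of a series of residue class
  1 and one of class 4 whose product is \<open>- 1 / \<sigma>\<close>, so that only balanced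
  monomials survive.

  Several relations are first obtained only up to a cube, a square or a spurious factor; leading
  coefficients decide which root or factor holds.

  The five initial exponents are -4, ..., 0, since the recurrence improves the bounds only past its
  initial values, and the improvement is wanted for every n >= 1. It amounts to 2 on a scale where
  one power of 5 counts 4.\<close>

definition fps_eqm :: "nat \<Rightarrow> 'a fps \<Rightarrow> 'a fps \<Rightarrow> bool" where
  "fps_eqm m f g \<longleftrightarrow> (\<forall>i<m. fps_nth f i = fps_nth g i)"

lemma fps_eqm_refl [simp]: "fps_eqm m f f"
  by (simp add: fps_eqm_def)

lemma fps_eqm_sym: "fps_eqm m f g \<Longrightarrow> fps_eqm m g f"
  by (simp add: fps_eqm_def)

lemma fps_eqm_trans [trans]: "fps_eqm m f g \<Longrightarrow> fps_eqm m g h \<Longrightarrow> fps_eqm m f h"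
  by (simp add: fps_eqm_def)

text \<open>Identities between infinite products reduce in this way to finite products modulo q^m
  for every m; only \<open>J_eq_qprod\<close> touches the topology of power series.\<close>

lemma fps_eqI_eqm: "(\<And>m. fps_eqm m f g) \<Longrightarrow> f = g"
  by (metis fps_eqm_def fps_ext lessI)

lemma fps_eqm_mult:
  fixes f g :: "'a::comm_ring_1 fps"
  assumes "fps_eqm m f f'" "fps_eqm m g g'"
  shows "fps_eqm m (f * g) (f' * g')"
  using assms unfolding fps_eqm_def
  by (auto simp: fps_mult_nth intro!: sum.cong)

lemma fps_eqm_prod:
  fixes f :: "'b \<Rightarrow> 'a::comm_ring_1 fps"
  shows "(\<And>i. i \<in> S \<Longrightarrow> fps_eqm m (f i) (g i)) \<Longrightarrow> fps_eqm m (prod f S) (prod g S)"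
  by (induction S rule: infinite_finite_induct) (auto intro: fps_eqm_mult)

lemma fps_eqm_1_minus_X_power: "m \<le> k \<Longrightarrow> fps_eqm m (1 - fps_X ^ k) (1 :: 'a::comm_ring_1 fps)"
  by (auto simp: fps_eqm_def)

definition qpart :: "nat \<Rightarrow> nat \<Rightarrow> nat \<Rightarrow> 'a::comm_ring_1 fps" where
  "qpart c b M = (\<Prod>m<M. 1 - fps_X ^ (c + b * m))"

text \<open>The infinite product (q^c; q^b), read off coefficientwise: for c, b >= 1 the factors of
  index above n have exponents above n and leave coefficient n alone.\<close>

definition qprod :: "nat \<Rightarrow> nat \<Rightarrow> 'a::comm_ring_1 fps" where
  "qprod c b = Abs_fps (\<lambda>n. fps_nth (qpart c b (Suc n)) n)"

lemma qpart_Suc: "qpart c b (Suc M) = qpart c b M * (1 - fps_X ^ (c + b * M))"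
  by (simp add: qpart_def)

lemma qpart_stable:
  assumes "c \<ge> 1" "b \<ge> 1" "m \<le> Suc M"
  shows "fps_eqm m (qpart c b (M + d)) (qpart c b M :: 'a::comm_ring_1 fps)"
proof (induction d)
  case (Suc d)
  have "m \<le> c + b * (M + d)"
    using assms by (metis (no_types, opaque_lifting) add.commute add_mono le_add1 mult_le_mono1
      nat_mult_1 order_trans plus_1_eq_Suc)
  then have "fps_eqm m (qpart c b (M + d) * (1 - fps_X ^ (c + b * (M
      + d)))) (qpart c b M * 1 :: 'a fps)"
    by (intro fps_eqm_mult fps_eqm_1_minus_X_power Suc)
  then show ?case
    by (simp add: qpart_Suc)
qed auto

lemma qpart_eqm_qprod:
  assumes "c \<ge> 1" "b \<ge> 1" "m \<le> Suc M"
  shows "fps_eqm m (qpart c b M) (qprod c b :: 'a::comm_ring_1 fps)"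
  unfolding fps_eqm_def
proof (intro allI impI)
  fix i assume i: "i < m"
  have "fps_nth (qpart c b (Suc i + M)) i = fps_nth (qpart c b M :: 'a fps) i"
    using qpart_stable[OF assms, of "Suc i", where 'a='a] i by (simp add: fps_eqm_def add.commute)
  moreover have "fps_nth (qpart c b (Suc i + M)) i = fps_nth (qpart c b (Suc i) :: 'a fps) i"
    using qpart_stable[OF assms(1,2), of "Suc i" "Suc i" M, where 'a='a] by (simp add: fps_eqm_def)
  ultimately show "fps_nth (qpart c b M) i = fps_nth (qprod c b :: 'a fps) i"
    by (simp add: qprod_def)
qed

lemma qprod_nth_0 [simp]: "c \<ge> 1 \<Longrightarrow> fps_nth (qprod c b) 0 = 1"
  by (simp add: qprod_def qpart_def)

lemma J_eq_qprod:
  assumes k: "k \<ge> 1"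
  shows "J k = fps_to_fls (qprod k k)"
proof -
  define f :: "nat \<Rightarrow> rat fps" where "f = (\<lambda>m. 1 - fps_X ^ (k * Suc m))"
  have "(\<lambda>n. \<Prod>i<n. f i) \<longlonglongrightarrow> (\<Prod>m. f m)"
    using J_product_has_prod[OF k] has_prod_imp_tendsto' unfolding f_def by blast
  then have lim: "\<forall>\<^sub>F n in sequentially. fps_nth (\<Prod>i<n. f i) i = fps_nth (\<Prod>m. f m) i" for i
    unfolding tendsto_fps_iff by blast
  have part: "(\<Prod>i<n. f i) = qpart k k n" for n
    by (simp add: f_def qpart_def)
  have "fps_nth (\<Prod>m. f m) i = fps_nth (qprod k k) i" for i
  proof -
    have "\<forall>\<^sub>F n in sequentially. fps_nth (\<Prod>m. f m) i = fps_nth (qprod k k) i"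
      using lim[of i] eventually_ge_at_top[of i]
    proof eventually_elim
      case (elim n)
      then show ?case
        using qpart_eqm_qprod[OF k k, of "Suc i" n] by (metis Suc_le_mono fps_eqm_def lessI part)
    qed
    then show ?thesis
      by (simp add: eventually_False_sequentially)
  qed
  then show ?thesis
    by (simp add: J_def f_def fps_ext)
qed

lemma J_nonzero [simp]: "k \<ge> 1 \<Longrightarrow> J k \<noteq> 0"
  by (metis J_eq_qprod fps_nonzeroI fps_to_fls_eq_0_iff qprod_nth_0 zero_neq_one)

lemma qpart_add: "qpart c b (M + N) = qpart c b M * (\<Prod>i<N. 1 - fps_X ^ (c + b * (M + i)))"
  by (induction N) (simp_all add: qpart_Suc mult_ac qpart_def)

lemma qpart_regroup:
  "(qpart c b (k * M) :: 'a::comm_ring_1 fps) = (\<Prod>i<k. qpart (c + i * b) (k * b) M)"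
proof (induction M)
  case (Suc M)
  have "(qpart c b (k * Suc M) :: 'a fps) = qpart c b (k * M + k)"
    by (simp add: add.commute)
  then show ?case
    unfolding qpart_Suc prod.distrib by (simp only: qpart_add Suc) (simp add: algebra_simps)
qed (simp add: qpart_def)

text \<open>Sorts the factors by the residue of their index modulo k.\<close>

lemma qprod_regroup:
  assumes "c \<ge> 1" "b \<ge> 1" "k \<ge> 1"
  shows "qprod c b = (\<Prod>i<k. qprod (c + i * b) (k * b))"
proof (rule fps_eqI_eqm)
  fix m
  have "fps_eqm m (qprod c b) (qpart c b (k * m))"
    using assms by (intro fps_eqm_sym[OF qpart_eqm_qprod]) (auto intro: le_SucI)
  also have "fps_eqm m \<dots> (\<Prod>i<k. qprod (c + i * b) (k * b))"
    unfolding qpart_regroup using assms by (intro fps_eqm_prod qpart_eqm_qprod) auto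
  finally show "fps_eqm m (qprod c b) (\<Prod>i<k. qprod (c + i * b) (k * b))" .
qed

lemma qprod_compose_power:
  assumes "c \<ge> 1" "b \<ge> 1" "k \<ge> 1"
  shows "qprod c b oo fps_X ^ k = (qprod (k * c) (k * b) :: 'a::idom fps)"
proof (rule fps_ext)
  fix n
  have X: "fps_nth (fps_X ^ k :: 'a fps) 0 = 0"
    using assms by simp
  have fps_X_power_compose: "fps_X ^ i oo fps_X ^ k = (fps_X ^ (k * i) :: 'a fps)" for i
    using fps_compose_power[OF X, of fps_X i] X by (simp add: power_mult)
  have part: "qpart c b M oo fps_X ^ k = (qpart (k * c) (k * b) M :: 'a fps)" for M
    unfolding qpart_def
    by (subst fps_compose_prod_distrib[OF X])
       (simp add: fps_compose_sub_distrib fps_X_power_compose algebra_simps)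
  have "fps_nth (qprod c b oo fps_X ^ k :: 'a fps) n =
        (if k dvd n then fps_nth (qprod c b) (n div k) else 0)"
    by (rule fps_nth_compose_X_power)
  also have "\<dots> = (if k dvd n then fps_nth (qpart c b (Suc n)) (n div k) else 0)"
    using qpart_eqm_qprod[OF assms(1,2), of "Suc n" "Suc n", where 'a='a]
    by (simp add: fps_eqm_def div_le_dividend le_imp_less_Suc)
  also have "\<dots> = fps_nth (qpart c b (Suc n) oo fps_X ^ k :: 'a fps) n"
    by (simp add: fps_nth_compose_X_power)
  also have "\<dots> = fps_nth (qpart (k * c) (k * b) (Suc n)) n"
    by (simp only: part)
  finally show "fps_nth (qprod c b oo fps_X ^ k :: 'a fps) n = fps_nth (qprod (k * c) (k * b)) n"
    by (simp add: qprod_def)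
qed

section \<open>The Jacobi triple product\<close>

text \<open>The Gaussian binomial coefficient at x. The Pascal rule defines it over any commutative
  ring, without quotients of q-factorials.\<close>

fun gauss_poly :: "'a::comm_ring_1 \<Rightarrow> nat \<Rightarrow> nat \<Rightarrow> 'a" where
  "gauss_poly x M 0 = 1"
| "gauss_poly x 0 (Suc k) = 0"
| "gauss_poly x (Suc M) (Suc k) = gauss_poly x M (Suc k) + x ^ (M - k) * gauss_poly x M k"

lemma gauss_poly_eq_0: "M < k \<Longrightarrow> gauss_poly x M k = 0"
  by (induction x M k rule: gauss_poly.induct) auto

lemma gauss_poly_self: "gauss_poly x M M = 1"
  by (induction M) (auto simp: gauss_poly_eq_0)

text \<open>The q-factorial formula with denominators cleared. With M = j + 1 + d the Pascal rule
  comes down to (1 - x^(d+1)) + x^(d+1) (1 - x^(j+1)) = 1 - x^(M+1).\<close>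

lemma gauss_poly_pochhammer:
  fixes x :: "'a::comm_ring_1"
  defines "p \<equiv> \<lambda>n. \<Prod>i<n. 1 - x ^ Suc i"
  assumes "k \<le> M"
  shows "gauss_poly x M k * p k * p (M - k) = p M"
  using assms(2)
proof (induction M arbitrary: k)
  case (Suc M)
  show ?case
  proof (cases k)
    case 0
    then show ?thesis by (simp add: p_def)
  next
    case (Suc j)
    show ?thesis
    proof (cases "j = M")
      case True
      then show ?thesis using Suc by (simp add: gauss_poly_self gauss_poly_eq_0 p_def)
    next
      case False
      then have j: "j < M" using Suc Suc.prems by simp
      then obtain d where d: "M = Suc j + d"
        using less_imp_Suc_add by force
      have IH1: "gauss_poly x M (Suc j) * p (Suc j) * p d = p M"
        using Suc.IH[of "Suc j"] j d by simp
      have IH2: "gauss_poly x M j * p j * p (Suc d) = p M"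
        using Suc.IH[of j] j d by simp
      have pS: "p (Suc n) = p n * (1 - x ^ Suc n)" for n
        by (simp add: p_def)
      have "gauss_poly x (Suc M) k * p k * p (Suc M - k) =
         (gauss_poly x M (Suc j) + x ^ Suc d * gauss_poly x M j) * p (Suc j) * p (Suc d)"
        using Suc d by simp
      also have "\<dots> = (gauss_poly x M (Suc j) * p (Suc j) * p d) * (1 - x ^ Suc d) +
           x ^ Suc d * (1 - x ^ Suc j) * (gauss_poly x M j * p j * p (Suc d))"
        by (simp add: pS algebra_simps)
      also have "\<dots> = p M * (1 - x ^ Suc d + x ^ Suc d * (1 - x ^ Suc j))"
        unfolding IH1 IH2 by (simp add: algebra_simps)
      also have "\<dots> = p M * (1 - x ^ Suc M)"
        by (simp add: d algebra_simps power_add)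
      finally show ?thesis by (simp add: pS)
    qed
  qed
qed (simp add: p_def)

lemma choose_two_Suc: "Suc k choose 2 = (k choose 2) + k"
  by (simp add: numeral_2_eq_2)

text \<open>The variable u homogenises the q-binomial theorem: with u = Q^N the negative powers of Q
  in the symmetric form of the triple product never appear.\<close>

lemma q_binomial:
  fixes x u y :: "'a::comm_ring_1"
  shows "(\<Prod>i<M. u + y * x ^ i) =
    (\<Sum>k\<le>M. gauss_poly x M k * x ^ (k choose 2) * y ^ k * u ^ (M - k))"
proof (induction M)
  case (Suc M)
  define f where "f = (\<lambda>M k. gauss_poly x M k * x ^ (k choose 2) * y ^ k * u ^ (M - k))"
  have "(\<Prod>i<Suc M. u + y * x ^ i) = (\<Sum>k\<le>M. f M k) * (u + y * x ^ M)"
    using Suc by (simp add: f_def)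
  also have "\<dots> = (\<Sum>k\<le>M. f M k * u) + (\<Sum>k\<le>M. f M k * y * x ^ M)"
    by (simp add: distrib_left sum_distrib_right mult.assoc)
  also have "(\<Sum>k\<le>M. f M k * u) = (\<Sum>k\<le>Suc M. gauss_poly x M k * x ^ (k choose 2) * y ^ k
      * u ^ (Suc M - k))"
    by (simp add: gauss_poly_eq_0 f_def Suc_diff_le mult_ac)
  also have "\<dots> = u ^ Suc M + (\<Sum>k\<le>M. gauss_poly x M (Suc k) * x ^ (Suc k choose 2) * y ^ Suc k
      * u ^ (M - k))"
    by (subst sum.atMost_Suc_shift) (simp add: numeral_2_eq_2)
  also have "(\<Sum>k\<le>M. f M k * y * x ^ M) =
     (\<Sum>k\<le>M. x ^ (M - k) * gauss_poly x M k * x ^ (Suc k choose 2) * y ^ Suc k * u ^ (M - k))"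
  proof (rule sum.cong[OF refl])
    fix k assume "k \<in> {..M}"
    then have "x ^ M = x ^ (M - k) * x ^ k"
      by (simp flip: power_add)
    then show "f M k * y * x ^ M = x ^ (M - k) * gauss_poly x M k * x ^ (Suc k choose 2)
      * y ^ Suc k * u ^ (M - k)"
      unfolding f_def choose_two_Suc by (simp add: power_add mult_ac)
  qed
  also have "u ^ Suc M + (\<Sum>k\<le>M. gauss_poly x M (Suc k) * x ^ (Suc k choose 2) * y ^ Suc k
      * u ^ (M - k)) +
     (\<Sum>k\<le>M. x ^ (M - k) * gauss_poly x M k * x ^ (Suc k choose 2) * y ^ Suc k * u ^ (M - k)) =
     u ^ Suc M + (\<Sum>k\<le>M. f (Suc M) (Suc k))"
    unfolding add.assoc sum.distrib[symmetric] by (simp add: f_def algebra_simps)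
  also have "\<dots> = (\<Sum>k\<le>Suc M. f (Suc M) k)"
    by (simp add: sum.atMost_Suc_shift f_def numeral_2_eq_2 del: sum.atMost_Suc)
  finally show ?case by (simp add: f_def)
qed (simp add: numeral_2_eq_2)

definition theta_exp :: "nat \<Rightarrow> nat \<Rightarrow> int \<Rightarrow> int" where
  "theta_exp a b n = int b * (n * (n - 1) div 2) + int a * n"

definition theta_sgn :: "int \<Rightarrow> rat" where
  "theta_sgn n = (if even n then 1 else -1)"

lemma two_theta_exp: "2 * theta_exp a b n = int b * n * (n - 1) + 2 * int a * n"
proof -
  have "2 * (n * (n - 1) div 2) = n * (n - 1)"
    by simp
  then show ?thesis
    unfolding theta_exp_def by (metis (no_types, lifting) distrib_left mult.assoc mult.left_commute)
qed

text \<open>Only |n| <= i can contribute to the coefficient of q^i, so the fibres of the exponent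
  are finite and the bilateral sum may be cut off.\<close>

lemma abs_le_theta_exp:
  assumes "a \<ge> 1" "a < b"
  shows "\<bar>n\<bar> \<le> theta_exp a b n"
proof (cases "n \<ge> 0")
  case True
  have "n * (n - 1) \<ge> 0"
    using True by (cases "n = 0") auto
  then have 1: "int b * (n * (n - 1)) \<ge> 0"
    by simp
  have 2: "int a * n \<ge> 1 * n"
    using True assms by (intro mult_right_mono) auto
  have "2 * theta_exp a b n = int b * (n * (n - 1)) + 2 * (int a * n)"
    unfolding two_theta_exp by (simp only: mult.assoc)
  then have "n \<le> theta_exp a b n"
    using 1 2 by linarith
  with True show ?thesis by simp
next
  case False
  define m where "m = -n"
  have m: "m \<ge> 1" using False by (simp add: m_def)
  have 1: "(int b - int a - 1) * m \<ge> 0"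
    using m assms by (intro mult_nonneg_nonneg) auto
  have 2: "int b * (m * (m - 1)) \<ge> 0"
    using m by (intro mult_nonneg_nonneg) auto
  have "2 * theta_exp a b n = int b * (m * (m - 1)) + 2 * ((int b - int a - 1) * m) + 2 * m"
    unfolding two_theta_exp m_def by (simp add: algebra_simps)
  then have "m \<le> theta_exp a b n"
    using 1 2 by linarith
  with m show ?thesis by (simp add: m_def)
qed

lemma finite_theta_exp:
  assumes "a \<ge> 1" "a < b"
  shows "finite {n. theta_exp a b n = i}"
proof (rule finite_subset)
  show "{n. theta_exp a b n = i} \<subseteq> {-i..i}"
  proof
    fix n assume "n \<in> {n. theta_exp a b n = i}"
    then show "n \<in> {-i..i}"
      using abs_le_theta_exp[OF assms, of n] by auto
  qed
qed simp

definition theta :: "nat \<Rightarrow> nat \<Rightarrow> rat fps" where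
  "theta a b = Abs_fps (\<lambda>i. \<Sum>n | theta_exp a b n = int i. theta_sgn n)"

lemma prod_lessThan_add:
  fixes f :: "nat \<Rightarrow> 'a::comm_monoid_mult"
  shows "(\<Prod>i<M + N. f i) = (\<Prod>i<M. f i) * (\<Prod>i<N. f (M + i))"
  by (induction N) (simp_all add: mult.assoc)

text \<open>The q-binomial theorem with 2N factors, recentred so that the index runs from -N to N.
  The factors with i >= N give the product from a; those with i < N, after a signed monomial is
  pulled out and their order is reversed, give the product from b - a.\<close>

lemma finite_triple_product:
  assumes a: "a \<ge> 1" "a < b"
  shows "qpart a b N * qpart (b - a) b N =
    (\<Sum>n=-int N..int N. fps_const (theta_sgn n) * fps_X ^ nat (theta_exp a b n) *
        gauss_poly (fps_X ^ b) (2 * N) (nat (n + int N)))"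
proof -
  let ?X = "fps_X :: rat fps"
  define Q where "Q = ?X ^ b"
  define Z where "Z = ?X ^ a"
  \<comment> \<open>The exponent of the monomial pulled out of all 2N factors together; it is
    cancelled at the end.\<close>
  define mon where "mon = b * (N choose 2) + a * N + b * N ^ 2"
  have "(\<Prod>i<2*N. Q ^ N + (- Z) * Q ^ i) =
     (\<Prod>i<N. Q ^ N - Z * Q ^ i) * (\<Prod>i<N. Q ^ N - Z * Q ^ (N + i))"
    using prod_lessThan_add[of "\<lambda>i. Q ^ N + (- Z) * Q ^ i" N N] by (simp flip: mult_2)
  also have "(\<Prod>i<N. Q ^ N - Z * Q ^ (N + i)) = (\<Prod>i<N. Q ^ N * (1 - ?X ^ (a + b * i)))"
    by (intro prod.cong refl) (simp add: Q_def Z_def power_add algebra_simps flip: power_mult)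
  also have "\<dots> = ?X ^ (b * N ^ 2) * qpart a b N"
    by (simp add: prod.distrib qpart_def Q_def power2_eq_square mult_ac flip: power_mult)
  also have "(\<Prod>i<N. Q ^ N - Z * Q ^ i) = (-1) ^ N * ?X ^ (b * (N choose 2) + a * N) * qpart (b
      - a) b N"
  proof -
    have "(\<Prod>i<N. Q ^ N - Z * Q ^ i) = (\<Prod>i<N. - (?X ^ (b * i + a)) * (1 - ?X ^ (b - a + b * (N
      - Suc i))))"
    proof (intro prod.cong refl)
      fix i assume "i \<in> {..<N}"
      then have "i < N" by simp
      then obtain d where d: "N = Suc i + d"
        using less_imp_Suc_add by force
      have "?X ^ (b * N) = ?X ^ (b * i + a) * ?X ^ (b - a + b * d)"
        using a d by (simp add: algebra_simps flip: power_add)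
      then show "Q ^ N - Z * Q ^ i = - (?X ^ (b * i + a)) * (1 - ?X ^ (b - a + b * (N - Suc i)))"
        using d by (simp add: Q_def Z_def algebra_simps flip: power_mult power_add)
    qed
    also have "\<dots> = (\<Prod>i<N. - (?X ^ (b * i + a))) * (\<Prod>i<N. 1 - ?X ^ (b - a + b * (N - Suc i)))"
      by (rule prod.distrib)
    also have "(\<Prod>i<N. 1 - ?X ^ (b - a + b * (N - Suc i))) = qpart (b - a) b N"
      unfolding qpart_def by (rule prod.nat_diff_reindex)
    also have "(\<Prod>i<N. - (?X ^ (b * i + a))) = (-1) ^ N * ?X ^ (b * (N choose 2) + a * N)"
      by (induction N) (simp_all add: choose_two_Suc power_add algebra_simps, simp add: numeral_2_eq_2)
    finally show ?thesis .
  qed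
  finally have lhs: "(\<Prod>i<2*N. Q ^ N + (- Z) * Q ^ i) =
     (-1) ^ N * ?X ^ mon * (qpart a b N * qpart (b - a) b N)"
    by (simp add: mon_def power_add mult_ac)
  have "(\<Prod>i<2*N. Q ^ N + (- Z) * Q ^ i) =
     (\<Sum>k\<le>2*N. gauss_poly Q (2*N) k * Q ^ (k choose 2) * (-Z) ^ k * (Q ^ N) ^ (2 * N - k))"
    by (rule q_binomial)
  also have "\<dots> = (\<Sum>n=-int N..int N. (-1) ^ N * ?X ^ mon * (fps_const (theta_sgn n) *
      fps_X ^ nat (theta_exp a b n) *
        gauss_poly (fps_X ^ b) (2 * N) (nat (n + int N))))"
  proof (rule sum.reindex_bij_witness[of _ "\<lambda>n. nat (n + int N)" "\<lambda>k. int k - int N"])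
    fix k assume "k \<in> {..2*N}"
    then have k: "k \<le> 2 * N" by simp
    define n where "n = int k - int N"
    have e0: "theta_exp a b n \<ge> 0"
      using abs_le_theta_exp[OF a, of n] by linarith
    have c2: "2 * int (m choose 2) = int m * (int m - 1)" for m
      by (induction m) (simp_all add: choose_two_Suc algebra_simps)
    \<comment> \<open>Doubled so that binomial coefficients and \<open>theta_exp\<close> become
      polynomials.\<close>
    have "2 * int (b * (k choose 2) + a * k + b * N * (2 * N - k)) = 2 * (int mon
      + theta_exp a b n)"
    proof -
      have "2 * int (b * (k choose 2) + a * k + b * N * (2 * N - k)) =
          int b * (2 * int (k choose 2)) + 2 * int a * int k + 2 * int b * int N * (2 * int N
        - int k)"
        using k by (simp only: of_nat_add of_nat_mult of_nat_diff of_nat_numeral) (simp add: algebra_simps)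
      moreover have "2 * int mon = int b * (2 * int (N choose 2)) + 2 * int a * int N
      + 2 * int b * int N ^ 2"
        by (simp add: mon_def algebra_simps)
      ultimately show ?thesis
        unfolding c2 distrib_left[of 2 "int mon"] two_theta_exp n_def
        by (simp add: algebra_simps power2_eq_square)
    qed
    then have "int (b * (k choose 2) + a * k + b * N * (2 * N - k)) = int (mon
      + nat (theta_exp a b n))"
      using e0 unfolding mult_left_cancel[OF zero_neq_numeral[symmetric]] by simp
    then have ex: "b * (k choose 2) + a * k + b * N * (2 * N - k) = mon + nat (theta_exp a b n)"
      by (simp only: of_nat_eq_iff)
    have sg: "(-1) ^ k = (-1) ^ N * (fps_const (theta_sgn n) :: rat fps)"
    proof -
      have "even n \<longleftrightarrow> (even k \<longleftrightarrow> even N)"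
        by (auto simp: n_def)
      then show ?thesis
        by (cases "even k"; cases "even N") (auto simp: theta_sgn_def)
    qed
    have E: "gauss_poly Q (2*N) k * Q ^ (k choose 2) * (-Z) ^ k * (Q ^ N) ^ (2 * N - k) =
       (-1) ^ k * ?X ^ (b * (k choose 2) + a * k + b * N * (2 * N - k)) * gauss_poly Q (2*N) k"
      by (simp add: Q_def Z_def power_add power_minus[of "?X ^ a"] mult_ac flip: power_mult)
    show "(-1) ^ N * ?X ^ mon * (fps_const (theta_sgn (int k
      - int N)) * fps_X ^ nat (theta_exp a b (int k - int N)) *
        gauss_poly (fps_X ^ b) (2 * N) (nat (int k - int N + int N))) =
      gauss_poly Q (2*N) k * Q ^ (k choose 2) * (-Z) ^ k * (Q ^ N) ^ (2 * N - k)"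
      unfolding E ex sg by (simp add: n_def Q_def power_add mult_ac)
  qed auto
  also have "\<dots> = (-1) ^ N * ?X ^ mon * (\<Sum>n=-int N..int N. fps_const (theta_sgn n) *
      fps_X ^ nat (theta_exp a b n) *
        gauss_poly (fps_X ^ b) (2 * N) (nat (n + int N)))"
    by (simp add: sum_distrib_left)
  finally have "((-1) ^ N * ?X ^ mon) * (qpart a b N * qpart (b - a) b N) = ((-1) ^ N * ?X ^ mon) *
     (\<Sum>n=-int N..int N. fps_const (theta_sgn n) * fps_X ^ nat (theta_exp a b n) *
        gauss_poly (fps_X ^ b) (2 * N) (nat (n + int N)))"
    unfolding lhs .
  then show ?thesis
    by (subst (asm) mult_left_cancel) auto
qed

text \<open>The limit of the finite form: the Gaussian coefficient of 2N over N + n tends to the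
  reciprocal of (q^b; q^b).\<close>

theorem jacobi_triple_product:
  assumes a: "a \<ge> 1" "a < b"
  shows "theta a b = qprod b b * qprod a b * qprod (b - a) b"
proof (rule fps_ext)
  fix i
  let ?X = "fps_X :: rat fps"
  let ?P = "qprod b b :: rat fps"
  define m where "m = Suc i"
  \<comment> \<open>For |n| < m both N + n and N - n exceed m, so all three q-factorials in the
    Gaussian coefficient agree with the infinite product modulo q^m.\<close>
  define N where "N = 2 * m"
  define G where "G = (\<lambda>n. gauss_poly (?X ^ b) (2 * N) (nat (n + int N)))"
  have b: "b \<ge> 1" "b - a \<ge> 1" using a by auto
  have P_part: "(\<Prod>i<k. 1 - (?X ^ b) ^ Suc i) = qpart b b k" for k
    by (simp add: qpart_def power_add flip: power_mult)
  have GP: "fps_eqm m (G n * ?P) 1" if "\<bar>n\<bar> < int m" for n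
  proof -
    define k where "k = nat (n + int N)"
    have k: "m \<le> k" "m \<le> 2 * N - k" "k \<le> 2 * N"
      using that by (auto simp: k_def N_def)
    have "fps_eqm m (G n * ?P * ?P) (G n * qpart b b k * qpart b b (2 * N - k))"
      using b k by (intro fps_eqm_mult fps_eqm_refl fps_eqm_sym[OF qpart_eqm_qprod]) auto
    also have "G n * qpart b b k * qpart b b (2 * N - k) = qpart b b (2 * N)"
      using gauss_poly_pochhammer[OF k(3), of "?X ^ b"] unfolding P_part by (simp add: G_def k_def)
    also have "fps_eqm m \<dots> ?P"
      using b k by (intro qpart_eqm_qprod) auto
    finally have "fps_eqm m (G n * ?P * ?P * inverse ?P) (?P * inverse ?P)"
      by (rule fps_eqm_mult) simp
    moreover have "?P * inverse ?P = 1"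
      using b by (intro inverse_mult_eq_1') simp
    ultimately show ?thesis
      by (simp add: mult.assoc)
  qed
  have "fps_nth (?P * qprod a b * qprod (b - a) b) i = fps_nth (qpart a b N * qpart (b
      - a) b N * ?P) i"
  proof -
    have "fps_eqm m (qprod a b * qprod (b - a) b * ?P) (qpart a b N * qpart (b - a) b N * ?P)"
      using a b by (intro fps_eqm_mult fps_eqm_refl fps_eqm_sym[OF qpart_eqm_qprod]) (auto simp: N_def)
    then show ?thesis
      by (simp add: fps_eqm_def m_def mult_ac)
  qed
  also have "\<dots> = (\<Sum>n=-int N..int N. fps_nth (fps_const (theta_sgn n)
      * (?X ^ nat (theta_exp a b n) * (G n * ?P))) i)"
    unfolding finite_triple_product[OF a] sum_distrib_right fps_sum_nth
    by (intro sum.cong refl) (simp add: G_def mult_ac)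
  also have "\<dots> = (\<Sum>n=-int N..int N. if theta_exp a b n = int i then theta_sgn n else 0)"
  proof (rule sum.cong[OF refl])
    fix n
    have e: "\<bar>n\<bar> \<le> theta_exp a b n" by (rule abs_le_theta_exp[OF a])
    show "fps_nth (fps_const (theta_sgn n) * (?X ^ nat (theta_exp a b n) * (G n * ?P))) i =
       (if theta_exp a b n = int i then theta_sgn n else 0)"
    proof (cases "theta_exp a b n > int i")
      case True
      then show ?thesis by (simp add: fps_X_power_mult_nth)
    next
      case False
      then have "\<bar>n\<bar> < int m" using e by (simp add: m_def)
      from GP[OF this] have "fps_nth (G n * ?P) (i - nat (theta_exp a b n)) = (if theta_exp a b n
      = int i then 1 else 0)"
        using False e by (auto simp: fps_eqm_def m_def)
      then show ?thesis
        using False e by (auto simp: fps_X_power_mult_nth)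
    qed
  qed
  also have "\<dots> = (\<Sum>n | theta_exp a b n = int i. theta_sgn n)"
  proof (rule sum.mono_neutral_cong_right)
    show "{n. theta_exp a b n = int i} \<subseteq> {- int N..int N}"
    proof
      fix n assume "n \<in> {n. theta_exp a b n = int i}"
      then show "n \<in> {- int N..int N}"
        using abs_le_theta_exp[OF a, of n] by (auto simp: N_def m_def)
    qed
  qed auto
  finally show "fps_nth (theta a b) i = fps_nth (?P * qprod a b * qprod (b - a) b) i"
    by (simp add: theta_def)
qed

unbundle fps_syntax

section \<open>Substitutions and residue classes of exponents\<close>

abbreviation V :: "nat \<Rightarrow> rat fls \<Rightarrow> rat fls" where "V n f \<equiv> fls_compose_power f n"

lemma V_q [simp]: "n > 0 \<Longrightarrow> V n q = q ^ n"
  by (simp add: fls_X_power_conv_shift_1)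

declare fls_compose_power_X [simp del] fls_inverse_X [simp del]

lemma V_numeral [simp]: "n > 0 \<Longrightarrow> V n (numeral k) = numeral k"
  by (metis fls_compose_power_const_left fls_const_numeral)

lemma V_inverse [simp]: "n > 0 \<Longrightarrow> V n (inverse f) = inverse (V n f)"
proof (cases "f = 0")
  case False
  assume n: "n > 0"
  have "V n f * V n (inverse f) = 1"
    using False n by (simp flip: fls_compose_power_mult)
  then show ?thesis
    by (simp add: inverse_unique)
qed auto

lemma V_divide [simp]: "n > 0 \<Longrightarrow> V n (f / g) = V n f / V n g"
  by (simp add: divide_inverse)

lemma V_eq_iff [simp]: "n > 0 \<Longrightarrow> V n f = V n g \<longleftrightarrow> f = g"
proof
  assume "n > 0" and eq: "V n f = V n g"
  show "f = g"
  proof (rule fls_eqI)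
    fix i
    have "V n f $$ (int n * i) = V n g $$ (int n * i)"
      by (simp add: eq)
    then show "f $$ i = g $$ i"
      using \<open>n > 0\<close> by (simp add: fls_nth_compose_power)
  qed
qed auto

lemma V_eq_0_iff [simp]: "n > 0 \<Longrightarrow> V n f = 0 \<longleftrightarrow> f = 0"
  using V_eq_iff[of n f 0] by simp

lemma V_V: "m > 0 \<Longrightarrow> n > 0 \<Longrightarrow> V m (V n f) = V (m * n) f"
  by (rule fls_eqI) (auto simp: fls_nth_compose_power mult.commute elim!: dvdE)

lemma V_J [simp]: "n > 0 \<Longrightarrow> k > 0 \<Longrightarrow> V n (J k) = J (n * k)"
  using qprod_compose_power[of k k n, where 'a=rat] J_eq_qprod[of k] J_eq_qprod[of "n * k"]
  by (simp add: fls_compose_power_fps_to_fls)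

section \<open>Residue classes of exponents modulo 5\<close>

definition cls :: "int \<Rightarrow> rat fls \<Rightarrow> bool" where
  "cls r f \<longleftrightarrow> (\<forall>n. f $$ n \<noteq> 0 \<longrightarrow> n mod 5 = r mod 5)"

lemma clsD: "cls r f \<Longrightarrow> n mod 5 \<noteq> r mod 5 \<Longrightarrow> f $$ n = 0"
  by (auto simp: cls_def)

lemma cls_cong: "cls r f \<Longrightarrow> r mod 5 = s mod 5 \<Longrightarrow> cls s f"
  by (simp add: cls_def)

lemma cls_add: "cls r f \<Longrightarrow> cls r g \<Longrightarrow> cls r (f + g)"
  unfolding cls_def by (metis fls_plus_nth add_0)

lemma cls_uminus: "cls r f \<Longrightarrow> cls r (- f)"
  by (simp add: cls_def)

lemma cls_diff: "cls r f \<Longrightarrow> cls r g \<Longrightarrow> cls r (f - g)"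
  using cls_add[of r f "- g"] by (simp add: cls_uminus)

lemma cls_mult:
  assumes "cls r f" "cls s g"
  shows "cls (r + s) (f * g)"
  unfolding cls_def
proof (intro allI impI)
  fix n assume "(f * g) $$ n \<noteq> 0"
  then obtain i where "f $$ i * g $$ (n - i) \<noteq> 0"
    unfolding fls_times_nth(2) by (rule sum.not_neutral_contains_not_neutral)
  then have "i mod 5 = r mod 5" "(n - i) mod 5 = s mod 5"
    using assms by (auto simp: cls_def)
  then have "(i + (n - i)) mod 5 = (r + s) mod 5"
    by (rule mod_add_cong)
  then show "n mod 5 = (r + s) mod 5" by simp
qed

lemma cls_V: "cls 0 (V 5 f)"
  by (simp add: cls_def fls_nth_compose_power)

lemma cls_1 [simp]: "cls 0 1"
  using cls_V[of 1] by simp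

lemma cls_numeral [simp]: "cls 0 (numeral k)"
  using cls_V[of "numeral k"] by simp

lemma cls_q: "cls 1 q"
  by (simp add: cls_def)

lemma cls_inverse_q: "cls (-1) (inverse q)"
  by (simp add: cls_def fls_inverse_X)

lemma cls_power: "cls r f \<Longrightarrow> cls (int n * r) (f ^ n)"
proof (induction n)
  case (Suc n)
  then show ?case
    using cls_mult[of r f "int n * r" "f ^ n"] by (simp add: algebra_simps)
qed simp

lemma cls_mult_V: "cls r f \<Longrightarrow> cls r (f * V 5 g)"
  using cls_mult[OF _ cls_V, of r f] by simp

lemma cls_divide_V: "cls r f \<Longrightarrow> cls r (f / V 5 g)"
  using cls_mult_V[of r f "inverse g"] by (simp add: divide_inverse)

lemma cls_numeral_mult: "cls r f \<Longrightarrow> cls r (numeral k * f)"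
  using cls_mult[OF cls_numeral, of r f] by simp

lemma cls_V2:
  assumes "cls r f"
  shows "cls (2 * r) (V 2 f)"
  unfolding cls_def
proof (intro allI impI)
  fix n assume "V 2 f $$ n \<noteq> 0"
  then obtain k where "n = 2 * k" "f $$ k \<noteq> 0"
    by (auto simp: fls_nth_compose_power split: if_splits)
  then show "n mod 5 = 2 * r mod 5"
    using assms by (simp add: cls_def mod_mult_cong)
qed

lemma cls_parts_unique:
  assumes "cls 0 f0" "cls 1 f1" "cls 2 f2" "cls 3 f3" "cls 4 f4"
    and "cls 0 g0" "cls 1 g1" "cls 2 g2" "cls 3 g3" "cls 4 g4"
    and "f0 + f1 + f2 + f3 + f4 = g0 + g1 + g2 + g3 + g4"
  shows "f0 = g0 \<and> f1 = g1 \<and> f2 = g2 \<and> f3 = g3 \<and> f4 = g4"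
proof -
  have eq: "f0 $$ n + f1 $$ n + f2 $$ n + f3 $$ n + f4 $$ n = g0 $$ n + g1 $$ n + g2 $$ n
      + g3 $$ n + g4 $$ n" for n
    using assms(11) by (metis fls_plus_nth)
  have "f0 $$ n = g0 $$ n \<and> f1 $$ n = g1 $$ n \<and> f2 $$ n = g2 $$ n \<and> f3 $$ n = g3 $$ n \<and> f4 $$ n
      = g4 $$ n" for n
  proof -
    have "n mod 5 \<in> {0,1,2,3,4}"
      using pos_mod_bound[of 5 n] pos_mod_sign[of 5 n] by auto
    then show ?thesis
      using eq[of n] assms(1-10)[THEN clsD, of n] by auto
  qed
  then show ?thesis
    by (auto intro: fls_eqI)
qed

section \<open>The operator \<open>U\<^sub>5\<close> and its linearity over series in q^5\<close>

lemma U5_nth [simp]: "U\<^sub>5 f $$ n = f $$ (5 * n)"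
  by transfer simp

lemma U5_add: "U\<^sub>5 (f + g) = U\<^sub>5 f + U\<^sub>5 g"
  by (rule fls_eqI) simp

lemma U5_uminus: "U\<^sub>5 (- f) = - U\<^sub>5 f"
  by (rule fls_eqI) simp

lemma U5_0 [simp]: "U\<^sub>5 0 = 0"
  by (rule fls_eqI) simp

lemma U5_sum: "U\<^sub>5 (sum f S) = (\<Sum>i\<in>S. U\<^sub>5 (f i))"
  by (induction S rule: infinite_finite_induct) (simp_all add: U5_add)

lemma U5_V [simp]: "U\<^sub>5 (V 5 f) = f"
  by (rule fls_eqI) (simp add: fls_nth_compose_power)

lemma U5_cls: "cls r f \<Longrightarrow> r mod 5 \<noteq> 0 \<Longrightarrow> U\<^sub>5 f = 0"
  using clsD[of r f "5 * n" for n] by (intro fls_eqI) simp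

text \<open>The class 0 part of g is \<open>V 5 (U\<^sub>5 g)\<close>. The rest of g has no exponent
  divisible by 5, and multiplication by a series in q^5 does not create one.\<close>

lemma U5_V_mult: "U\<^sub>5 (V 5 f * g) = f * U\<^sub>5 g"
proof -
  have "(V 5 f * (g - V 5 (U\<^sub>5 g))) $$ (5 * n) = 0" for n
  proof -
    have "V 5 f $$ i * (g - V 5 (U\<^sub>5 g)) $$ (5 * n - i) = 0" for i
      by (cases "5 dvd i") (auto simp: fls_nth_compose_power dvd_diff)
    then show ?thesis
      unfolding fls_times_nth(2) by (intro sum.neutral) blast
  qed
  then have "U\<^sub>5 (V 5 f * (g - V 5 (U\<^sub>5 g))) = 0"
    by (intro fls_eqI) simp
  moreover have "V 5 f * g = V 5 (f * U\<^sub>5 g) + V 5 f * (g - V 5 (U\<^sub>5 g))"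
    by (simp add: algebra_simps)
  ultimately show ?thesis
    by (simp only: U5_add U5_V) simp
qed

lift_definition cls_part :: "int \<Rightarrow> rat fls \<Rightarrow> rat fls" is
  "\<lambda>r f n. if n mod 5 = r mod 5 then f n else 0"
  by (auto elim: eventually_mono)

lemma cls_part_nth [simp]: "cls_part r f $$ n = (if n mod 5 = r mod 5 then f $$ n else 0)"
  by transfer simp

lemma cls_cls_part: "cls r (cls_part r f)"
  by (auto simp: cls_def)

section \<open>Theta series and their 5-dissections\<close>

abbreviation th :: "nat \<Rightarrow> nat \<Rightarrow> rat fls" where "th a b \<equiv> fps_to_fls (theta a b)"

lemma th_nth:
  assumes "a \<ge> 1" "a < b"
  shows "th a b $$ i = (\<Sum>n | theta_exp a b n = i. theta_sgn n)"
proof (cases "i \<ge> 0")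
  case True
  then show ?thesis by (simp add: theta_def)
next
  case False
  have "theta_exp a b n \<noteq> i" for n
    using abs_le_theta_exp[OF assms, of n] False by linarith
  then show ?thesis using False by simp
qed

lemma q_power_V_th_nth:
  assumes "a \<ge> 1" "a < b" "k \<ge> 1"
  shows "(q ^ c * V k (th a b)) $$ i = (\<Sum>n | int k * theta_exp a b n + int c = i. theta_sgn n)"
proof -
  have "(q ^ c * V k (th a b)) $$ i = V k (th a b) $$ (i - int c)"
    by (simp add: fls_X_power_times_conv_shift)
  also have "\<dots> = (\<Sum>n | int k * theta_exp a b n = i - int c. theta_sgn n)"
  proof (cases "int k dvd i - int c")
    case True
    then obtain j where "i - int c = int k * j" by blast
    with assms show ?thesis
      by (simp add: fls_nth_compose_power th_nth del: fps_to_fls_nth)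
  next
    case False
    then have "{n. int k * theta_exp a b n = i - int c} = {}"
      by (auto simp flip: dvd_def) (metis dvd_triv_left)
    with False assms show ?thesis
      by (simp add: fls_nth_compose_power del: fps_to_fls_nth)
  qed
  also have "{n. int k * theta_exp a b n = i - int c} = {n. int k * theta_exp a b n + int c = i}"
    by auto
  finally show ?thesis .
qed

lemma J1_conv: "J 1 = fps_to_fls (qprod 1 2) * J 2"
  using qprod_regroup[of 1 1 2, where 'a=rat]
  by (simp add: J_eq_qprod lessThan_Suc numeral_2_eq_2 mult_ac fls_times_fps_to_fls)

text \<open>Euler's pentagonal number theorem: the exponents 1, 2, 3 modulo 3 cover all
  factors.\<close>

lemma J1_theta: "J 1 = th 1 3"
  using qprod_regroup[of 1 1 3, where 'a=rat] jacobi_triple_product[of 1 3]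
  by (simp add: J_eq_qprod lessThan_Suc numeral_3_eq_3 mult_ac numeral_2_eq_2)

text \<open>Ramanujan's phi(-q), the alternating sum of q^(n^2) over all integers n.\<close>

definition \<phi> :: "rat fls" where "\<phi> = J 1 ^ 2 / J 2"

lemma phi_theta: "\<phi> = th 1 2"
proof -
  have "th 1 2 = J 2 * fps_to_fls (qprod 1 2) ^ 2"
    by (subst jacobi_triple_product)
       (simp_all add: J_eq_qprod fls_times_fps_to_fls power2_eq_square mult_ac)
  then show ?thesis
    unfolding \<phi>_def J1_conv by (simp add: power2_eq_square field_simps)
qed

text \<open>Together the two triple products contain the factors with exponents prime to 10, which
  form a quotient of the \<open>J k\<close>. This yields the product of \<open>\<gamma>1\<close> and
  \<open>\<gamma>4\<close>.\<close>

lemma theta_product_10: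
  "th 7 10 * th 9 10 * J 5 * J 2 = J 10 ^ 3 * J 1"
proof -
  let ?P = "\<lambda>c. fps_to_fls (qprod c 10) :: rat fls"
  have 1: "J 1 = ?P 1 * ?P 3 * ?P 5 * ?P 7 * ?P 9 * J 2"
    unfolding J1_conv using qprod_regroup[of 1 2 5, where 'a=rat]
    by (simp add: eval_nat_numeral fls_times_fps_to_fls mult_ac)
  have 2: "J 5 = ?P 5 * J 10"
    using qprod_regroup[of 5 5 2, where 'a=rat]
    by (simp add: J_eq_qprod lessThan_Suc eval_nat_numeral mult_ac fls_times_fps_to_fls)
  have 3: "th 7 10 = J 10 * ?P 7 * ?P 3" "th 9 10 = J 10 * ?P 9 * ?P 1"
    by (subst jacobi_triple_product; simp add: J_eq_qprod fls_times_fps_to_fls)+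
  show ?thesis
    unfolding 1 2 3 by (simp add: power3_eq_cube mult_ac)
qed

text \<open>Squares are 0, 1 or 4 modulo 5, so only three classes occur. For n = 5m + 1 the exponent
  is 5 (5m^2 + 2m) + 1, for n = 5m + 2 it is 5 (5m^2 + 4m) + 4; the negatives of these n account for
  the factors 2.\<close>

lemma phi_dissection:
  "\<phi> = V 25 \<phi> - 2 * q * V 5 (th 7 10) + 2 * q ^ 4 * V 5 (th 9 10)"
proof (rule fls_eqI)
  fix i
  define S where "S = {n. theta_exp 1 2 n = i}"
  have e: "theta_exp (Suc 0) 2 n = n ^ 2" "theta_exp 7 10 n = 5 * n ^ 2
      + 2 * n" "theta_exp 9 10 n = 5 * n ^ 2 + 4 * n" for n
    using two_theta_exp[of 1 2 n] two_theta_exp[of 7 10 n] two_theta_exp[of 9 10 n]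
    by (simp_all add: power2_eq_square algebra_simps)
  have fin: "finite S"
    unfolding S_def by (rule finite_theta_exp) auto
  have mod5: "n mod 5 = r \<Longrightarrow> \<exists>m. n = 5 * m + r" for n r :: int
    by (metis mult_div_mod_eq)
  have "\<phi> $$ i = sum theta_sgn S"
    unfolding phi_theta S_def by (rule th_nth) auto
  also have "\<dots> = (\<Sum>r\<in>{0,1,2,3,4}. \<Sum>n | n \<in> S \<and> n mod 5 = r. theta_sgn n)"
  proof -
    have "n mod 5 \<in> {0,1,2,3,4}" for n :: int
      using pos_mod_bound[of 5 n] pos_mod_sign[of 5 n] by auto
    then have "(\<lambda>n. n mod 5) ` S \<subseteq> {0,1,2,3,4}"
      by auto
    from sum.group[OF fin _ this, of theta_sgn] show ?thesis
      by simp
  qed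
  also have "\<dots> = (q ^ 0 * V 25 \<phi>) $$ i - 2 * (q ^ 1 * V 5 (th 7 10)) $$ i + 2 * (q ^ 4
      * V 5 (th 9 10)) $$ i"
  proof -
    have 0: "(\<Sum>n | n \<in> S \<and> n mod 5 = 0. theta_sgn n) = (\<Sum>n | int 25 * theta_exp 1 2 n + int 0
      = i. theta_sgn n)"
      by (rule sum.reindex_bij_witness[of _ "\<lambda>m. 5 * m" "\<lambda>n. n div 5"])
         (auto simp: S_def e theta_sgn_def power2_eq_square dest!: mod5)
    have 1: "(\<Sum>n | n \<in> S \<and> n mod 5 = 1. theta_sgn n) = (\<Sum>n | int 5 * theta_exp 7 10 n + int 1
      = i. - theta_sgn n)"
      by (rule sum.reindex_bij_witness[of _ "\<lambda>m. 5 * m + 1" "\<lambda>n. n div 5"])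
         (auto simp: S_def e theta_sgn_def power2_eq_square algebra_simps dest!: mod5)
    have 4: "(\<Sum>n | n \<in> S \<and> n mod 5 = 4. theta_sgn n) = (\<Sum>n | int 5 * theta_exp 7 10 n + int 1
      = i. - theta_sgn n)"
      by (rule sum.reindex_bij_witness[of _ "\<lambda>m. - (5 * m + 1)" "\<lambda>n. - (n div 5) - 1"])
         (auto simp: S_def e theta_sgn_def power2_eq_square algebra_simps dest!: mod5, presburger+)
    have 2: "(\<Sum>n | n \<in> S \<and> n mod 5 = 2. theta_sgn n) = (\<Sum>n | int 5 * theta_exp 9 10 n + int 4
      = i. theta_sgn n)"
      by (rule sum.reindex_bij_witness[of _ "\<lambda>m. 5 * m + 2" "\<lambda>n. n div 5"])
         (auto simp: S_def e theta_sgn_def power2_eq_square algebra_simps dest!: mod5)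
    have 3: "(\<Sum>n | n \<in> S \<and> n mod 5 = 3. theta_sgn n) = (\<Sum>n | int 5 * theta_exp 9 10 n + int 4
      = i. theta_sgn n)"
      by (rule sum.reindex_bij_witness[of _ "\<lambda>m. - (5 * m + 2)" "\<lambda>n. - (n div 5) - 1"])
         (auto simp: S_def e theta_sgn_def power2_eq_square algebra_simps dest!: mod5, presburger+)
    show ?thesis
      unfolding phi_theta
      by (subst q_power_V_th_nth, simp, simp, simp)+ (simp add: 0 1 2 3 4 sum_negf)
  qed
  also have "\<dots> = (V 25 \<phi> - 2 * q * V 5 (th 7 10) + 2 * q ^ 4 * V 5 (th 9 10)) $$ i"
    by (simp add: mult.assoc)
  finally show "\<phi> $$ i = (V 25 \<phi> - 2 * q * V 5 (th 7 10) + 2 * q ^ 4 * V 5 (th 9 10)) $$ i" .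
qed

text \<open>Pentagonal numbers are 0, 1 or 2 modulo 5. Those of class 1 come from n = 1 - 5m, where
  the exponent is 25 times that of m, plus 1; so this part is a dilated \<open>J 1\<close> again.
  The other two parts are related to each other later, through
  \<open>J 1 ^ 2 = J 2 * \<phi>\<close>.\<close>

lemma J1_dissection:
  obtains a0 a2 where "cls 0 a0" "cls 2 a2" "J 1 = a0 - q * J 25 + a2"
proof
  show "cls 0 (cls_part 0 (J 1))" "cls 2 (cls_part 2 (J 1))"
    by (rule cls_cls_part)+
  show "J 1 = cls_part 0 (J 1) - q * J 25 + cls_part 2 (J 1)"
  proof (rule fls_eqI)
    fix i
    have mod5: "\<exists>m. n = 5 * m + n mod 5" for n :: int
      by (metis mult_div_mod_eq)
    have range5: "n mod 5 \<in> {0,1,2,3,4}" for n :: int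
      using pos_mod_bound[of 5 n] pos_mod_sign[of 5 n] by auto
    have e: "2 * theta_exp 1 3 n = 3 * n ^ 2 - n" for n
      using two_theta_exp[of 1 3 n] by (simp add: power2_eq_square algebra_simps)
    have cases: "theta_exp 1 3 n mod 5 = (if n mod 5 = 0 then 0 else if n mod 5 = 1 then 1 else
        if n mod 5 = 2 then 0 else 2)" for n
    proof -
      define r where "r = n mod 5"
      obtain m where m: "n = 5 * m + r" unfolding r_def using mod5 by blast
      define N where "N = 15 * m ^ 2 + 6 * m * r - m"
      have E2: "2 * theta_exp 1 3 n = 5 * N + 3 * r ^ 2 - r"
        unfolding e N_def m by (simp add: power2_eq_square algebra_simps)
      have "r \<in> {0,1,2,3,4}"
        unfolding r_def by (rule range5)
      then consider "r = 0" | "r = 1" | "r = 2" | "r = 3" | "r = 4"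
        by blast
      then show ?thesis
        unfolding r_def[symmetric]
      proof cases
        case 1
        with E2 have "2 * theta_exp 1 3 n = 5 * N" by simp
        with 1 show "theta_exp 1 3 n mod 5 = (if r = 0 then 0 else if r = 1 then 1 else if r
        = 2 then 0 else 2)"
          by presburger
      next
        case 2
        with E2 have "2 * theta_exp 1 3 n = 5 * N + 2" by simp
        with 2 show "theta_exp 1 3 n mod 5 = (if r = 0 then 0 else if r = 1 then 1 else if r
        = 2 then 0 else 2)"
          by presburger
      next
        case 3
        with E2 have "2 * theta_exp 1 3 n = 5 * N + 10" by simp
        with 3 show "theta_exp 1 3 n mod 5 = (if r = 0 then 0 else if r = 1 then 1 else if r
        = 2 then 0 else 2)"
          by presburger
      next
        case 4
        with E2 have "2 * theta_exp 1 3 n = 5 * N + 24" by simp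
        with 4 show "theta_exp 1 3 n mod 5 = (if r = 0 then 0 else if r = 1 then 1 else if r
        = 2 then 0 else 2)"
          by presburger
      next
        case 5
        with E2 have "2 * theta_exp 1 3 n = 5 * N + 44" by simp
        with 5 show "theta_exp 1 3 n mod 5 = (if r = 0 then 0 else if r = 1 then 1 else if r
        = 2 then 0 else 2)"
          by presburger
      qed
    qed
    have J25: "(q * J 25) $$ i = (\<Sum>n | int 25 * theta_exp 1 3 n + int 1 = i. theta_sgn n)"
      using q_power_V_th_nth[of 1 3 25 1 i] unfolding J1_theta[symmetric] by simp
    have J1: "J 1 $$ i = (\<Sum>n | theta_exp 1 3 n = i. theta_sgn n)"
      unfolding J1_theta by (rule th_nth) auto
    have "(\<Sum>n | theta_exp 1 3 n = i. theta_sgn n) = (\<Sum>n | int 25 * theta_exp 1 3 n + int 1 = i.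
      - theta_sgn n)"
      if i: "i mod 5 = 1"
    proof (rule sum.reindex_bij_witness[of _ "\<lambda>m. 1 - 5 * m" "\<lambda>n. (1 - n) div 5"])
      fix n assume "n \<in> {n. theta_exp 1 3 n = i}"
      then have n: "theta_exp 1 3 n = i" by simp
      then have "n mod 5 = 1"
        using i cases[of n] by (auto split: if_splits)
      then obtain m where m: "n = 5 * m + 1" using mod5 by metis
      then have d: "(1 - n) div 5 = - m" by simp
      show "1 - 5 * ((1 - n) div 5) = n" using m d by simp
      have "2 * (25 * theta_exp 1 3 (- m) + 1) = 2 * theta_exp 1 3 n"
        unfolding distrib_left[of 2] e mult.left_commute[of 2 25]
        by (simp add: m power2_eq_square algebra_simps)
      then show "(1 - n) div 5 \<in> {n. int 25 * theta_exp 1 3 n + int 1 = i}"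
        using n d by simp
      show "- theta_sgn ((1 - n) div 5) = theta_sgn n"
        unfolding d by (simp add: m theta_sgn_def)
    next
      fix m assume m: "m \<in> {n. int 25 * theta_exp 1 3 n + int 1 = i}"
      show "(1 - (1 - 5 * m)) div 5 = m" by simp
      have "2 * (25 * theta_exp 1 3 m + 1) = 2 * theta_exp 1 3 (1 - 5 * m)"
        unfolding distrib_left[of 2] e mult.left_commute[of 2 25]
        by (simp add: power2_eq_square algebra_simps)
      then show "1 - 5 * m \<in> {n. theta_exp 1 3 n = i}"
        using m by simp
    qed
    moreover have "(\<Sum>n | theta_exp 1 3 n = i. theta_sgn n) = 0" if "i mod 5 = 3 \<or> i mod 5 = 4"
    proof -
      have "theta_exp 1 3 n \<noteq> i" for n
        using cases[of n] that by (auto split: if_splits)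
      then show ?thesis by simp
    qed
    moreover have "(q * J 25) $$ i = 0" if "i mod 5 \<noteq> 1"
    proof -
      have "25 * theta_exp 1 3 n + 1 \<noteq> i" for n
      proof -
        have "(25 * x + 1) mod 5 = (1::int)" for x by presburger
        with that show ?thesis by metis
      qed
      then show ?thesis unfolding J25 by simp
    qed
    ultimately show "J 1 $$ i = (cls_part 0 (J 1) - q * J 25 + cls_part 2 (J 1)) $$ i"
      using range5[of i] J25 J1 by (auto simp: sum_negf)
  qed
qed

section \<open>The norm of \<open>J 1\<close>\<close>

text \<open>The substitution of z q for q, with complex values because z will be a fifth root of
  unity. At z = 1 it is the embedding through which rational identities are recovered.\<close>

definition twist :: "complex \<Rightarrow> rat fps \<Rightarrow> complex fps" where
  "twist z f = Abs_fps (\<lambda>n. of_rat (fps_nth f n) * z ^ n)"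

lemma twist_nth [simp]: "fps_nth (twist z f) n = of_rat (fps_nth f n) * z ^ n"
  by (simp add: twist_def)

lemma twist_mult: "twist z (f * g) = twist z f * twist z g"
proof (rule fps_ext)
  fix n
  have "of_rat (fps_nth f i * fps_nth g (n - i)) * z ^ n =
      (of_rat (fps_nth f i) * z ^ i) * (of_rat (fps_nth g (n - i)) * z ^ (n - i))" if "i \<le> n" for i
  proof -
    have "z ^ n = z ^ i * z ^ (n - i)"
      using that by (simp flip: power_add)
    then show ?thesis by (simp add: of_rat_mult mult_ac)
  qed
  then show "fps_nth (twist z (f * g)) n = fps_nth (twist z f * twist z g) n"
    by (simp add: fps_mult_nth of_rat_sum sum_distrib_right)
qed

lemma twist_add: "twist z (f + g) = twist z f + twist z g"
  by (rule fps_ext) (simp add: of_rat_add algebra_simps)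

lemma twist_diff: "twist z (f - g) = twist z f - twist z g"
  by (rule fps_ext) (simp add: of_rat_diff algebra_simps)

lemma twist_1 [simp]: "twist z 1 = 1"
  by (rule fps_ext) simp

lemma twist_prod: "twist z (prod f S) = (\<Prod>i\<in>S. twist z (f i))"
  by (induction S rule: infinite_finite_induct) (simp_all add: twist_mult)

lemma twist_power: "twist z (f ^ n) = twist z f ^ n"
  by (induction n) (simp_all add: twist_mult)

lemma twist_numeral [simp]: "twist z (numeral k) = numeral k"
  by (rule fps_ext) (simp add: fps_numeral_nth)

lemma twist_X_power: "twist z (fps_X ^ n) = fps_const (z ^ n) * fps_X ^ n"
  by (rule fps_ext) simp

lemma twist_one_inj: "twist 1 f = twist 1 g \<longleftrightarrow> f = g"
  by (auto simp: fps_eq_iff)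

lemma twist_qprod:
  assumes "c \<ge> 1" "b \<ge> 1"
  shows "fps_eqm m (\<Prod>i<m. 1 - fps_const (z ^ (c + b * i)) * fps_X ^ (c
      + b * i)) (twist z (qprod c b))"
proof -
  have "fps_eqm m (twist z (qpart c b m)) (twist z (qprod c b))"
    using qpart_eqm_qprod[OF assms, of m m, where 'a=rat] by (simp add: fps_eqm_def)
  then show ?thesis
    by (simp add: qpart_def twist_prod twist_diff twist_X_power)
qed

lemma prod_lessThan_5: "(\<Prod>i<5. f i) = f 0 * f 1 * f 2 * f 3 * (f (4::nat) :: 'a::comm_monoid_mult)"
  by (simp add: eval_nat_numeral)

lemma prod_fifth_roots:
  fixes z y :: "'a::idom"
  assumes "1 + z + z ^ 2 + z ^ 3 + z ^ 4 = 0"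
  shows "(\<Prod>i<5. 1 - z ^ i * y) = 1 - y ^ 5"
proof -
  have "(1 - y) * (1 - z * y) * (1 - z ^ 2 * y) * (1 - z ^ 3 * y) * (1 - z ^ 4 * y) = 1 - y ^ 5"
    using assms by algebra
  then show ?thesis
    by (simp add: prod_lessThan_5)
qed

text \<open>The factors i and 5 - i are paired for i = 1, 2. This leaves the periods g = z + z^4 and
  h = z^2 + z^3, which satisfy g + h = g h = -1.\<close>

lemma norm_trinomial:
  fixes z a b c :: "'a::idom"
  assumes "1 + z + z ^ 2 + z ^ 3 + z ^ 4 = 0"
  shows "(\<Prod>i<5. a + z ^ i * b + z ^ (2 * i) * c) =
    a ^ 5 + b ^ 5 + c ^ 5 - 5 * a * b ^ 3 * c + 5 * a ^ 2 * b * c ^ 2"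
proof -
  have "(a + z * b + z ^ 2 * c) * (a + z ^ 4 * b + z ^ 8 * c) =
      a\<^sup>2 + b\<^sup>2 + c\<^sup>2 + (z + z ^ 4) * (b * (a + c)) + (z ^ 2 + z ^ 3) * (a * c)"
    using assms by algebra
  moreover have "(a + z ^ 2 * b + z ^ 4 * c) * (a + z ^ 3 * b + z ^ 6 * c) =
      a\<^sup>2 + b\<^sup>2 + c\<^sup>2 + (z ^ 2 + z ^ 3) * (b * (a + c)) + (z + z ^ 4) * (a * c)"
    using assms by algebra
  moreover have "(s + g * p + h * r) * (s + h * p + g * r) = s\<^sup>2 - s * (p + r) - p\<^sup>2 - r\<^sup>2 + 3 * p * r"
    if "g + h = -1" "g * h = -1" for s g h p r :: 'a
    using that by algebra
  moreover have "(z + z ^ 4) + (z ^ 2 + z ^ 3) = -1" "(z + z ^ 4) * (z ^ 2 + z ^ 3) = -1"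
    using assms by algebra+
  ultimately have "((a + z * b + z ^ 2 * c) * (a + z ^ 4 * b + z ^ 8 * c)) *
      ((a + z ^ 2 * b + z ^ 4 * c) * (a + z ^ 3 * b + z ^ 6 * c)) =
      (a\<^sup>2 + b\<^sup>2 + c\<^sup>2)\<^sup>2 - (a\<^sup>2 + b\<^sup>2 + c\<^sup>2) * (b * (a + c) + a * c) - (b * (a + c))\<^sup>2 - (a * c)\<^sup>2 +
        3 * (b * (a + c)) * (a * c)"
    by metis
  moreover have "(\<Prod>i<5. a + z ^ i * b + z ^ (2 * i) * c) = (a + b + c) *
     (((a + z * b + z ^ 2 * c) * (a + z ^ 4 * b + z ^ 8 * c)) *
      ((a + z ^ 2 * b + z ^ 4 * c) * (a + z ^ 3 * b + z ^ 6 * c)))"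
    by (simp add: prod_lessThan_5 mult_ac)
  ultimately show ?thesis
    by algebra
qed

definition \<zeta> :: complex where "\<zeta> = cis (2 * pi / 5)"

lemma zeta_power_5: "\<zeta> ^ 5 = 1"
proof -
  have "\<zeta> ^ 5 = cis (real 5 * (2 * pi / 5))"
    unfolding \<zeta>_def by (rule Complex.DeMoivre)
  then show ?thesis by simp
qed

lemma zeta_sum: "1 + \<zeta> + \<zeta> ^ 2 + \<zeta> ^ 3 + \<zeta> ^ 4 = 0"
proof -
  have "\<zeta> \<noteq> 1"
  proof
    assume "\<zeta> = 1"
    then have "cos (2 * pi / 5) = 1"
      by (simp add: \<zeta>_def complex_eq_iff)
    moreover have "cos (2 * pi / 5) < cos 0"
      by (rule cos_monotone_0_pi) (use pi_gt_zero in auto)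
    ultimately show False by simp
  qed
  moreover have "(\<zeta> - 1) * (1 + \<zeta> + \<zeta> ^ 2 + \<zeta> ^ 3 + \<zeta> ^ 4) = 0"
    using zeta_power_5 by algebra
  ultimately show ?thesis
    by simp
qed

lemma zeta_power_sum:
  assumes "\<not> 5 dvd c"
  shows "1 + \<zeta> ^ c + (\<zeta> ^ c) ^ 2 + (\<zeta> ^ c) ^ 3 + (\<zeta> ^ c) ^ 4 = 0"
proof -
  define r where "r = c mod 5"
  have "\<zeta> ^ c = (\<zeta> ^ 5) ^ (c div 5) * \<zeta> ^ r"
    unfolding r_def by (simp flip: power_mult power_add)
  then have r: "\<zeta> ^ c = \<zeta> ^ r"
    by (simp add: zeta_power_5)
  have "r \<noteq> 0" "r < 5"
    using assms by (auto simp: r_def dvd_eq_mod_eq_0)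
  then consider "r = 1" | "r = 2" | "r = 3" | "r = 4"
    by linarith
  moreover have H2: "1 + \<zeta> ^ 2 + \<zeta> ^ 4 + \<zeta> ^ 6 + \<zeta> ^ 8 = 0"
    using zeta_sum zeta_power_5 by algebra
  moreover have H3: "1 + \<zeta> ^ 3 + \<zeta> ^ 6 + \<zeta> ^ 9 + \<zeta> ^ 12 = 0"
    using zeta_sum zeta_power_5 by algebra
  moreover have H4: "1 + \<zeta> ^ 4 + \<zeta> ^ 8 + \<zeta> ^ 12 + \<zeta> ^ 16 = 0"
    using zeta_sum zeta_power_5 by algebra
  ultimately show ?thesis
  proof cases
    case 1 then show ?thesis unfolding r using zeta_sum by simp
  next
    case 2 then show ?thesis unfolding r using H2 by (simp flip: power_mult)
  next
    case 3 then show ?thesis unfolding r using H3 by (simp flip: power_mult)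
  next
    case 4 then show ?thesis unfolding r using H4 by (simp flip: power_mult)
  qed
qed

text \<open>Every exponent e = c + 5j is prime to 5, so the five twists of 1 - q^e multiply to 1 -
  q^(5e).\<close>

lemma norm_qprod:
  assumes "c \<ge> 1" "\<not> 5 dvd c"
  shows "(\<Prod>i<5. twist (\<zeta> ^ i) (qprod c 5)) = twist 1 (qprod (5 * c) 25)"
proof (rule fps_eqI_eqm)
  fix m
  have "fps_eqm m (\<Prod>i<5. twist (\<zeta> ^ i) (qprod c 5))
     (\<Prod>i<5. \<Prod>j<m. 1 - fps_const ((\<zeta> ^ i) ^ (c + 5 * j)) * fps_X ^ (c + 5 * j))"
    using assms by (intro fps_eqm_prod fps_eqm_sym[OF twist_qprod]) auto
  also have "(\<Prod>i<5. \<Prod>j<m. 1 - fps_const ((\<zeta> ^ i) ^ (c + 5 * j)) * fps_X ^ (c + 5 * j)) =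
     (\<Prod>j<m. \<Prod>i<5. 1 - (fps_const (\<zeta> ^ (c + 5 * j))) ^ i * fps_X ^ (c + 5 * j))"
    by (subst prod.swap) (simp add: fps_const_power mult.commute flip: power_mult)
  also have "\<dots> = (\<Prod>j<m. 1 - (fps_X ^ (c + 5 * j)) ^ 5)"
  proof (intro prod.cong refl prod_fifth_roots)
    fix j
    have "1 + \<zeta> ^ (c + 5 * j) + (\<zeta> ^ (c + 5 * j)) ^ 2 + (\<zeta> ^ (c + 5 * j)) ^ 3 + (\<zeta> ^ (c
      + 5 * j)) ^ 4 = 0"
      by (rule zeta_power_sum) (use assms in \<open>simp add: dvd_add_left_iff\<close>)
    then have "fps_const (1 + \<zeta> ^ (c + 5 * j) + (\<zeta> ^ (c + 5 * j)) ^ 2 + (\<zeta> ^ (c + 5 * j)) ^ 3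
      + (\<zeta> ^ (c + 5 * j)) ^ 4) = 0"
      by simp
    then show "1 + fps_const (\<zeta> ^ (c + 5 * j)) + fps_const (\<zeta> ^ (c + 5 * j)) ^ 2
      + fps_const (\<zeta> ^ (c + 5 * j)) ^ 3 +
       fps_const (\<zeta> ^ (c + 5 * j)) ^ 4 = 0"
      by (simp only: fps_const_power fps_const_add flip: fps_const_1_eq_1)
  qed
  also have "\<dots> = (\<Prod>j<m. 1 - fps_const (1 ^ (5 * c + 25 * j)) * fps_X ^ (5 * c + 25 * j))"
    by (simp add: algebra_simps flip: power_mult)
  also have "fps_eqm m \<dots> (twist 1 (qprod (5 * c) 25))"
    using assms by (intro twist_qprod) auto
  finally show "fps_eqm m (\<Prod>i<5. twist (\<zeta> ^ i) (qprod c 5)) (twist 1 (qprod (5 * c) 25))" .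
qed

lemma twist_zeta_part:
  assumes "\<And>n. fps_nth f n \<noteq> 0 \<Longrightarrow> n mod 5 = r"
  shows "twist (\<zeta> ^ i) f = fps_const (\<zeta> ^ i) ^ r * twist 1 f"
proof (rule fps_ext)
  fix n
  have "(\<zeta> ^ i) ^ n = (\<zeta> ^ i) ^ r" if "fps_nth f n \<noteq> 0"
  proof -
    have "n = 5 * (n div 5) + r" using assms[OF that] by presburger
    then have "(\<zeta> ^ i) ^ n = ((\<zeta> ^ 5) ^ i) ^ (n div 5) * (\<zeta> ^ i) ^ r"
      by (metis (no_types, lifting) mult.assoc mult.commute power_add power_mult)
    then show ?thesis by (simp add: zeta_power_5)
  qed
  then show "fps_nth (twist (\<zeta> ^ i) f) n = fps_nth (fps_const (\<zeta> ^ i) ^ r * twist 1 f) n"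
    by (cases "fps_nth f n = 0") (simp_all add: fps_const_power)
qed

text \<open>The norm of \<open>J 1\<close> computed twice: from its three residue classes, and from
  the product, where the factors with exponents prime to 5 contribute \<open>J 5 / J 25\<close> and
  the rest, \<open>J 5\<close>, is fixed by the twists and contributes its fifth power.\<close>

lemma norm_J1_fps:
  fixes a b c :: "rat fps"
  assumes abc: "qprod 1 1 = a + b + c"
    and cls: "\<And>n. fps_nth a n \<noteq> 0 \<Longrightarrow> n mod 5 = 0" "\<And>n. fps_nth b n \<noteq> 0 \<Longrightarrow> n mod 5 = 1"
      "\<And>n. fps_nth c n \<noteq> 0 \<Longrightarrow> n mod 5 = 2"
  shows "(a ^ 5 + b ^ 5 + c ^ 5 - 5 * a * b ^ 3 * c + 5 * a ^ 2 * b * c ^ 2) * qprod 25 25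
      = qprod 5 5 ^ 6"
proof -
  have z: "1 + fps_const \<zeta> + fps_const \<zeta> ^ 2 + fps_const \<zeta> ^ 3 + fps_const \<zeta> ^ 4 = 0"
    using zeta_sum by (simp only: fps_const_power fps_const_add flip: fps_const_1_eq_1) simp
  have "(\<Prod>i<5. twist (\<zeta> ^ i) (qprod 1 1)) =
     (\<Prod>i<5. twist 1 a + fps_const \<zeta> ^ i * twist 1 b + fps_const \<zeta> ^ (2 * i) * twist 1 c)"
    by (simp add: abc[unfolded One_nat_def] twist_add twist_zeta_part[OF cls(1)] twist_zeta_part[OF cls(2)] twist_zeta_part[OF cls(3)]
         fps_const_power mult.commute[of 2] flip: power_mult)
  also have "\<dots> = twist 1 (a ^ 5 + b ^ 5 + c ^ 5 - 5 * a * b ^ 3 * c + 5 * a ^ 2 * b * c ^ 2)"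
    unfolding norm_trinomial[OF z] by (simp add: twist_add twist_diff twist_mult twist_power)
  finally have 1: "(\<Prod>i<5. twist (\<zeta> ^ i) (qprod 1 1)) =
    twist 1 (a ^ 5 + b ^ 5 + c ^ 5 - 5 * a * b ^ 3 * c + 5 * a ^ 2 * b * c ^ 2)" .
  have J1: "qprod 1 1 = (qprod 1 5 * qprod 2 5 * qprod 3 5 * qprod 4 5 * qprod 5 5 :: rat fps)"
    using qprod_regroup[of 1 1 5, where 'a=rat] by (simp add: eval_nat_numeral mult_ac)
  have J5: "qprod 5 5 = (qprod 5 25 * qprod 10 25 * qprod 15 25 * qprod 20 25
      * qprod 25 25 :: rat fps)"
    using qprod_regroup[of 5 5 5, where 'a=rat] by (simp add: prod_lessThan_5)
  have 5: "twist (\<zeta> ^ i) (qprod 5 5) = twist 1 (qprod 5 5)" for i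
  proof -
    have "qprod 5 5 = (qprod 1 1 oo fps_X ^ 5 :: rat fps)"
      using qprod_compose_power[of 1 1 5, where 'a=rat] by simp
    then have "n mod 5 = 0" if "fps_nth (qprod 5 5 :: rat fps) n \<noteq> 0" for n
      using that by (auto simp: fps_nth_compose_X_power split: if_splits)
    from twist_zeta_part[OF this] show ?thesis by simp
  qed
  have "(\<Prod>i<5. twist (\<zeta> ^ i) (qprod 1 1)) = twist 1 (qprod 5 25 * qprod 10 25 * qprod 15 25
      * qprod 20 25 * qprod 5 5 ^ 5)"
    unfolding J1 twist_mult prod.distrib 5
    using norm_qprod[of 1] norm_qprod[of 2] norm_qprod[of 3] norm_qprod[of 4]
    by (simp add: twist_power)
  then have "a ^ 5 + b ^ 5 + c ^ 5 - 5 * a * b ^ 3 * c + 5 * a ^ 2 * b * c ^ 2 =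
      qprod 5 25 * qprod 10 25 * qprod 15 25 * qprod 20 25 * qprod 5 5 ^ 5"
    unfolding 1 twist_one_inj .
  then have "(a ^ 5 + b ^ 5 + c ^ 5 - 5 * a * b ^ 3 * c + 5 * a ^ 2 * b * c ^ 2) * qprod 25 25 =
     (qprod 5 25 * qprod 10 25 * qprod 15 25 * qprod 20 25 * qprod 25 25) * qprod 5 5 ^ 5"
    by (simp only: mult_ac)
  also have "\<dots> = qprod 5 5 ^ 6"
    unfolding J5[symmetric] by (simp add: eval_nat_numeral)
  finally show ?thesis .
qed

lemma norm_J1:
  assumes abc: "J 1 = a + b + c" and cls: "cls 0 a" "cls 1 b" "cls 2 c"
  shows "(a ^ 5 + b ^ 5 + c ^ 5 - 5 * a * b ^ 3 * c + 5 * a ^ 2 * b * c ^ 2) * J 25 = J 5 ^ 6"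
proof -
  \<comment> \<open>Distinct residue classes cannot cancel each other, so the three parts inherit
    the absence of negative exponents from \<open>J 1\<close>.\<close>
  have nn: "fls_nth f n = 0" if "f \<in> {a, b, c}" "n < 0" for f n
  proof -
    have "a $$ n + b $$ n + c $$ n = 0"
      using abc \<open>n < 0\<close> by (metis J_eq_qprod One_nat_def fls_plus_nth fps_to_fls_nth le_numeral_extra(4))
    moreover have "n mod 5 \<noteq> 0 \<longrightarrow> a $$ n = 0" "n mod 5 \<noteq> 1 \<longrightarrow> b $$ n = 0" "n mod 5 \<noteq> 2 \<longrightarrow> c $$ n = 0"
      using clsD[OF cls(1), of n] clsD[OF cls(2), of n] clsD[OF cls(3), of n] by simp_all
    ultimately show ?thesis
      using that(1) by auto
  qed
  have fps: "fps_to_fls (Abs_fps (\<lambda>n. f $$ int n)) = f" if "f \<in> {a, b, c}" for f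
    using nn[OF that] by (intro fls_eqI) auto
  define a' b' c' where "a' = Abs_fps (\<lambda>n. a $$ int n)" and "b' = Abs_fps (\<lambda>n. b $$ int n)"
      and "c' = Abs_fps (\<lambda>n. c $$ int n)"
  have eqs: "fps_to_fls a' = a" "fps_to_fls b' = b" "fps_to_fls c' = c"
    by (simp_all add: a'_def b'_def c'_def fps)
  have md: "int n mod 5 = int k \<Longrightarrow> n mod 5 = k" for n k
    by (metis of_nat_eq_iff of_nat_mod of_nat_numeral)
  have "fps_to_fls (qprod 1 1) = fps_to_fls (a' + b' + c')"
    using abc by (simp add: eqs J_eq_qprod)
  then have 1: "qprod 1 1 = a' + b' + c'"
    by (simp only: fps_to_fls_eq_iff)
  have "(a' ^ 5 + b' ^ 5 + c' ^ 5 - 5 * a' * b' ^ 3 * c'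
      + 5 * a' ^ 2 * b' * c' ^ 2) * qprod 25 25 = qprod 5 5 ^ 6"
  proof (rule norm_J1_fps[OF 1])
    show "n mod 5 = 0" if "a' $ n \<noteq> 0" for n
      using that cls(1) md[of n 0] by (auto simp: a'_def cls_def)
    show "n mod 5 = 1" if "b' $ n \<noteq> 0" for n
      using that cls(2) md[of n 1] by (auto simp: b'_def cls_def)
    show "n mod 5 = 2" if "c' $ n \<noteq> 0" for n
      using that cls(3) md[of n 2] by (auto simp: c'_def cls_def)
  qed
  then have "fps_to_fls ((a' ^ 5 + b' ^ 5 + c' ^ 5 - 5 * a' * b' ^ 3 * c'
      + 5 * a' ^ 2 * b' * c' ^ 2) * qprod 25 25) =
     fps_to_fls (qprod 5 5 ^ 6)"
    by (simp only:)
  then show ?thesis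
    by (simp add: J_eq_qprod eqs fls_times_fps_to_fls fps_to_fls_power)
qed

section \<open>The function field relations\<close>

text \<open>
  In the application \<open>J\<^sub>1 = q J\<^sub>2\<^sub>5 (1/u - 1 - u)\<close>, \<open>v = V\<^sub>2 u\<close> and \<open>\<phi> = V\<^sub>2\<^sub>5 \<phi> (1 + 2 c1 + 2 c4)\<close>; the assumptions
  \<open>E1\<close> to \<open>E4\<close> are the residue classes of \<open>J\<^sub>1\<^sup>2 = J\<^sub>2 \<phi>\<close>. In Ramanujan's notation \<open>u = R(q\<^sup>5)\<close>, and \<open>K\<close> is
  his parameter \<open>k\<close> at \<open>q\<^sup>5\<close>.
\<close>

locale dissection_algebra =
  fixes u v c1 c4 \<sigma> :: "'a::field_char_0"
  assumes u0: "u \<noteq> 0" and v0: "v \<noteq> 0" and s0: "\<sigma> \<noteq> 0"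
    and E1: "2 * u = - 2 * c1 - 2 * v * c4" and E2: "u\<^sup>2 = - v + 2 * c4 / v"
    and E3: "1 / u\<^sup>2 = 1 / v - 2 * v * c1" and E4: "- 2 / u = - 2 * c4 + 2 * c1 / v"
    and E5: "c1 * c4 = - 1 / \<sigma>"
begin

definition "K = u * v\<^sup>2"

lemma c4: "2 * c4 = v * (u\<^sup>2 + v)"
  using E2 v0 by (simp add: field_simps power2_eq_square)

lemma c1: "2 * c1 * (u\<^sup>2 * v\<^sup>2) = u\<^sup>2 - v"
  using E3 v0 u0 by (simp add: field_simps power2_eq_square)

text \<open>Ramanujan's relation (v - u^2) / (v + u^2) = u v^2 between his continued fraction at q
  and at q^2, here with q^5 for q. \<open>E1\<close> and \<open>E4\<close> express u^2 - v through
  c4 alone, and \<open>E2\<close> then removes c4.\<close>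

lemma vu: "v * (1 - K) = u\<^sup>2 * (1 + K)"
proof -
  have "2 * u - 2 * v / u = - v * (2 * c4) - v * (2 * c4)"
  proof -
    have "- 2 * v / u = v * (- 2 / u)" by simp
    also have "\<dots> = - v * (2 * c4) + 2 * c1"
      unfolding E4 using v0 by (simp add: field_simps)
    finally show ?thesis
      using E1 by (simp add: algebra_simps)
  qed
  then have "2 * (u\<^sup>2 - v) = - (2 * (u * v * (2 * c4)))"
    using u0 by (simp add: field_simps power2_eq_square)
  then have "u\<^sup>2 - v = - (u * v * (2 * c4))"
    by (simp only: mult_minus_right[symmetric] mult_left_cancel[OF zero_neq_numeral[symmetric]])
  then have "u\<^sup>2 - v = - (u * v * (v * (u\<^sup>2 + v)))"
    unfolding c4 .
  then show ?thesis
    unfolding K_def by (simp add: algebra_simps power2_eq_square)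
qed

lemma K_neq: "K \<noteq> 0" "1 - K \<noteq> 0" "1 + K \<noteq> 0"
proof -
  show "K \<noteq> 0" using u0 v0 by (simp add: K_def)
  show "1 - K \<noteq> 0"
  proof
    assume "1 - K = 0"
    then have "K = 1" by simp
    with vu u0 show False by simp
  qed
  show "1 + K \<noteq> 0"
  proof
    assume "1 + K = 0"
    then have "K = -1" by (simp add: eq_neg_iff_add_eq_0 add.commute)
    with vu v0 show False by simp
  qed
qed

lemma v_eq: "v = u\<^sup>2 * (1 + K) / (1 - K)"
  using vu K_neq by (simp add: field_simps)

lemma two_cancel: "2 * a = 2 * b \<Longrightarrow> a = b" for a b :: 'a
  by simp

text \<open>Substituting v into K = u v^2 leaves only u and K. With \<open>v5\<close> these are
  Ramanujan's formulas for the fifth powers of R at q and q^2 in terms of k.\<close>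

lemma u5: "u ^ 5 = K * (1 - K)\<^sup>2 / (1 + K)\<^sup>2"
proof -
  have "K = u * v\<^sup>2"
    by (rule K_def)
  also have "u * v\<^sup>2 = u * (u\<^sup>2 * (1 + K) / (1 - K))\<^sup>2"
    using v_eq by simp
  also have "\<dots> = u ^ 5 * (1 + K)\<^sup>2 / (1 - K)\<^sup>2"
    by (simp add: power_mult_distrib power_divide eval_nat_numeral)
  finally show ?thesis
    using K_neq by (simp add: field_simps)
qed

lemma v5: "v ^ 5 = K\<^sup>2 * (1 + K) / (1 - K)"
proof -
  have "v ^ 5 = (u ^ 5)\<^sup>2 * ((1 + K) / (1 - K)) ^ 5"
    by (subst v_eq) (simp add: power_mult_distrib power_divide flip: power_mult)
  also have "\<dots> = K\<^sup>2 * (1 + K) / (1 - K)"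
    unfolding u5 using K_neq by (simp add: power_divide power_mult_distrib divide_simps) (simp add: eval_nat_numeral)
  finally show ?thesis .
qed

lemma c1_eq: "c1 = - u / (1 - K)"
proof -
  have "2 * c1 * (u\<^sup>2 * v\<^sup>2) = u\<^sup>2 - u\<^sup>2 * (1 + K) / (1 - K)"
    using c1 v_eq by simp
  also have "\<dots> = - 2 * K * u\<^sup>2 / (1 - K)"
    using K_neq by (simp add: field_simps)
  also have "\<dots> = 2 * (- u / (1 - K)) * (u\<^sup>2 * v\<^sup>2)"
    unfolding K_def by (simp add: eval_nat_numeral)
  finally have "(2 * (u\<^sup>2 * v\<^sup>2)) * c1 = (2 * (u\<^sup>2 * v\<^sup>2)) * (- u / (1 - K))"
    by (simp only: mult_ac)
  then show ?thesis
    by (subst (asm) mult_left_cancel) (use u0 v0 in auto)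
qed

lemma c4_eq: "c4 = K / (u * (1 + K))"
proof -
  have "2 * c4 = u\<^sup>2 * (1 + K) / (1 - K) * (u\<^sup>2 + u\<^sup>2 * (1 + K) / (1 - K))"
    using c4 v_eq by simp
  also have "\<dots> = 2 * (u ^ 5 * (1 + K) / (u * (1 - K)\<^sup>2))"
    using K_neq u0 by (simp add: divide_simps) (simp add: algebra_simps eval_nat_numeral)
  also have "u ^ 5 * (1 + K) / (u * (1 - K)\<^sup>2) = K / (u * (1 + K))"
    unfolding u5 using K_neq u0 by (simp add: divide_simps) (simp add: algebra_simps eval_nat_numeral)
  finally show ?thesis by (rule two_cancel)
qed

lemma sigma_eq: "\<sigma> = (1 - K\<^sup>2) / K"
proof -
  have "c1 * c4 = - (K / ((1 - K) * (1 + K)))"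
    unfolding c1_eq c4_eq using u0 by simp
  also have "(1 - K) * (1 + K) = 1 - K\<^sup>2"
    by (simp add: algebra_simps power2_eq_square)
  finally have "1 / \<sigma> = K / (1 - K\<^sup>2)"
    using E5 by simp
  then have "1 / (1 / \<sigma>) = 1 / (K / (1 - K\<^sup>2))" by simp
  then show ?thesis by simp
qed

lemma K2_neq: "1 - K\<^sup>2 \<noteq> 0"
  using s0 sigma_eq by auto

definition "x = c1 + c4"

lemma c_powers: "c1 ^ 5 = - K / ((1 + K)\<^sup>2 * (1 - K) ^ 3)" "c4 ^ 5 = K ^ 4 / ((1 + K) ^ 3 * (1
      - K)\<^sup>2)"
proof -
  have gen: "K * a\<^sup>2 / (b\<^sup>2 * a ^ 5) = K / (b\<^sup>2 * a ^ 3)"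
    and gen': "b \<noteq> 0 \<Longrightarrow> K ^ 5 * b\<^sup>2 / (K * a\<^sup>2 * b ^ 5) = K ^ 4 / (b ^ 3 * a\<^sup>2)" if "a \<noteq> 0" for a b
    using that K_neq by (simp_all add: field_simps eval_nat_numeral)
  have "c1 ^ 5 = - (u ^ 5 / (1 - K) ^ 5)"
    unfolding c1_eq by (simp add: power_divide)
  then show "c1 ^ 5 = - K / ((1 + K)\<^sup>2 * (1 - K) ^ 3)"
    unfolding u5 using K_neq by (simp add: gen)
  have "c4 ^ 5 = K ^ 5 / (u ^ 5 * (1 + K) ^ 5)"
    unfolding c4_eq by (simp add: power_divide power_mult_distrib)
  then show "c4 ^ 5 = K ^ 4 / ((1 + K) ^ 3 * (1 - K)\<^sup>2)"
    unfolding u5 using K_neq by (simp add: gen')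
qed

text \<open>The exchange of K and - 1 / K fixes \<open>\<sigma>\<close>, which is 1 / K - K, and
  swaps the expressions for c1^5 and c4^5 in \<open>c_powers\<close>. Hence their sum is rational in
  \<open>\<sigma>\<close>; the middle terms of (c1 + c4)^5 reduce through \<open>E5\<close>.\<close>

lemma quintic: "\<sigma> ^ 3 * x ^ 5 + 5 * \<sigma>\<^sup>2 * x ^ 3 + 5 * \<sigma> * x + \<sigma>\<^sup>2 + \<sigma> + 2 = 0"
proof -
  have p: "\<sigma> * (c1 * c4) = -1"
    using E5 s0 by simp
  have "\<sigma> ^ 3 * (c1 ^ 5 + c4 ^ 5) = - (\<sigma>\<^sup>2 + \<sigma> + 2)"
  proof -
    have "c1 ^ 5 + c4 ^ 5 = (K ^ 4 * (1 - K) - K * (1 + K)) / (1 - K\<^sup>2) ^ 3"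
    proof -
      have "1 - K\<^sup>2 = (1 + K) * (1 - K)" by (simp add: algebra_simps power2_eq_square)
      then show ?thesis
        unfolding c_powers using K_neq by (simp add: divide_simps) (simp add: algebra_simps eval_nat_numeral)
    qed
    then have "\<sigma> ^ 3 * (c1 ^ 5 + c4 ^ 5) = ((1 - K\<^sup>2) / K) ^ 3 * ((K ^ 4 * (1 - K) - K * (1
      + K)) / (1 - K\<^sup>2) ^ 3)"
      by (simp only: sigma_eq)
    also have "\<dots> = (K ^ 4 * (1 - K) - K * (1 + K)) / K ^ 3"
      using K2_neq by (simp add: power_divide)
    also have "\<dots> = - (\<sigma>\<^sup>2 + \<sigma> + 2)"
      unfolding sigma_eq using K_neq by (simp add: divide_simps) (simp add: algebra_simps eval_nat_numeral)
    finally show ?thesis .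
  qed
  then have "\<sigma>\<^sup>2 + \<sigma> + 2 = - (\<sigma> ^ 3 * (c1 ^ 5 + c4 ^ 5))" by simp
  moreover have "\<sigma> ^ 3 * (c1 + c4) ^ 5 + 5 * \<sigma>\<^sup>2 * (c1 + c4) ^ 3 + 5 * \<sigma> * (c1 + c4)
      = \<sigma> ^ 3 * (c1 ^ 5 + c4 ^ 5)"
    using p by algebra
  ultimately show ?thesis
    unfolding x_def by (simp add: add.assoc)
qed

text \<open>The quartic is chosen so that it collapses to
  \<open>\<sigma> * (c1 + c4) + \<sigma>\<^sup>2 * (c1 ^ 4 + c4 ^ 4)\<close>. The terms with c1 and
  c4^4, of residue class 1 in the application, add up to - (1 + \<open>\<sigma>\<close>) u, and
  those with c4 and c1^4, of class 4, to (1 + \<open>\<sigma>\<close>) / u.\<close>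

lemma alpha: "(1 / u - u) * (1 + \<sigma>) = 2 + \<sigma> * x + 4 * \<sigma> * x\<^sup>2 + \<sigma>\<^sup>2 * x ^ 4"
proof -
  have p: "\<sigma> * (c1 * c4) = -1"
    using E5 s0 by simp
  have "2 + \<sigma> * x + 4 * \<sigma> * x\<^sup>2 + \<sigma>\<^sup>2 * x ^ 4 = \<sigma> * c1 + \<sigma> * c4 + \<sigma>\<^sup>2 * c1 ^ 4 + \<sigma>\<^sup>2 * c4 ^ 4"
    unfolding x_def using p by algebra
  also have "\<sigma> * c1 = - (u * (1 + K) / K)"
    unfolding sigma_eq c1_eq using K_neq by (simp add: divide_simps) (simp add: algebra_simps eval_nat_numeral)
  also have "\<sigma> * c4 = (1 - K) / u"
    unfolding sigma_eq c4_eq using K_neq u0 by (simp add: divide_simps) (simp add: algebra_simps eval_nat_numeral)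
  also have "\<sigma>\<^sup>2 * c1 ^ 4 = 1 / (K * u)"
  proof -
    have "\<sigma>\<^sup>2 * c1 ^ 4 * c1 = \<sigma>\<^sup>2 * (- K / ((1 + K)\<^sup>2 * (1 - K) ^ 3))"
      unfolding c_powers(1)[symmetric] by (simp add: eval_nat_numeral mult_ac)
    also have "\<dots> = 1 / (K * u) * c1"
      unfolding sigma_eq c1_eq using K_neq u0 by (simp add: divide_simps) (simp add: algebra_simps eval_nat_numeral)
    finally show ?thesis
      by (subst (asm) mult_right_cancel) (use c1_eq u0 K_neq in auto)
  qed
  also have "\<sigma>\<^sup>2 * c4 ^ 4 = K * u"
  proof -
    have "\<sigma>\<^sup>2 * c4 ^ 4 * c4 = \<sigma>\<^sup>2 * (K ^ 4 / ((1 + K) ^ 3 * (1 - K)\<^sup>2))"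
      unfolding c_powers(2)[symmetric] by (simp add: eval_nat_numeral mult_ac)
    also have "\<dots> = K * u * c4"
      unfolding sigma_eq c4_eq using K_neq u0 by (simp add: divide_simps) (simp add: algebra_simps eval_nat_numeral)
    finally show ?thesis
      by (subst (asm) mult_right_cancel) (use c4_eq u0 K_neq in auto)
  qed
  also have "- (u * (1 + K) / K) + (1 - K) / u + 1 / (K * u) + K * u = (1 / u - u) * (1 + \<sigma>)"
    unfolding sigma_eq using K_neq u0 by (simp add: divide_simps) (simp add: algebra_simps eval_nat_numeral)
  finally show ?thesis ..
qed

text \<open>Up to a power of q and a quotient of the \<open>J k\<close>, the left side is the norm
  of \<open>J 1\<close>: \<open>norm_trinomial\<close> at 1 / u, -1, -u produces the constant -1 - 5
  - 5 = -11. \<open>norm_v\<close> is the counterpart for \<open>J 2\<close>.\<close>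

lemma norm_u: "1 / u ^ 5 - 11 - u ^ 5 = (\<sigma> - 4)\<^sup>2 * (1 + \<sigma>) / \<sigma>\<^sup>2"
proof -
  have 1: "1 - K\<^sup>2 = (1 + K) * (1 - K)" by (simp add: algebra_simps power2_eq_square)
  show ?thesis
    unfolding sigma_eq u5 1 using K_neq by (simp add: divide_simps) (simp add: algebra_simps eval_nat_numeral)
qed

lemma norm_v: "1 / v ^ 5 - 11 - v ^ 5 = (\<sigma> - 4) * (1 + \<sigma>)\<^sup>2 / \<sigma>"
proof -
  have 1: "1 - K\<^sup>2 = (1 + K) * (1 - K)" by (simp add: algebra_simps power2_eq_square)
  show ?thesis
    unfolding sigma_eq v5 1 using K_neq by (simp add: divide_simps) (simp add: algebra_simps eval_nat_numeral)
qed

end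

section \<open>The parametrisation of level 10, instantiated\<close>

definition \<sigma>\<^sub>0 :: "rat fls" where "\<sigma>\<^sub>0 = J 2 * J 5 ^ 5 / (q * J 1 * J 10 ^ 5)"

definition \<sigma> :: "rat fls" where "\<sigma> = V 5 \<sigma>\<^sub>0"

text \<open>With \<open>\<gamma>4\<close>, half of the class 1 and class 4 parts of
  \<open>\<phi> / V 25 \<phi>\<close>; these instantiate c1 and c4.\<close>

definition \<gamma>1 :: "rat fls" where "\<gamma>1 = - (q * V 5 (th 7 10)) / V 25 \<phi>"

definition \<gamma>4 :: "rat fls" where "\<gamma>4 = q ^ 4 * V 5 (th 9 10) / V 25 \<phi>"

definition X :: "rat fls" where "X = \<gamma>1 + \<gamma>4"

lemma phi_neq_0 [simp]: "\<phi> \<noteq> 0"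
  by (simp add: \<phi>_def)

lemma sigma_neq_0 [simp]: "\<sigma> \<noteq> 0" "\<sigma>\<^sub>0 \<noteq> 0"
  by (simp_all add: \<sigma>_def \<sigma>\<^sub>0_def)

lemma phi_gamma: "\<phi> = V 25 \<phi> * (1 + 2 * \<gamma>1 + 2 * \<gamma>4)"
  by (subst phi_dissection) (simp add: \<gamma>1_def \<gamma>4_def field_simps)

lemma cls_gamma: "cls 1 \<gamma>1" "cls 4 \<gamma>4"
proof -
  have V25: "V 25 \<phi> = V 5 (V 5 \<phi>)" by (simp add: V_V)
  show "cls 1 \<gamma>1"
    unfolding \<gamma>1_def V25 by (intro cls_divide_V cls_uminus cls_mult_V cls_q)
  show "cls 4 \<gamma>4"
    unfolding \<gamma>4_def V25 using cls_power[OF cls_q, of 4] by (intro cls_divide_V cls_uminus cls_mult_V) simp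
qed

lemma gamma_product: "\<gamma>1 * \<gamma>4 = - 1 / \<sigma>"
proof -
  have "th 7 10 * th 9 10 = J 10 ^ 3 * J 1 / (J 5 * J 2)"
    using theta_product_10 by (simp add: field_simps)
  then have "V 5 (th 7 10 * th 9 10) = V 5 (J 10 ^ 3 * J 1 / (J 5 * J 2))"
    by (simp only:)
  then have th: "V 5 (th 7 10) * V 5 (th 9 10) = J 50 ^ 3 * J 5 / (J 25 * J 10)"
    by simp
  have "\<gamma>1 * \<gamma>4 = - (q ^ 5 * (V 5 (th 7 10) * V 5 (th 9 10)) / (V 25 \<phi>) ^ 2)"
    unfolding \<gamma>1_def \<gamma>4_def by (simp add: eval_nat_numeral)
  also have "\<dots> = - 1 / \<sigma>"
    unfolding th by (simp add: \<phi>_def \<sigma>_def \<sigma>\<^sub>0_def divide_simps) (simp add: eval_nat_numeral)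
  finally show ?thesis .
qed

theorem level_10_relations:
  shows "\<sigma> ^ 3 * X ^ 5 + 5 * \<sigma>\<^sup>2 * X ^ 3 + 5 * \<sigma> * X + \<sigma>\<^sup>2 + \<sigma> + 2 = 0" (is ?thesis1)
    and "(J 1 / (q * J 25) + 1) * (1 + \<sigma>) = 2 + \<sigma> * X + 4 * \<sigma> * X\<^sup>2 + \<sigma>\<^sup>2 * X ^ 4" (is ?thesis2)
    and "J 5 ^ 6 / (q ^ 5 * J 25 ^ 6) = (\<sigma> - 4)\<^sup>2 * (1 + \<sigma>) / \<sigma>\<^sup>2" (is ?thesis3)
    and "J 10 ^ 6 / (q ^ 10 * J 50 ^ 6) = (\<sigma> - 4) * (1 + \<sigma>)\<^sup>2 / \<sigma>" (is ?thesis4)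
proof -
  obtain a0 a2 where a: "cls 0 a0" "cls 2 a2" "J 1 = a0 - q * J 25 + a2"
    by (rule J1_dissection)
  define \<alpha> where "\<alpha> = a0 / (q * J 25)"
  define u where "u = - a2 / (q * J 25)"
  have J25: "J 25 = V 5 (J 5)" by simp
  have J50: "J 50 = V 5 (J 10)" by simp
  have q_inv: "f / (q ^ k * g) = f * inverse q ^ k / g" for f g :: "rat fls" and k
    by (simp only: divide_inverse inverse_mult_distrib power_inverse mult_ac)
  have cq: "cls (r - int k) (f * inverse q ^ k)" if "cls r f" for f r k
    using cls_mult[OF that cls_power[OF cls_inverse_q, of k]] by simp
  have cls_\<alpha>: "cls 4 \<alpha>"
    using cls_divide_V[OF cq[OF a(1), of 1], of "J 5"] q_inv[of a0 1 "J 25"]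
    by (auto simp: \<alpha>_def elim: cls_cong)
  have cls_u: "cls 1 u"
    using cls_divide_V[OF cq[OF cls_uminus[OF a(2)], of 1], of "J 5"] q_inv[of "- a2" 1 "J 25"]
    by (auto simp: u_def elim: cls_cong)
  have J1: "J 1 = q * J 25 * (\<alpha> - 1 - u)"
  proof -
    have "y - m + z = m * (y / m - 1 + z / m)" if "m \<noteq> 0" for m y z :: "rat fls"
      using that by (simp add: field_simps)
    from this[of "q * J 25" a0 a2] show ?thesis
      unfolding a(3) by (simp add: \<alpha>_def u_def)
  qed
  \<comment> \<open>\<open>V 2\<close> carries the dissection of \<open>J 1\<close> over to
    \<open>J 2\<close>.\<close>
  define \<beta> v where "\<beta> = V 2 \<alpha>" and "v = V 2 u"
  have cls_\<beta>: "cls 3 \<beta>" and cls_v: "cls 2 v"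
    using cls_V2[OF cls_\<alpha>] cls_V2[OF cls_u] by (auto simp: \<beta>_def v_def elim: cls_cong)
  have "V 2 (J 1) = V 2 (q * J 25 * (\<alpha> - 1 - u))"
    by (simp only: J1)
  then have J2: "J 2 = q ^ 2 * J 50 * (\<beta> - 1 - v)"
    by (simp add: \<beta>_def v_def)
  have "J 1 ^ 2 = J 2 * \<phi>"
    by (simp add: \<phi>_def)
  then have "(q * J 25 * (\<alpha> - 1 - u)) ^ 2 = (q ^ 2 * J 50 * (\<beta> - 1 - v)) * (V 25 \<phi> * (1 + 2 * \<gamma>1
      + 2 * \<gamma>4))"
    unfolding J1[symmetric] J2[symmetric] phi_gamma[symmetric] .
  then have "(q ^ 2 * J 25 ^ 2) * (\<alpha> - 1 - u) ^ 2 = (q ^ 2 * J 25 ^ 2) * ((\<beta> - 1 - v) * (1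
      + 2 * \<gamma>1 + 2 * \<gamma>4))"
    by (simp add: \<phi>_def power_mult_distrib mult_ac)
  then have main: "(\<alpha> - 1 - u) ^ 2 = (\<beta> - 1 - v) * (1 + 2 * \<gamma>1 + 2 * \<gamma>4)"
    by simp
  \<comment> \<open>Class 0 forces \<open>\<alpha> * u = 1\<close>, so the two unknown parts of
    \<open>J 1\<close> are determined by u; the other four classes are \<open>E1\<close> to
    \<open>E4\<close>.\<close>
  have parts: "1 - 2 * (\<alpha> * u) = -1 \<and> 2 * u = - (2 * \<gamma>1) - 2 * (v * \<gamma>4) \<and> u * u = - v
      + 2 * (\<beta> * \<gamma>4) \<and>
       \<alpha> * \<alpha> = \<beta> - 2 * (v * \<gamma>1) \<and> - (2 * \<alpha>) = - (2 * \<gamma>4) + 2 * (\<beta> * \<gamma>1)"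
  proof (rule cls_parts_unique)
    have m: "cls k (f * g)" if "cls r f" "cls s g" "(r + s) mod 5 = k mod 5" for r s k f g
      using cls_mult[OF that(1,2)] that(3) by (rule cls_cong)
    note intros = cls_diff cls_add cls_uminus cls_numeral_mult
    show "cls 0 (1 - 2 * (\<alpha> * u))" by (intro intros m[OF cls_\<alpha> cls_u] cls_1) auto
    show "cls 0 (-1)" by (intro intros cls_1)
    show "cls 1 (2 * u)" by (intro intros cls_u)
    show "cls 1 (- (2 * \<gamma>1) - 2 * (v * \<gamma>4))" by (intro intros cls_gamma m[OF cls_v cls_gamma(2)]) auto
    show "cls 2 (u * u)" by (intro m[OF cls_u cls_u]) auto
    show "cls 2 (- v + 2 * (\<beta> * \<gamma>4))" by (intro intros cls_v m[OF cls_\<beta> cls_gamma(2)]) auto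
    show "cls 3 (\<alpha> * \<alpha>)" by (intro m[OF cls_\<alpha> cls_\<alpha>]) auto
    show "cls 3 (\<beta> - 2 * (v * \<gamma>1))" by (intro intros cls_\<beta> m[OF cls_v cls_gamma(1)]) auto
    show "cls 4 (- (2 * \<alpha>))" by (intro intros cls_\<alpha>)
    show "cls 4 (- (2 * \<gamma>4) + 2 * (\<beta> * \<gamma>1))" by (intro intros cls_gamma m[OF cls_\<beta> cls_gamma(1)]) auto
    show "1 - 2 * (\<alpha> * u) + 2 * u + u * u + \<alpha> * \<alpha> + - (2 * \<alpha>) =
      -1 + (- (2 * \<gamma>1) - 2 * (v * \<gamma>4)) + (- v + 2 * (\<beta> * \<gamma>4)) + (\<beta> - 2 * (v * \<gamma>1)) + (- (2 * \<gamma>4)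
      + 2 * (\<beta> * \<gamma>1))"
      using main by (simp add: algebra_simps power2_eq_square)
  qed
  have \<alpha>u: "\<alpha> * u = 1"
    using parts by simp
  have "V 2 (\<alpha> * u) = V 2 1"
    by (simp only: \<alpha>u)
  then have \<beta>v: "\<beta> * v = 1"
    by (simp add: \<beta>_def v_def)
  have u0: "u \<noteq> 0" and v0: "v \<noteq> 0"
    using \<alpha>u \<beta>v by auto
  have \<alpha>: "\<alpha> = 1 / u" and \<beta>: "\<beta> = 1 / v"
    using \<alpha>u \<beta>v u0 v0 by (simp_all add: field_simps)
  interpret dissection_algebra u v \<gamma>1 \<gamma>4 \<sigma>
  proof
    show "u \<noteq> 0" "v \<noteq> 0" "\<sigma> \<noteq> 0"
      using u0 v0 by auto
    show "\<gamma>1 * \<gamma>4 = - 1 / \<sigma>"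
      by (rule gamma_product)
    show "2 * u = - 2 * \<gamma>1 - 2 * v * \<gamma>4" "u\<^sup>2 = - v + 2 * \<gamma>4 / v" "- 2 / u = - 2 * \<gamma>4 + 2 * \<gamma>1 / v"
      using parts unfolding \<alpha> \<beta> by (simp_all add: power2_eq_square mult.assoc)
    have "\<alpha> * \<alpha> = \<beta> - 2 * (v * \<gamma>1)"
      using parts by blast
    then show "1 / u\<^sup>2 = 1 / v - 2 * v * \<gamma>1"
      unfolding \<alpha> \<beta> by (simp add: power2_eq_square mult.assoc)
  qed
  have xX: "x = X"
    by (simp add: x_def X_def)
  show ?thesis1
    using quintic unfolding xX .
  have "J 1 / (q * J 25) = \<alpha> - 1 - u"
    unfolding J1 by simp
  then show ?thesis2
    using alpha unfolding xX \<alpha> by simp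
  have "(a0 ^ 5 + (- (q * J 25)) ^ 5 + a2 ^ 5 - 5 * a0 * (- (q * J 25)) ^ 3 * a2
      + 5 * a0 ^ 2 * (- (q * J 25)) * a2 ^ 2) * J 25 = J 5 ^ 6"
  proof (rule norm_J1)
    show "cls 1 (- (q * J 25))"
      unfolding J25 by (intro cls_uminus cls_mult_V cls_q)
  qed (use a in auto)
  moreover have "(m / u) ^ 5 + (- m) ^ 5 + (- (m * u)) ^ 5
      - 5 * (m / u) * (- m) ^ 3 * (- (m * u)) +
      5 * (m / u) ^ 2 * (- m) * (- (m * u)) ^ 2 = m ^ 5 * (1 / u ^ 5 - 11 - u ^ 5)" for m
    using u0 by (simp add: field_simps eval_nat_numeral)
  moreover have "a0 = (q * J 25) / u" "a2 = - ((q * J 25) * u)"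
    using \<alpha> by (simp_all add: \<alpha>_def u_def field_simps)
  ultimately have "(q * J 25) ^ 5 * (1 / u ^ 5 - 11 - u ^ 5) * J 25 = J 5 ^ 6"
    by (simp only:)
  then have N: "J 5 ^ 6 = q ^ 5 * J 25 ^ 6 * (1 / u ^ 5 - 11 - u ^ 5)"
    by (simp add: power_mult_distrib power_Suc2[of "J 25" 5, simplified] mult_ac)
  then show ?thesis3
    by (simp add: norm_u)
  have "V 2 (J 5 ^ 6) = V 2 (q ^ 5 * J 25 ^ 6 * (1 / u ^ 5 - 11 - u ^ 5))"
    by (simp only: N)
  then have "J 10 ^ 6 = q ^ 10 * J 50 ^ 6 * (1 / v ^ 5 - 11 - v ^ 5)"
    by (simp add: v_def flip: power_mult)
  then show ?thesis4
    by (simp add: norm_v)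
qed

section \<open>Leading coefficients\<close>

definition ord_ge :: "int \<Rightarrow> rat fls \<Rightarrow> bool" where
  "ord_ge n f \<longleftrightarrow> (\<forall>m<n. f $$ m = 0)"

text \<open>A leading coefficient 1 singles out one root when only a power of a series is
  known.\<close>

definition monic_at :: "int \<Rightarrow> rat fls \<Rightarrow> bool" where
  "monic_at n f \<longleftrightarrow> ord_ge n f \<and> f $$ n = 1"

lemma ord_ge_subdegree: "ord_ge n f \<longleftrightarrow> f = 0 \<or> n \<le> fls_subdegree f"
proof (cases "f = 0")
  case False
  then show ?thesis
    by (metis fls_eq0_below_subdegree fls_subdegree_geI nth_fls_subdegree_nonzero order_less_le_trans
        linorder_not_le ord_ge_def)
qed (simp add: ord_ge_def)

lemma ord_ge_mono: "ord_ge n f \<Longrightarrow> m \<le> n \<Longrightarrow> ord_ge m f"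
  by (simp add: ord_ge_def)

lemma ord_ge_add: "ord_ge n f \<Longrightarrow> ord_ge n g \<Longrightarrow> ord_ge n (f + g)"
  by (simp add: ord_ge_def)

lemma ord_ge_uminus: "ord_ge n f \<Longrightarrow> ord_ge n (- f)"
  by (simp add: ord_ge_def)

lemma ord_ge_diff: "ord_ge n f \<Longrightarrow> ord_ge n g \<Longrightarrow> ord_ge n (f - g)"
  by (simp add: ord_ge_def)

lemma ord_ge_mult: "ord_ge m f \<Longrightarrow> ord_ge n g \<Longrightarrow> ord_ge (m + n) (f * g)"
  by (cases "f = 0 \<or> g = 0") (auto simp: ord_ge_subdegree)

lemma ord_ge_1: "ord_ge 0 1"
  by (simp add: ord_ge_subdegree)

lemma ord_ge_numeral: "ord_ge 0 (numeral k)"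
  by (simp add: ord_ge_subdegree)

lemma ord_ge_power: "ord_ge n f \<Longrightarrow> ord_ge (int k * n) (f ^ k)"
proof (induction k)
  case (Suc k)
  then show ?case
    using ord_ge_mult[of n f "int k * n" "f ^ k"] by (simp add: algebra_simps)
qed (simp add: ord_ge_1)

lemma monic_at_nonzero: "monic_at n f \<Longrightarrow> f \<noteq> 0"
  by (auto simp: monic_at_def)

lemma monic_at_subdegree: "monic_at n f \<longleftrightarrow> fls_subdegree f = n \<and> f $$ n = 1"
proof
  assume f: "monic_at n f"
  then have "fls_subdegree f = n"
    by (intro fls_subdegree_eqI) (auto simp: monic_at_def ord_ge_def)
  with f show "fls_subdegree f = n \<and> f $$ n = 1"
    by (simp add: monic_at_def)
qed (auto simp: monic_at_def ord_ge_def)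

lemma monic_at_ord_ge: "monic_at n f \<Longrightarrow> ord_ge n f"
  by (simp add: monic_at_def)

lemma monic_at_add: "monic_at n f \<Longrightarrow> ord_ge (n + 1) g \<Longrightarrow> monic_at n (f + g)"
  by (simp add: monic_at_def ord_ge_def)

lemma monic_at_diff: "monic_at n f \<Longrightarrow> ord_ge (n + 1) g \<Longrightarrow> monic_at n (f - g)"
  by (simp add: monic_at_def ord_ge_def)

lemma monic_at_mult:
  assumes "monic_at m f" "monic_at n g"
  shows "monic_at (m + n) (f * g)"
  using assms monic_at_nonzero[OF assms(1)] monic_at_nonzero[OF assms(2)] fls_times_base[of f g]
  by (auto simp: monic_at_subdegree)

lemma monic_at_1: "monic_at 0 1"
  by (simp add: monic_at_subdegree)

lemma monic_at_inverse:
  assumes "monic_at n f"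
  shows "monic_at (- n) (inverse f)"
proof -
  have f: "f \<noteq> 0" by (rule monic_at_nonzero[OF assms])
  have 1: "f * inverse f = 1"
    using f by simp
  have "fls_subdegree (f * inverse f) = fls_subdegree f + fls_subdegree (inverse f)"
    using f by (intro fls_subdegree_mult) auto
  then have sub: "fls_subdegree (inverse f) = - n"
    using assms unfolding 1 by (simp add: monic_at_subdegree)
  have "(f * inverse f) $$ (fls_subdegree f + fls_subdegree (inverse f)) = inverse f $$ (-n)"
    using assms sub unfolding fls_times_base by (simp add: monic_at_subdegree)
  then show ?thesis
    using assms sub unfolding 1 monic_at_subdegree by auto
qed

lemma monic_at_divide: "monic_at m f \<Longrightarrow> monic_at n g \<Longrightarrow> monic_at (m - n) (f / g)"
  using monic_at_mult[OF _ monic_at_inverse] by (simp add: divide_inverse)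

lemma monic_at_power: "monic_at n f \<Longrightarrow> monic_at (int k * n) (f ^ k)"
proof (induction k)
  case (Suc k)
  then show ?case
    using monic_at_mult[of n f "int k * n" "f ^ k"] by (simp add: algebra_simps)
qed (simp add: monic_at_1)

lemma monic_at_cong: "monic_at n f \<Longrightarrow> n = m \<Longrightarrow> monic_at m f"
  by simp

lemma monic_at_J: "k \<ge> 1 \<Longrightarrow> monic_at 0 (J k)"
  by (auto simp: monic_at_def ord_ge_def J_eq_qprod)

lemma monic_at_q: "monic_at 1 q"
  by (simp add: monic_at_def ord_ge_def)

lemma monic_at_V5:
  assumes "monic_at n f"
  shows "monic_at (5 * n) (V 5 f)"
  using assms unfolding monic_at_def ord_ge_def
  by (auto simp: fls_nth_compose_power)

lemmas monic_at_intros = monic_at_divide monic_at_mult monic_at_power monic_at_J monic_at_q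

text \<open>The cofactor f^2 + f g + g^2 of f - g has leading coefficient 3, hence is
  nonzero.\<close>

lemma monic_cube_eqD:
  assumes "monic_at m f" "monic_at n g" "f ^ 3 = g ^ 3"
  shows "f = g"
proof -
  have "monic_at (3 * m) (f ^ 3)" "monic_at (3 * n) (g ^ 3)"
    using monic_at_power[OF assms(1), of 3] monic_at_power[OF assms(2), of 3] by simp_all
  then have "m = n"
    using assms(3) by (simp add: monic_at_subdegree)
  have *: "monic_at (2 * m) (f ^ 2)" "monic_at (2 * m) (f * g)" "monic_at (2 * m) (g ^ 2)"
    using monic_at_power[OF assms(1), of 2] monic_at_power[OF assms(2), of 2] monic_at_mult[OF assms(1,2)]
    by (simp_all add: \<open>m = n\<close>)
  then have "(f ^ 2 + f * g + g ^ 2) $$ (2 * m) = 3"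
    by (simp add: monic_at_def)
  then have "f ^ 2 + f * g + g ^ 2 \<noteq> 0"
    by (metis fls_zero_nth zero_neq_numeral)
  moreover have "(f - g) * (f ^ 2 + f * g + g ^ 2) = f ^ 3 - g ^ 3"
    by (simp add: algebra_simps power2_eq_square power3_eq_cube)
  ultimately show ?thesis
    using assms(3) by simp
qed

section \<open>The Hauptmodul\<close>

lemma monic_sigma0: "monic_at (-1) \<sigma>\<^sub>0"
  unfolding \<sigma>\<^sub>0_def by (rule monic_at_cong, (rule monic_at_intros | simp)+)

lemma monic_sigma: "monic_at (-5) \<sigma>"
  using monic_at_V5[OF monic_sigma0] by (simp add: \<sigma>_def)

lemma monic_t: "monic_at 1 t"
  unfolding t_def by (rule monic_at_cong, (rule monic_at_intros | simp)+)

lemma t_neq_0 [simp]: "t \<noteq> 0"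
  using monic_t by (rule monic_at_nonzero)

lemma monic_phi: "monic_at 0 \<phi>"
  unfolding \<phi>_def by (rule monic_at_cong, (rule monic_at_intros | simp)+)

lemma monic_sigma_add:
  "monic_at (-1) (1 + \<sigma>\<^sub>0)" "monic_at (-1) (\<sigma>\<^sub>0 - 4)" "monic_at (-5) (1 + \<sigma>)" "monic_at (-5) (\<sigma> - 4)"
  using monic_at_add[OF monic_sigma0, of 1] monic_at_diff[OF monic_sigma0, of 4]
    monic_at_add[OF monic_sigma, of 1] monic_at_diff[OF monic_sigma, of 4] ord_ge_mono[OF ord_ge_1]
    ord_ge_mono[OF ord_ge_numeral] by (simp_all add: add.commute)

lemma sigma_neqs [simp]: "1 + \<sigma>\<^sub>0 \<noteq> 0" "\<sigma>\<^sub>0 - 4 \<noteq> 0" "1 + \<sigma> \<noteq> 0" "\<sigma> - 4 \<noteq> 0"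
  using monic_sigma_add[THEN monic_at_nonzero] by blast+

lemma sigma_neq_4 [simp]: "\<sigma>\<^sub>0 \<noteq> 4" "\<sigma> \<noteq> 4"
  using sigma_neqs(2,4) by simp_all

text \<open>The cube of \<open>V 5 t\<close> is the normalised norm of \<open>J 1\<close> over the
  square of that of \<open>J 2\<close>. Both are known in \<open>\<sigma>\<close>, everything but 1
  + \<open>\<sigma>\<close> cancels, and monicity removes the cube.\<close>

lemma t_sigma: "1 / t = 1 + \<sigma>\<^sub>0"
proof -
  have "V 5 t = 1 / (1 + \<sigma>)"
  proof (rule monic_cube_eqD)
    show "monic_at 5 (V 5 t)"
      using monic_at_V5[OF monic_t] by simp
    show "monic_at 5 (1 / (1 + \<sigma>))"
      using monic_at_divide[OF monic_at_1 monic_sigma_add(3)] by simp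
    have "V 5 t ^ 3 = (J 5 ^ 6 / (q ^ 5 * J 25 ^ 6)) / (J 10 ^ 6 / (q ^ 10 * J 50 ^ 6)) ^ 2"
      unfolding t_def by (simp add: power_divide power_mult_distrib flip: power_mult)
        (simp add: divide_simps flip: power_add)
    also have "\<dots> = (1 / (1 + \<sigma>)) ^ 3"
      unfolding level_10_relations by (simp add: divide_simps) (simp add: eval_nat_numeral)
    finally show "V 5 t ^ 3 = (1 / (1 + \<sigma>)) ^ 3" .
  qed
  then have "V 5 (1 / t) = V 5 (1 + \<sigma>\<^sub>0)"
    by (simp add: \<sigma>_def)
  then show ?thesis
    by (simp only: V_eq_iff zero_less_numeral)
qed

text \<open>The same two norms, now the square of the first over the second.\<close>

lemma phi_sigma: "(\<phi> / V 5 \<phi>) ^ 2 = (\<sigma>\<^sub>0 - 4) / \<sigma>\<^sub>0"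
proof -
  have "(V 5 \<phi> / V 25 \<phi>) ^ 2 = (\<sigma> - 4) / \<sigma>"
  proof (rule monic_cube_eqD)
    have V25: "V 25 \<phi> = V 5 (V 5 \<phi>)" by (simp add: V_V)
    show "monic_at 0 ((V 5 \<phi> / V 25 \<phi>) ^ 2)"
      using monic_at_power[OF monic_at_divide[OF monic_at_V5[OF monic_phi] monic_at_V5[OF monic_at_V5[OF monic_phi]]], of 2]
      by (simp add: V25)
    show "monic_at 0 ((\<sigma> - 4) / \<sigma>)"
      using monic_at_divide[OF monic_sigma_add(4) monic_sigma] by simp
    have "((V 5 \<phi> / V 25 \<phi>) ^ 2) ^ 3 = (J 5 ^ 6 / (q ^ 5 * J 25 ^ 6)) ^ 2 / (J 10 ^ 6 / (q ^ 10
      * J 50 ^ 6))"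
      unfolding \<phi>_def by (simp add: power_divide power_mult_distrib flip: power_mult)
    also have "\<dots> = ((\<sigma> - 4) / \<sigma>) ^ 3"
      unfolding level_10_relations by (simp add: divide_simps) (simp add: eval_nat_numeral)
    finally show "((V 5 \<phi> / V 25 \<phi>) ^ 2) ^ 3 = ((\<sigma> - 4) / \<sigma>) ^ 3" .
  qed
  then have "V 5 ((\<phi> / V 5 \<phi>) ^ 2) = V 5 ((\<sigma>\<^sub>0 - 4) / \<sigma>\<^sub>0)"
    by (simp add: \<sigma>_def V_V)
  then show ?thesis
    by (simp only: V_eq_iff zero_less_numeral)
qed

section \<open>Level 20\<close>

abbreviation s :: "rat fls" where "s \<equiv> 1 + \<sigma>\<^sub>0"

abbreviation s2 :: "rat fls" where "s2 \<equiv> V 2 (1 + \<sigma>\<^sub>0)"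

lemma eta_s: "s = J 2 ^ 4 * J 5 ^ 2 / (q * J 1 ^ 2 * J 10 ^ 4)"
  unfolding t_sigma[symmetric] t_def by simp

lemma eta_s5: "\<sigma>\<^sub>0 - 4 = J 1 ^ 3 * J 5 / (q * J 2 * J 10 ^ 3)"
proof -
  have "\<sigma>\<^sub>0 - 4 = \<sigma>\<^sub>0 * (\<phi> / V 5 \<phi>) ^ 2"
    unfolding phi_sigma by simp
  also have "\<dots> = J 1 ^ 3 * J 5 / (q * J 2 * J 10 ^ 3)"
    unfolding \<sigma>\<^sub>0_def \<phi>_def by (simp add: divide_simps) (simp add: eval_nat_numeral)
  finally show ?thesis .
qed

lemma eta_s2:
  "s2 = J 4 ^ 4 * J 10 ^ 2 / (q ^ 2 * J 2 ^ 2 * J 20 ^ 4)"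
  "V 2 \<sigma>\<^sub>0 = J 4 * J 10 ^ 5 / (q ^ 2 * J 2 * J 20 ^ 5)"
  "V 2 \<sigma>\<^sub>0 - 4 = J 2 ^ 3 * J 10 / (q ^ 2 * J 4 * J 20 ^ 3)"
proof -
  have "V 2 s = V 2 (J 2 ^ 4 * J 5 ^ 2 / (q * J 1 ^ 2 * J 10 ^ 4))"
    by (simp only: eta_s)
  then show "s2 = J 4 ^ 4 * J 10 ^ 2 / (q ^ 2 * J 2 ^ 2 * J 20 ^ 4)"
    by simp
  show "V 2 \<sigma>\<^sub>0 = J 4 * J 10 ^ 5 / (q ^ 2 * J 2 * J 20 ^ 5)"
    by (simp add: \<sigma>\<^sub>0_def)
  have "V 2 (\<sigma>\<^sub>0 - 4) = V 2 (J 1 ^ 3 * J 5 / (q * J 2 * J 10 ^ 3))"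
    by (simp only: eta_s5)
  then show "V 2 \<sigma>\<^sub>0 - 4 = J 2 ^ 3 * J 10 / (q ^ 2 * J 4 * J 20 ^ 3)"
    by simp
qed

abbreviation \<sigma>2 :: "rat fls" where "\<sigma>2 \<equiv> V 2 \<sigma>\<^sub>0"

lemma sigma2_neq [simp]: "\<sigma>2 \<noteq> 0" "\<sigma>2 - 4 \<noteq> 0" "1 + \<sigma>2 \<noteq> 0"
proof -
  show "\<sigma>2 \<noteq> 0" "1 + \<sigma>2 \<noteq> 0" using eta_s2(1,2) by simp_all
  show "\<sigma>2 - 4 \<noteq> 0" unfolding eta_s2(3) by simp
qed

lemma sigma2_neq_4 [simp]: "\<sigma>2 \<noteq> 4"
  using sigma2_neq(2) by simp

text \<open>
  Both sides of \<open>rel\<close> below equal \<open>(J 2 / J 10)\<^sup>6 / q\<^sup>2\<close>. The relation splits into two factors,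
  and the leading coefficients show that the first one is nonzero.
\<close>

lemma level_20_relation: "s\<^sup>2 * \<sigma>2\<^sup>2 + 4 * \<sigma>\<^sub>0 * (1 + \<sigma>2)\<^sup>2 = \<sigma>\<^sub>0 * (\<sigma>\<^sub>0 + 6) * (1 + \<sigma>2) * \<sigma>2"
proof -
  have "s ^ 2 * (\<sigma>\<^sub>0 - 4) / \<sigma>\<^sub>0 = J 2 ^ 6 / (q ^ 2 * J 10 ^ 6)"
    unfolding eta_s eta_s5 unfolding \<sigma>\<^sub>0_def by (simp add: divide_simps) (simp add: eval_nat_numeral)
  also have "\<dots> = s2 * (\<sigma>2 - 4) ^ 2 / \<sigma>2 ^ 2"
    unfolding eta_s2(3) unfolding eta_s2(1,2) by (simp add: divide_simps) (simp add: eval_nat_numeral)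
  finally have rel: "s\<^sup>2 * (\<sigma>\<^sub>0 - 4) * \<sigma>2\<^sup>2 = (1 + \<sigma>2) * (\<sigma>2 - 4)\<^sup>2 * \<sigma>\<^sub>0"
    by (simp add: field_simps)
  have "(s * \<sigma>2 - (\<sigma>2 - 4)) * (s\<^sup>2 * \<sigma>2\<^sup>2 + 4 * \<sigma>\<^sub>0 * (1 + \<sigma>2)\<^sup>2 - \<sigma>\<^sub>0 * (\<sigma>\<^sub>0 + 6) * (1 + \<sigma>2) * \<sigma>2) =
      - (s\<^sup>2 * (\<sigma>\<^sub>0 - 4) * \<sigma>2\<^sup>2 - (1 + \<sigma>2) * (\<sigma>2 - 4)\<^sup>2 * \<sigma>\<^sub>0)"
    by algebra
  moreover have "s * \<sigma>2 - (\<sigma>2 - 4) \<noteq> 0"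
  proof -
    have "monic_at (-2) \<sigma>2"
      unfolding eta_s2 by (rule monic_at_cong, (rule monic_at_intros | simp)+)
    then have "monic_at (-3) (\<sigma>\<^sub>0 * \<sigma>2)"
      using monic_at_mult[OF monic_sigma0] by fastforce
    then have "monic_at (-3) (\<sigma>\<^sub>0 * \<sigma>2 + 4)"
      using ord_ge_mono[OF ord_ge_numeral] by (intro monic_at_add) auto
    moreover have "s * \<sigma>2 - (\<sigma>2 - 4) = \<sigma>\<^sub>0 * \<sigma>2 + 4"
      by (simp add: algebra_simps)
    ultimately show ?thesis
      by (metis monic_at_nonzero)
  qed
  ultimately show ?thesis
    using rel by simp
qed

lemma P_A_level_20:
  "P_A = s * \<sigma>2 / ((\<sigma>\<^sub>0 - 4) * (1 + \<sigma>2)) - 4 * (\<sigma>\<^sub>0 * (1 + \<sigma>2) / (s * (\<sigma>\<^sub>0 - 4) * \<sigma>2))"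
proof -
  have "s * \<sigma>2 / ((\<sigma>\<^sub>0 - 4) * s2) = J 10 ^ 2 * J 5 * J 2 ^ 6 / (J 20 * J 4 ^ 3 * J 1 ^ 5)"
    unfolding eta_s eta_s5 eta_s2(1,2) by (simp add: divide_simps) (simp add: eval_nat_numeral)
  moreover have "\<sigma>\<^sub>0 * s2 / (s * (\<sigma>\<^sub>0 - 4) * \<sigma>2) = q * J 20 * J 5 ^ 2 * J 4 ^ 3 / (J 10 * J 2 ^ 3
      * J 1 ^ 2)"
    unfolding eta_s eta_s5 eta_s2(1,2) unfolding \<sigma>\<^sub>0_def by (simp add: divide_simps) (simp add: eval_nat_numeral)
  ultimately show ?thesis
    unfolding P_A_def by simp
qed

lemma P_B_level_20:
  "P_B = (\<sigma>2 - 4) / \<sigma>\<^sub>0 + 4 * (s * (\<sigma>\<^sub>0 - 4) / (\<sigma>\<^sub>0 * (\<sigma>2 - 4)))"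
proof -
  have "(\<sigma>2 - 4) / \<sigma>\<^sub>0 = J 10 ^ 6 * J 2 ^ 2 * J 1 / (q * J 20 ^ 3 * J 5 ^ 5 * J 4)"
    unfolding eta_s2(3) unfolding \<sigma>\<^sub>0_def by (simp add: divide_simps) (simp add: eval_nat_numeral)
  moreover have "s * (\<sigma>\<^sub>0 - 4) / (\<sigma>\<^sub>0 * (\<sigma>2 - 4)) = q * J 20 ^ 3 * J 4 * J 1 ^ 2 / (J 10 ^ 3
      * J 5 ^ 2 * J 2)"
    unfolding eta_s eta_s5 eta_s2(3) unfolding \<sigma>\<^sub>0_def by (simp add: divide_simps) (simp add: eval_nat_numeral)
  ultimately show ?thesis
    unfolding P_B_def by simp
qed

text \<open>Over a common denominator \<open>P_A\<close> is a difference a - b, and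
  \<open>level_20_relation\<close> gives a + b as a multiple of
  \<open>(1 + \<sigma>2) * \<sigma>2\<close>. Since (a - b)^2 = (a + b)^2 - 4 a b, and a b is a
  multiple of the square of that product, the level 20 variable \<open>\<sigma>2\<close>
  cancels.\<close>

lemma P_A_square: "P_A\<^sup>2 * (s\<^sup>2 * (\<sigma>\<^sub>0 - 4)) = \<sigma>\<^sub>0 * (\<sigma>\<^sub>0\<^sup>2 + 4)"
proof -
  define den where "den = s * (\<sigma>\<^sub>0 - 4) * (1 + \<sigma>2) * \<sigma>2"
  have den: "den \<noteq> 0" by (simp add: den_def)
  have num: "P_A * den = s\<^sup>2 * \<sigma>2\<^sup>2 - 4 * \<sigma>\<^sub>0 * (1 + \<sigma>2)\<^sup>2"
    unfolding P_A_level_20 den_def by (simp add: divide_simps) (simp add: algebra_simps power2_eq_square)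
  have "(s\<^sup>2 * \<sigma>2\<^sup>2 - 4 * \<sigma>\<^sub>0 * (1 + \<sigma>2)\<^sup>2)\<^sup>2 =
     (s\<^sup>2 * \<sigma>2\<^sup>2 + 4 * \<sigma>\<^sub>0 * (1 + \<sigma>2)\<^sup>2)\<^sup>2 - 16 * \<sigma>\<^sub>0 * s\<^sup>2 * (1 + \<sigma>2)\<^sup>2 * \<sigma>2\<^sup>2"
    by algebra
  also have "\<dots> = (\<sigma>\<^sub>0\<^sup>2 * (\<sigma>\<^sub>0 + 6)\<^sup>2 - 16 * \<sigma>\<^sub>0 * s\<^sup>2) * ((1 + \<sigma>2)\<^sup>2 * \<sigma>2\<^sup>2)"
    unfolding level_20_relation by algebra
  also have "\<sigma>\<^sub>0\<^sup>2 * (\<sigma>\<^sub>0 + 6)\<^sup>2 - 16 * \<sigma>\<^sub>0 * s\<^sup>2 = \<sigma>\<^sub>0 * (\<sigma>\<^sub>0 - 4) * (\<sigma>\<^sub>0\<^sup>2 + 4)"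
    by algebra
  finally have "(P_A * den)\<^sup>2 = \<sigma>\<^sub>0 * (\<sigma>\<^sub>0 - 4) * (\<sigma>\<^sub>0\<^sup>2 + 4) * ((1 + \<sigma>2)\<^sup>2 * \<sigma>2\<^sup>2)"
    unfolding num .
  then have "(P_A\<^sup>2 * (s\<^sup>2 * (\<sigma>\<^sub>0 - 4))) * ((\<sigma>\<^sub>0 - 4) * (1 + \<sigma>2)\<^sup>2 * \<sigma>2\<^sup>2) =
       (\<sigma>\<^sub>0 * (\<sigma>\<^sub>0\<^sup>2 + 4)) * ((\<sigma>\<^sub>0 - 4) * (1 + \<sigma>2)\<^sup>2 * \<sigma>2\<^sup>2)"
    unfolding den_def by algebra
  then show ?thesis
    by (subst (asm) mult_right_cancel) auto
qed

text \<open>\<open>P_A\<close> and \<open>P_B\<close> thus involve the same square root over the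
  rational functions in \<open>t\<close>, and a root in the quintic extension has to be found only
  once.\<close>

lemma P_B_conv_P_A: "P_B * \<sigma>\<^sub>0 = P_A * (s * (\<sigma>\<^sub>0 - 4))"
proof -
  define den where "den = (1 + \<sigma>2) * \<sigma>2 * (\<sigma>2 - 4)"
  have den: "den \<noteq> 0" by (simp add: den_def)
  have "P_A * (s * (\<sigma>\<^sub>0 - 4)) = s\<^sup>2 * \<sigma>2 / (1 + \<sigma>2) - 4 * (\<sigma>\<^sub>0 * (1 + \<sigma>2) / \<sigma>2)"
    unfolding P_A_level_20 by (simp add: divide_simps) (simp add: algebra_simps power2_eq_square)
  then have 1: "(P_A * (s * (\<sigma>\<^sub>0 - 4))) * den = (s\<^sup>2 * \<sigma>2\<^sup>2 - 4 * \<sigma>\<^sub>0 * (1 + \<sigma>2)\<^sup>2) * (\<sigma>2 - 4)"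
    unfolding den_def by (simp add: divide_simps) (simp add: algebra_simps power2_eq_square)
  have "P_B * \<sigma>\<^sub>0 = (\<sigma>2 - 4) + 4 * (s * (\<sigma>\<^sub>0 - 4) / (\<sigma>2 - 4))"
    unfolding P_B_level_20 by (simp add: divide_simps)
  then have "(P_B * \<sigma>\<^sub>0) * den = ((\<sigma>2 - 4)\<^sup>2 + 4 * s * (\<sigma>\<^sub>0 - 4)) * (1 + \<sigma>2) * \<sigma>2"
    unfolding den_def by (simp add: divide_simps) (simp add: algebra_simps power2_eq_square)
  also have "\<dots> = (s\<^sup>2 * \<sigma>2\<^sup>2 - 4 * \<sigma>\<^sub>0 * (1 + \<sigma>2)\<^sup>2) * (\<sigma>2 - 4)"
    using level_20_relation by algebra
  also have "\<dots> = (P_A * (s * (\<sigma>\<^sub>0 - 4))) * den"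
    by (rule 1[symmetric])
  finally show ?thesis
    using den by simp
qed

lemma monic_P_A: "monic_at 0 P_A"
proof -
  have "monic_at 0 ((J 10 ^ 2 * J 5 * J 2 ^ 6) / (J 20 * J 4 ^ 3 * J 1 ^ 5))"
    by (rule monic_at_cong, (rule monic_at_intros | simp)+)
  moreover have "monic_at 1 ((q * J 20 * J 5 ^ 2 * J 4 ^ 3) / (J 10 * J 2 ^ 3 * J 1 ^ 2))"
    by (rule monic_at_cong, (rule monic_at_intros | simp)+)
  ultimately show ?thesis
    unfolding P_A_def using ord_ge_mult[OF ord_ge_numeral monic_at_ord_ge, of 1 _ "Num.Bit0 (Num.Bit0 Num.One)"]
    by (intro monic_at_diff) (simp_all del: times_divide_eq_right)
qed

lemma monic_P_B: "monic_at (-1) P_B"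
proof -
  have "monic_at (-1) ((J 10 ^ 6 * J 2 ^ 2 * J 1) / (q * J 20 ^ 3 * J 5 ^ 5 * J 4))"
    by (rule monic_at_cong, (rule monic_at_intros | simp)+)
  moreover have "monic_at 1 ((q * J 20 ^ 3 * J 4 * J 1 ^ 2) / (J 10 ^ 3 * J 5 ^ 2 * J 2))"
    by (rule monic_at_cong, (rule monic_at_intros | simp)+)
  ultimately show ?thesis
    unfolding P_B_def using ord_ge_mult[OF ord_ge_numeral monic_at_ord_ge, of 1 _ "Num.Bit0 (Num.Bit0 Num.One)"]
    by (intro monic_at_add) (auto intro!: ord_ge_mono[of 1 _ 0] simp del: times_divide_eq_right)
qed

section \<open>Multiplication by the Hauptmodul in the quintic extension\<close>

text \<open>
  The field generated by \<open>x\<close> over the rational functions in \<open>g\<close> has degree 5. All elements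
  below are expanded in the powers of \<open>x\<close>, up to a denominator in \<open>g\<close>; the identities hold
  modulo \<open>Q\<close>, with the explicit multiple of \<open>Q\<close> given in each proof.
\<close>

locale quintic_algebra =
  fixes g x s :: "'a::field_char_0" and Q W H F :: 'a
  defines "Q \<equiv> g ^ 3 * x ^ 5 + 5 * g\<^sup>2 * x ^ 3 + 5 * g * x + g\<^sup>2 + g + 2"
    and "W \<equiv> 1 + g * x + g * x\<^sup>2"
    and "H \<equiv> (4 - 4*g - g^2) + (8 - 20*g - 2*g^2) * x + (-20*g - 2*g^2) * x^2 + (8*g
      - 8*g^2) * x^3 + (-8*g^2) * x^4"
    and "F \<equiv> H / ((g\<^sup>2 + 4) * W)"
  assumes Q0: "Q = 0" and sW: "s * W = W + 4 - g"
    and W0: "W \<noteq> 0" and g1: "1 + g \<noteq> 0" and g2: "g\<^sup>2 + 4 \<noteq> 0"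
begin

text \<open>The powers F s^i are wanted for i = 0, ..., 4 because the modular equation has order 5.
  Each follows from the one before through \<open>sW\<close>; W is cancelled after the reduction
  modulo Q.\<close>

lemma F_s_0: "F * ((g\<^sup>2 + 4) * (1 + g) ^ 2) = (-20 - 11*g^2 - g^3) + (8 - 32*g - 6*g^2 - g^3) * x
      + (-8*g + 20*g^2 - 2*g^3) * x^2 + (-12*g^2 - 2*g^3) * x^3 + (6*g^3 + g^4) * x^4" (is "?l
      = ?r")
proof -
  have "?l * W = H * (1 + g) ^ 2"
    unfolding F_def using W0 g2 by simp
  also have "\<dots> = ?r * W - ((-12 + 4*g + g^2) + (6*g + g^2) * x) * Q"
    unfolding H_def W_def Q_def by algebra
  finally show ?thesis
    using W0 Q0 by simp
qed

lemma F_s_1: "F * s * ((g\<^sup>2 + 4) * (1 + g) ^ 3) = (-68 + 8*g + 5*g^2 - 21*g^3) + (8 + 40*g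
      - 14*g^2 - 21*g^3) * x + (-72*g + 116*g^2 + 8*g^3 - 5*g^4) * x^2 + (20*g^2 - 6*g^3 - 2*g^4
      - g^5) * x^3 + (-16*g^2 + 34*g^3 + g^4 + g^5) * x^4" (is "?l = ?r")
proof -
  have "?l * W = (F * ((g\<^sup>2 + 4) * (1 + g) ^ 2)) * (1 + g) * (s * W)"
    by (simp add: power_add[symmetric] mult_ac eval_nat_numeral)
  also have "\<dots> = ?r * W + ((-16 - 36*g + 6*g^2 + g^3) + (16 - 28*g + 6*g^2) * x) * Q"
    unfolding F_s_0 sW unfolding W_def Q_def by algebra
  finally show ?thesis
    using W0 Q0 by simp
qed

lemma F_s_2: "F * s ^ 2 * ((g\<^sup>2 + 4) * (1 + g) ^ 4) = (-308 - 240*g + 285*g^2 - 65*g^3 - 30*g^4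
      + 2*g^5) + (8 + 304*g + 306*g^2 - 141*g^3 - 24*g^4 + 2*g^5) * x + (-200*g - 364*g^2
      + 614*g^3 - 104*g^4 - 6*g^5 + g^6) * x^2 + (52*g^2 + 118*g^3 - 48*g^4 + 8*g^5
      - 3*g^6) * x^3 + (-32*g^2 - 98*g^3 + 153*g^4 - 28*g^5 + 3*g^6) * x^4" (is "?l = ?r")
proof -
  have "?l * W = (F * s * ((g\<^sup>2 + 4) * (1 + g) ^ 3)) * (1 + g) * (s * W)"
    by (simp add: power_add[symmetric] mult_ac eval_nat_numeral)
  also have "\<dots> = ?r * W + ((-16 + 12*g - 78*g^2 + 19*g^3) + (16 + 116*g - 118*g^2 + 30*g^3
      - 2*g^4) * x) * Q"
    unfolding F_s_1 sW unfolding W_def Q_def by algebra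
  finally show ?thesis
    using W0 Q0 by simp
qed

lemma F_s_3: "F * s ^ 3 * ((g\<^sup>2 + 4) * (1 + g) ^ 5) = (-996 - 4200*g + 1245*g^2 + 635*g^3
      - 150*g^4 - 76*g^5 + 10*g^6) + (8 + 1784*g + 634*g^2 + 1855*g^3 - 1220*g^4 + 158*g^5 - g^6
      - g^7) * x + (-392*g - 4940*g^2 + 1240*g^3 + 1595*g^4 - 450*g^5 - 2*g^6 + 5*g^7) * x^2
      + (340*g^2 + 50*g^3 + 550*g^4 - 325*g^5 + 75*g^6 - 10*g^7) * x^3 + (-48*g^2 - 1030*g^3
      + 185*g^4 + 405*g^5 - 125*g^6 + 12*g^7) * x^4" (is "?l = ?r")
proof -
  have "?l * W = (F * s ^ 2 * ((g\<^sup>2 + 4) * (1 + g) ^ 4)) * (1 + g) * (s * W)"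
    by (simp add: power_add[symmetric] mult_ac eval_nat_numeral)
  also have "\<dots> = ?r * W + ((-272 + 1020*g - 610*g^2 + 5*g^3 + 30*g^4 - 2*g^5) + (16 + 900*g
      - 130*g^2 - 280*g^3 + 100*g^4 - 9*g^5) * x) * Q"
    unfolding F_s_2 sW unfolding W_def Q_def by algebra
  finally show ?thesis
    using W0 Q0 by simp
qed

lemma F_s_4: "F * s ^ 4 * ((g\<^sup>2 + 4) * (1 + g) ^ 5) = (-2388 - 29068*g + 12081*g^2 - 930*g^3
      + 990*g^4 - 518*g^5 + 52*g^6 + g^7) + (8 + 8568*g - 2542*g^2 + 10405*g^3 - 6605*g^4
      + 1233*g^5 - 37*g^6 - 7*g^7) * x + (-648*g - 26724*g^2 + 6530*g^3 + 5350*g^4 - 1650*g^5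
      + 2*g^6 + 21*g^7) * x^2 + (1652*g^2 - 1030*g^3 + 2710*g^4 - 1670*g^5 + 400*g^6
      - 38*g^7) * x^3 + (-64*g^2 - 5130*g^3 + 795*g^4 + 1525*g^5 - 535*g^6 + 51*g^7) * x^4"
      (is "?l = ?r")
proof -
  have "?l * W = (F * s ^ 3 * ((g\<^sup>2 + 4) * (1 + g) ^ 5)) * (s * W)"
    by (simp add: power_add[symmetric] mult_ac eval_nat_numeral)
  also have "\<dots> = ?r * W + ((-1296 + 5180*g - 2770*g^2 + 225*g^3 + 85*g^4 - 11*g^5) + (16 + 4100*g
      - 610*g^2 - 1120*g^3 + 410*g^4 - 39*g^5) * x) * Q"
    unfolding F_s_3 sW unfolding W_def Q_def by algebra
  finally show ?thesis
    using W0 Q0 by simp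
qed

text \<open>In the application this is \<open>B * F5\<close>: the d of \<open>G_mult\<close> is
  \<open>J 1 / (q * J 25)\<close>, the reciprocal of \<open>B\<close>. Checking G d = F spares the
  inversion of d modulo Q.\<close>

definition G where "G = ((-4 + 4*g + g^2) + (12*g) * x + (-4*g + 2*g^2) * x^2
      + (4*g^2) * x^3) / ((g\<^sup>2 + 4) * (1 + g) ^ 1)"

lemma G_s_0: "G * ((g\<^sup>2 + 4) * (1 + g) ^ 1) = (-4 + 4*g + g^2) + (12*g) * x + (-4*g + 2*g^2) * x^2
      + (4*g^2) * x^3"
  using g1 g2 by (simp add: G_def)

lemma G_mult:
  assumes "(d + 1) * (1 + g) = 2 + g * x + 4 * g * x\<^sup>2 + g\<^sup>2 * x ^ 4"
  shows "G * d = F"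
proof -
  have d: "d * (1 + g) = (1 - g) + (g) * x + (4*g) * x^2 + (g^2) * x^4"
    using assms by algebra
  have "(G * d) * ((g\<^sup>2 + 4) * (1 + g) ^ 2) = (G * ((g\<^sup>2 + 4) * (1 + g) ^ 1)) * (d * (1 + g))"
    by (simp add: power2_eq_square)
  also have "\<dots> = F * ((g\<^sup>2 + 4) * (1 + g) ^ 2) + ((8) + (-4 + 2*g) * x + (4*g) * x^2) * Q"
    unfolding G_s_0 F_s_0 d unfolding Q_def by algebra
  finally show ?thesis
    using Q0 g1 g2 by simp
qed

lemma G_s_1: "G * s * ((g\<^sup>2 + 4) * (1 + g) ^ 3) = (-20 - 64*g + 9*g^2 + 5*g^3 + 2*g^4) + (28*g
      + 28*g^2 + 22*g^3 - 3*g^4) * x + (-4*g - 102*g^2 + 8*g^3 + 6*g^4) * x^2 + (4*g^2 + 8*g^3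
      + 4*g^4) * x^3 + (-24*g^3 + 2*g^4 + g^5) * x^4" (is "?l = ?r")
proof -
  have "?l * W = (G * ((g\<^sup>2 + 4) * (1 + g) ^ 1)) * (1 + g) ^ 2 * (s * W)"
    by (simp add: power_add[symmetric] mult_ac eval_nat_numeral)
  also have "\<dots> = ?r * W + ((24*g - 2*g^2 - g^3) + (24*g - 2*g^2 - g^3) * x) * Q"
    unfolding G_s_0 sW unfolding W_def Q_def by algebra
  finally show ?thesis
    using W0 Q0 by simp
qed

lemma G_s_2: "G * s ^ 2 * ((g\<^sup>2 + 4) * (1 + g) ^ 4) = (-36 - 592*g - 307*g^2 + g^3 + 10*g^4
      + 8*g^5) + (172*g - 4*g^2 + 236*g^3 + 22*g^4 - 15*g^5) * x + (-4*g - 522*g^2 - 382*g^3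
      + 36*g^4 + 25*g^5) * x^2 + (36*g^2 - 28*g^3 + 60*g^4 - 2*g^5 - g^6) * x^3 + (-96*g^3
      - 88*g^4 + 12*g^5 + 4*g^6) * x^4" (is "?l = ?r")
proof -
  have "?l * W = (G * s * ((g\<^sup>2 + 4) * (1 + g) ^ 3)) * (1 + g) * (s * W)"
    by (simp add: power_add[symmetric] mult_ac eval_nat_numeral)
  also have "\<dots> = ?r * W + ((-32 + 112*g + 18*g^2 - 3*g^3 - 2*g^4) + (72*g + 66*g^2 - 9*g^3
      - 3*g^4) * x) * Q"
    unfolding G_s_1 sW unfolding W_def Q_def by algebra
  finally show ?thesis
    using W0 Q0 by simp
qed

lemma G_s_3: "G * s ^ 3 * ((g\<^sup>2 + 4) * (1 + g) ^ 5) = (-52 - 2992*g - 5087*g^2 - 1243*g^3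
      - 272*g^4 + 110*g^5 + 36*g^6) + (572*g + 1644*g^2 + 506*g^3 + 1299*g^4 - 79*g^5
      - 69*g^6) * x + (-4*g - 2222*g^2 - 4272*g^3 - 1398*g^4 + 153*g^5 + 123*g^6 + g^7) * x^2
      + (100*g^2 + 344*g^3 - 24*g^4 + 314*g^5 - 49*g^6 - 6*g^7) * x^3 + (-408*g^3 - 782*g^4
      - 323*g^5 + 68*g^6 + 17*g^7) * x^4" (is "?l = ?r")
proof -
  have "?l * W = (G * s ^ 2 * ((g\<^sup>2 + 4) * (1 + g) ^ 4)) * (1 + g) * (s * W)"
    by (simp add: power_add[symmetric] mult_ac eval_nat_numeral)
  also have "\<dots> = ?r * W + ((-64 - 24*g + 654*g^2 - 9*g^3 - 6*g^4 - 8*g^5) + (312*g + 598*g^2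
      + 247*g^3 - 52*g^4 - 13*g^5) * x) * Q"
    unfolding G_s_2 sW unfolding W_def Q_def by algebra
  finally show ?thesis
    using W0 Q0 by simp
qed

lemma G_s_4: "G * s ^ 4 * ((g\<^sup>2 + 4) * (1 + g) ^ 6) = (-68 - 12000*g - 43179*g^2 - 30335*g^3
      - 7620*g^4 - 1568*g^5 + 880*g^6 + 166*g^7) + (1356*g + 14764*g^2 + 12024*g^3 + 8100*g^4
      + 5830*g^5 - 854*g^6 - 326*g^7 - g^8) * x + (-4*g - 7954*g^2 - 36142*g^3 - 23400*g^4
      - 7070*g^5 + 1246*g^6 + 616*g^7 + 8*g^8) * x^2 + (196*g^2 + 2980*g^3 + 2280*g^4 + 1140*g^5
      + 1350*g^6 - 324*g^7 - 30*g^8) * x^3 + (-1408*g^3 - 6880*g^4 - 4240*g^5 - 1520*g^6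
      + 450*g^7 + 77*g^8) * x^4" (is "?l = ?r")
proof -
  have "?l * W = (G * s ^ 3 * ((g\<^sup>2 + 4) * (1 + g) ^ 5)) * (1 + g) * (s * W)"
    by (simp add: power_add[symmetric] mult_ac eval_nat_numeral)
  also have "\<dots> = ?r * W + ((-96 - 1536*g + 3730*g^2 + 2285*g^3 + 180*g^4 - 96*g^5 - 36*g^6)
      + (1000*g + 5690*g^2 + 3135*g^3 + 1265*g^4 - 365*g^5 - 60*g^6) * x) * Q"
    unfolding G_s_3 sW unfolding W_def Q_def by algebra
  finally show ?thesis
    using W0 Q0 by simp
qed

text \<open>In the application 4 - g is \<open>\<sigma>\<^sub>0 * W5\<close> and (1 + 2x)^2 is
  \<open>A\<close>, so this reads \<open>A * (\<sigma>\<^sub>0\<^sup>2 + 4) = (\<sigma>\<^sup>2 + 4)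
  * F5\<^sup>2\<close>, the core of the squared form of \<open>A_P_A\<close>.\<close>

lemma F_square: "(1 + 2 * x)\<^sup>2 * ((4 - g)\<^sup>2 + 4 * W\<^sup>2) = (g\<^sup>2 + 4) * F\<^sup>2 * W\<^sup>2"
proof -
  have "((1 + 2 * x)\<^sup>2 * ((4 - g)\<^sup>2 + 4 * W\<^sup>2)) * (g\<^sup>2 + 4) = H\<^sup>2 + ((32 - 16*g) + (128 - 80*g) * x
      + (128 - 128*g) * x^2 + (-64*g) * x^3) * Q"
    unfolding H_def W_def Q_def by algebra
  also have "\<dots> = ((g\<^sup>2 + 4) * F\<^sup>2 * W\<^sup>2) * (g\<^sup>2 + 4)"
    unfolding F_def using W0 g2 Q0 by (simp add: power_divide power_mult_distrib) (simp add: power2_eq_square)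
  finally show ?thesis
    using g2 by simp
qed

text \<open>In the application S is \<open>V 5 s\<close>. Multiplication by W^5 turns the powers of
  s into polynomials in g and x through \<open>sW\<close>, after which divisibility by Q is a
  polynomial identity.\<close>

lemma modular_equation:
  defines "S \<equiv> 1 + g"
  shows "S^4 * s^5 - (10*S^4 - 5*S^3) * s^4 + (35*S^4 - 50*S^3 + 25*S^2) * s^3 - (60*S^4
      - 175*S^3 + 250*S^2 - 125*S) * s^2 + (55*S^4 - 300*S^3 + 875*S^2 - 1250*S + 625) * s - S^5
      = 0" (is "?l = 0")
proof -
  define y where "y = s * W"
  have "?l * W ^ 5 = S^4 * y^5 - (10*S^4 - 5*S^3) * y^4 * W + (35*S^4 - 50*S^3
      + 25*S^2) * y^3 * W^2 - (60*S^4 - 175*S^3 + 250*S^2 - 125*S) * y^2 * W^3 + (55*S^4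
      - 300*S^3 + 875*S^2 - 1250*S + 625) * y * W^4 - S^5 * W^5"
    unfolding y_def by (simp add: algebra_simps power_mult_distrib eval_nat_numeral)
  also have "\<dots> = ((512 - 1536*g + 192*g^2 + 352*g^3 - 62*g^4 - 36*g^5 + 12*g^6 - g^7) + (-1280*g
      - 2560*g^2 + 2080*g^3 - 80*g^4 - 245*g^5 + 65*g^6 - 5*g^7) * x + (-3840*g^2 + 1280*g^3
      + 1120*g^4 - 720*g^5 + 145*g^6 - 10*g^7) * x^2 + (-1280*g^2 - 1280*g^3 + 2080*g^4 - 880*g^5
      + 155*g^6 - 10*g^7) * x^3 + (-1280*g^3 + 1280*g^4 - 480*g^5 + 80*g^6 - 5*g^7) * x^4
      + (-256*g^3 + 256*g^4 - 96*g^5 + 16*g^6 - g^7) * x^5) * Q"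
    unfolding y_def sW unfolding W_def Q_def S_def by algebra
  finally show ?thesis
    using W0 Q0 by simp
qed

end

section \<open>The operators on powers of the Hauptmodul\<close>

text \<open>Equals \<open>1 + \<sigma> * (A - 1) / 4\<close>. It arises when \<open>A_sigma\<close>
  is solved for \<open>\<sigma>\<^sub>0\<close>, see \<open>sigma_W5\<close>.\<close>

definition W5 :: "rat fls" where "W5 = 1 + \<sigma> * X + \<sigma> * X\<^sup>2"

text \<open>
  \<open>F5\<close> is \<open>A P_A s / V\<^sub>5 P_B\<close>, see \<open>A_P_A\<close>. Only its square is accessible directly; the square root \<open>H5\<close> was
  found by matching the values \<open>U\<^sub>5 (F5 * s ^ i)\<close>, and leading coefficients determine the sign.
\<close>

definition H5 :: "rat fls" where "H5 = (4 - 4*\<sigma> - \<sigma>^2) + (8 - 20*\<sigma> - 2*\<sigma>^2) * X + (-20*\<sigma>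
      - 2*\<sigma>^2) * X^2 + (8*\<sigma> - 8*\<sigma>^2) * X^3 + (-8*\<sigma>^2) * X^4"

definition F5 :: "rat fls" where "F5 = H5 / ((\<sigma>\<^sup>2 + 4) * W5)"

lemma phi_X: "\<phi> / V 25 \<phi> = 1 + 2 * X"
proof -
  have "\<phi> = V 25 \<phi> * (1 + 2 * X)"
    using phi_gamma by (simp add: X_def add.assoc)
  then show ?thesis
    by (metis V_eq_0_iff nonzero_mult_div_cancel_left phi_neq_0 zero_less_numeral)
qed

lemma A_eq: "A = (1 + 2 * X)\<^sup>2"
  unfolding phi_X[symmetric] by (simp add: A_def \<phi>_def power_divide power_mult_distrib mult.commute flip: power_mult)

text \<open>\<open>A\<close> telescopes into \<open>(\<phi> / V 5 \<phi>) ^ 2\<close> and its image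
  under \<open>V 5\<close>.\<close>

lemma A_sigma: "A * (\<sigma> * \<sigma>\<^sub>0) = (\<sigma>\<^sub>0 - 4) * (\<sigma> - 4)"
proof -
  have "V 5 ((\<phi> / V 5 \<phi>) ^ 2) = V 5 ((\<sigma>\<^sub>0 - 4) / \<sigma>\<^sub>0)"
    by (simp only: phi_sigma)
  then have "(V 5 \<phi> / V 25 \<phi>) ^ 2 = (\<sigma> - 4) / \<sigma>"
    by (simp add: V_V \<sigma>_def)
  moreover have "A = (\<phi> / V 5 \<phi>) ^ 2 * (V 5 \<phi> / V 25 \<phi>) ^ 2"
    unfolding A_eq phi_X[symmetric] by (simp add: power_divide)
  ultimately have "A * (\<sigma> * \<sigma>\<^sub>0) = ((\<sigma>\<^sub>0 - 4) / \<sigma>\<^sub>0 * ((\<sigma> - 4) / \<sigma>)) * (\<sigma> * \<sigma>\<^sub>0)"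
    unfolding phi_sigma by (simp only:)
  then show ?thesis by simp
qed

lemma sigma_W5: "\<sigma>\<^sub>0 * W5 = 4 - \<sigma>"
proof -
  have "4 * (\<sigma>\<^sub>0 * W5) = 4 * (4 - \<sigma>)"
    using A_sigma unfolding A_eq W5_def by algebra
  then show ?thesis
    by (subst (asm) mult_left_cancel) simp_all
qed

lemma W5_neq_0: "W5 \<noteq> 0"
  using sigma_W5 by auto

lemma sigma_square_neq: "\<sigma>\<^sub>0\<^sup>2 + 4 \<noteq> 0" "\<sigma>\<^sup>2 + 4 \<noteq> 0" and monic_sigma_square: "monic_at (-10) (\<sigma>\<^sup>2 + 4)"
proof -
  have "monic_at (-2) (\<sigma>\<^sub>0\<^sup>2 + 4)"
    using monic_at_power[OF monic_sigma0, of 2] ord_ge_mono[OF ord_ge_numeral]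
    by (intro monic_at_add) auto
  then show "\<sigma>\<^sub>0\<^sup>2 + 4 \<noteq> 0"
    by (rule monic_at_nonzero)
  show "monic_at (-10) (\<sigma>\<^sup>2 + 4)"
    using monic_at_power[OF monic_sigma, of 2] ord_ge_mono[OF ord_ge_numeral]
    by (intro monic_at_add) auto
  then show "\<sigma>\<^sup>2 + 4 \<noteq> 0"
    by (rule monic_at_nonzero)
qed

interpretation M: quintic_algebra \<sigma> X s
  "\<sigma> ^ 3 * X ^ 5 + 5 * \<sigma>\<^sup>2 * X ^ 3 + 5 * \<sigma> * X + \<sigma>\<^sup>2 + \<sigma> + 2" W5 H5 F5
proof -
  show "quintic_algebra \<sigma> X s"
  proof
    show "s * (1 + \<sigma> * X + \<sigma> * X\<^sup>2) = 1 + \<sigma> * X + \<sigma> * X\<^sup>2 + 4 - \<sigma>"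
      using sigma_W5 unfolding W5_def by (simp add: algebra_simps)
  qed (use level_10_relations(1) W5_neq_0 sigma_square_neq in \<open>simp_all add: W5_def\<close>)
qed (rule W5_def[THEN eq_reflection] H5_def[THEN eq_reflection] F5_def[THEN eq_reflection] reflexive)+

abbreviation G5 :: "rat fls" where "G5 \<equiv> M.G"

lemma ord_X: "ord_ge 1 X"
proof -
  have th: "ord_ge 0 (V 5 (th a b))" for a b
    by (auto simp: ord_ge_def fls_nth_compose_power elim!: dvdE)
  have V25: "monic_at 0 (inverse (V 25 \<phi>))"
    using monic_at_inverse[OF monic_at_V5[OF monic_at_V5[OF monic_phi]]] by (simp add: V_V)
  have 1: "ord_ge (1 + 0 + 0) (- (q * V 5 (th 7 10)) * inverse (V 25 \<phi>))"
    using V25 by (intro ord_ge_mult ord_ge_uminus monic_at_ord_ge[OF monic_at_q] th) (rule monic_at_ord_ge)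
  have 4: "ord_ge (int 4 * 1 + 0 + 0) ((q ^ 4 * V 5 (th 9 10)) * inverse (V 25 \<phi>))"
    using V25 by (intro ord_ge_mult ord_ge_power monic_at_ord_ge[OF monic_at_q] th) (rule monic_at_ord_ge)
  show ?thesis
    unfolding X_def \<gamma>1_def \<gamma>4_def divide_inverse using 1 4
    by (intro ord_ge_add) (auto intro: ord_ge_mono)
qed

text \<open>Decides the sign in \<open>A_P_A\<close>. As \<open>X\<close> has positive order, the
  leading term of \<open>- H5\<close> is that of \<open>\<sigma>\<^sup>2\<close>;
  \<open>- W5\<close> is a quotient of monic series by \<open>sigma_W5\<close>.\<close>

lemma monic_F5: "monic_at 4 F5"
proof -
  have X0: "ord_ge 0 (X ^ k)" for k
    using ord_ge_power[OF ord_X, of k] by (rule ord_ge_mono) simp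
  have num: "ord_ge 0 (numeral n * X ^ k)" for n k
    using ord_ge_mult[OF ord_ge_numeral X0] by simp
  have numX: "ord_ge 0 (numeral n * X)" for n
    using num[of n 1] by simp
  note intros = ord_ge_add ord_ge_diff ord_ge_uminus num numX ord_ge_numeral
  have "monic_at (-10) (\<sigma>\<^sup>2 + (\<sigma>\<^sup>2 * X * (2 + 2 * X + 8 * X ^ 2 + 8 * X ^ 3) +
      (\<sigma> * (4 + 20 * X + 20 * X ^ 2 - 8 * X ^ 3) + (- 4 - 8 * X ^ 1))))"
  proof (intro monic_at_add ord_ge_add)
    show "monic_at (-10) (\<sigma>\<^sup>2)"
      using monic_at_power[OF monic_sigma, of 2] by simp
    show "ord_ge (-10 + 1) (\<sigma>\<^sup>2 * X * (2 + 2 * X + 8 * X ^ 2 + 8 * X ^ 3))"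
    proof -
      have "ord_ge 0 (2 + 2 * X + 8 * X ^ 2 + 8 * X ^ 3)"
        by (intro intros)
      from ord_ge_mult[OF ord_ge_mult[OF ord_ge_power[OF monic_at_ord_ge[OF monic_sigma], of 2] ord_X] this]
      show ?thesis by simp
    qed
    show "ord_ge (-10 + 1) (\<sigma> * (4 + 20 * X + 20 * X ^ 2 - 8 * X ^ 3))"
      by (rule ord_ge_mono[OF ord_ge_mult[OF monic_at_ord_ge[OF monic_sigma], of 0]])
         (auto intro!: intros)
    have "ord_ge 0 (- 4 - 8 * X ^ 1)"
      by (intro intros)
    then show "ord_ge (-10 + 1) (- 4 - 8 * X ^ 1)"
      by (rule ord_ge_mono) simp
  qed
  also have "\<sigma>\<^sup>2 + (\<sigma>\<^sup>2 * X * (2 + 2 * X + 8 * X ^ 2 + 8 * X ^ 3) +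
      (\<sigma> * (4 + 20 * X + 20 * X ^ 2 - 8 * X ^ 3) + (- 4 - 8 * X ^ 1))) = - H5"
    unfolding H5_def by algebra
  finally have H: "monic_at (-10) (- H5)" .
  have "- W5 = (\<sigma> - 4) / \<sigma>\<^sub>0"
    using sigma_W5 by (simp add: field_simps)
  then have W: "monic_at (-4) (- W5)"
    using monic_at_divide[OF monic_sigma_add(4) monic_sigma0] by simp
  have "F5 = - H5 / ((\<sigma>\<^sup>2 + 4) * (- W5))"
    unfolding F5_def by simp
  also have "monic_at 4 \<dots>"
    using monic_at_divide[OF H monic_at_mult[OF monic_sigma_square W]] by simp
  finally show ?thesis .
qed

lemma P_B_square: "P_B\<^sup>2 * \<sigma>\<^sub>0 = (\<sigma>\<^sub>0\<^sup>2 + 4) * (\<sigma>\<^sub>0 - 4)"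
proof -
  have "(P_B\<^sup>2 * \<sigma>\<^sub>0) * \<sigma>\<^sub>0 = ((\<sigma>\<^sub>0\<^sup>2 + 4) * (\<sigma>\<^sub>0 - 4)) * \<sigma>\<^sub>0"
    using P_B_conv_P_A P_A_square by algebra
  then show ?thesis by simp
qed

lemma A_P_A: "A * P_A * s = V 5 P_B * F5"
proof -
  have "V 5 (P_B\<^sup>2 * \<sigma>\<^sub>0) = V 5 ((\<sigma>\<^sub>0\<^sup>2 + 4) * (\<sigma>\<^sub>0 - 4))"
    by (simp only: P_B_square)
  then have PB: "(V 5 P_B)\<^sup>2 * \<sigma> = (\<sigma>\<^sup>2 + 4) * (\<sigma> - 4)"
    by (simp add: \<sigma>_def)
  have "(A * (\<sigma>\<^sub>0\<^sup>2 + 4)) * W5\<^sup>2 = ((\<sigma>\<^sup>2 + 4) * F5\<^sup>2) * W5\<^sup>2"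
    using M.F_square unfolding A_eq[symmetric] sigma_W5[symmetric]
    by (simp add: algebra_simps power_mult_distrib)
  then have F: "A * (\<sigma>\<^sub>0\<^sup>2 + 4) = (\<sigma>\<^sup>2 + 4) * F5\<^sup>2"
    using W5_neq_0 by simp
  \<comment> \<open>The extra factor clears the denominators of the squares of \<open>P_A\<close>
    and \<open>V 5 P_B\<close>.\<close>
  have "(A * P_A * s)\<^sup>2 * ((\<sigma>\<^sub>0 - 4) * \<sigma>) = (V 5 P_B * F5)\<^sup>2 * ((\<sigma>\<^sub>0 - 4) * \<sigma>)"
  proof -
    have "(A * P_A * s)\<^sup>2 * ((\<sigma>\<^sub>0 - 4) * \<sigma>) = A\<^sup>2 * (P_A\<^sup>2 * (s\<^sup>2 * (\<sigma>\<^sub>0 - 4))) * \<sigma>"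
      by (simp add: power_mult_distrib mult_ac)
    also have "\<dots> = (A * (\<sigma> * \<sigma>\<^sub>0)) * (A * (\<sigma>\<^sub>0\<^sup>2 + 4))"
      unfolding P_A_square by (simp add: power2_eq_square mult_ac)
    also have "\<dots> = (\<sigma>\<^sub>0 - 4) * (\<sigma> - 4) * ((\<sigma>\<^sup>2 + 4) * F5\<^sup>2)"
      unfolding A_sigma F ..
    also have "\<dots> = ((V 5 P_B)\<^sup>2 * \<sigma>) * (F5\<^sup>2 * (\<sigma>\<^sub>0 - 4))"
      unfolding PB by (simp add: mult_ac)
    also have "\<dots> = (V 5 P_B * F5)\<^sup>2 * ((\<sigma>\<^sub>0 - 4) * \<sigma>)"
      by (simp add: power_mult_distrib mult_ac)
    finally show ?thesis .
  qed
  then have "(A * P_A * s)\<^sup>2 = (V 5 P_B * F5)\<^sup>2"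
    by simp
  then have "A * P_A * s = V 5 P_B * F5 \<or> A * P_A * s = - (V 5 P_B * F5)"
    by (simp add: power2_eq_iff)
  moreover have "A * P_A * s \<noteq> - (V 5 P_B * F5)"
  proof
    have "monic_at 0 A"
      unfolding A_def by (rule monic_at_cong, (rule monic_at_intros | simp)+)
    then have "monic_at (-1) (A * P_A * s)"
      using monic_at_mult[OF monic_at_mult[OF _ monic_P_A] monic_sigma_add(1)] by force
    moreover have "monic_at (-1) (V 5 P_B * F5)"
      using monic_at_mult[OF monic_at_V5[OF monic_P_B] monic_F5] by simp
    moreover assume "A * P_A * s = - (V 5 P_B * F5)"
    ultimately show False
      by (simp add: monic_at_def)
  qed
  ultimately show ?thesis by blast
qed

text \<open>No second square root is extracted: \<open>P_B_conv_P_A\<close>, applied at q and at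
  q^5, turns \<open>A_P_A\<close> into \<open>P_B = V 5 P_A * (1 + \<sigma>) * F5\<close>, and
  \<open>B * F5\<close> is \<open>G5\<close>.\<close>

lemma B_P_B: "B * P_B = V 5 P_A * (1 + \<sigma>) * G5"
proof -
  define D where "D = J 1 / (q * J 25)"
  have D: "D \<noteq> 0" and BD: "B * D = 1"
    by (simp_all add: D_def B_def)
  have "G5 * D = F5"
    by (rule M.G_mult) (unfold D_def, rule level_10_relations(2))
  have "V 5 (P_B * \<sigma>\<^sub>0) = V 5 (P_A * (s * (\<sigma>\<^sub>0 - 4)))"
    by (simp only: P_B_conv_P_A)
  then have PB: "V 5 P_B * \<sigma> = V 5 P_A * (1 + \<sigma>) * (\<sigma> - 4)"
    by (simp add: \<sigma>_def mult_ac)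
  have "P_B * ((\<sigma>\<^sub>0 - 4) * (\<sigma> - 4)) = A * (P_B * \<sigma>\<^sub>0) * \<sigma>"
    unfolding A_sigma[symmetric] by (simp add: mult_ac)
  also have "\<dots> = (A * P_A * s) * \<sigma> * (\<sigma>\<^sub>0 - 4)"
    unfolding P_B_conv_P_A by (simp add: mult_ac)
  also have "\<dots> = (V 5 P_B * \<sigma>) * F5 * (\<sigma>\<^sub>0 - 4)"
    unfolding A_P_A by (simp add: mult_ac)
  also have "\<dots> = (V 5 P_A * (1 + \<sigma>) * F5) * ((\<sigma>\<^sub>0 - 4) * (\<sigma> - 4))"
    unfolding PB by (simp add: mult_ac)
  finally have "P_B = V 5 P_A * (1 + \<sigma>) * F5"
    by simp
  then have "B * P_B = V 5 P_A * (1 + \<sigma>) * G5 * (B * D)"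
    unfolding \<open>G5 * D = F5\<close>[symmetric] by (simp add: mult_ac)
  then show ?thesis
    by (simp add: BD)
qed

section \<open>Reduction of \<open>U_A\<close> and \<open>U_B\<close> to \<open>U\<^sub>5\<close> on
  the quintic extension\<close>

lemma s_t: "s * t = 1" "t * s = 1"
  using t_sigma[symmetric] by simp_all

text \<open>The extra \<open>t\<close> on the right undoes the \<open>s\<close> on the left of
  \<open>A_P_A\<close>.\<close>

lemma U_A_t_power: "U_A (P_A * t ^ n) = P_B * U\<^sub>5 (F5 * t * t ^ n)"
proof -
  have "A * (P_A * t ^ n) = A * P_A * (s * t) * t ^ n"
    unfolding s_t by (simp add: mult.assoc)
  also have "\<dots> = (A * P_A * s) * (t * t ^ n)"
    by (simp only: mult_ac)
  finally have "A * (P_A * t ^ n) = V 5 P_B * (F5 * t * t ^ n)"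
    unfolding A_P_A by (simp only: mult.assoc)
  then show ?thesis
    unfolding U_A_def by (simp only: U5_V_mult)
qed

lemma U_B_t_power: "U_B (P_B * t ^ n) = P_A * (s * U\<^sub>5 (G5 * t ^ n))"
proof -
  have "B * (P_B * t ^ n) = V 5 (P_A * s) * (G5 * t ^ n)"
    unfolding mult.assoc[symmetric] B_P_B by (simp add: \<sigma>_def)
  then show ?thesis
    unfolding U_B_def by (simp only: U5_V_mult mult.assoc)
qed

text \<open>\<open>\<gamma>1 ^ m * \<gamma>4 ^ n\<close> has residue class m - n, so for m + n <= 4
  only m = n survives. Then 2 and 6 are central binomial coefficients, and each pair contributes
  \<open>- 1 / \<sigma>\<^sub>0\<close>.\<close>

lemma U5_X_powers: "U\<^sub>5 1 = 1" "U\<^sub>5 X = 0" "U\<^sub>5 (X ^ 2) = - 2 / \<sigma>\<^sub>0" "U\<^sub>5 (X ^ 3) = 0" "U\<^sub>5 (X ^ 4)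
      = 6 / \<sigma>\<^sub>0\<^sup>2"
proof -
  have p: "\<gamma>1 * \<gamma>4 = V 5 (- 1 / \<sigma>\<^sub>0)"
    unfolding gamma_product by (simp add: \<sigma>_def)
  have cls: "U\<^sub>5 (\<gamma>1 ^ m * \<gamma>4 ^ n) = 0" if "(int m + int n * 4) mod 5 \<noteq> 0" for m n
    using cls_mult[OF cls_power[OF cls_gamma(1), of m] cls_power[OF cls_gamma(2), of n]] that
    by (intro U5_cls) auto
  have cls': "U\<^sub>5 (V 5 f * (\<gamma>1 ^ m * \<gamma>4 ^ n)) = 0" if "(int m + int n * 4) mod 5 \<noteq> 0" for m n f
    unfolding U5_V_mult cls[OF that] by simp
  show "U\<^sub>5 1 = 1"
    using U5_V[of 1] by simp
  show "U\<^sub>5 X = 0"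
    using cls[of 1 0] cls[of 0 1] by (simp add: X_def U5_add)
  have "X ^ 2 = \<gamma>1 ^ 2 * \<gamma>4 ^ 0 + \<gamma>1 ^ 0 * \<gamma>4 ^ 2 + V 5 (2 * (- 1 / \<sigma>\<^sub>0))"
    unfolding X_def fls_compose_power_mult p[symmetric] by (simp add: power2_eq_square algebra_simps)
  then show "U\<^sub>5 (X ^ 2) = - 2 / \<sigma>\<^sub>0"
    using cls[of 2 0] cls[of 0 2] by (simp only: U5_add U5_V) simp
  have "X ^ 3 = \<gamma>1 ^ 3 * \<gamma>4 ^ 0 + \<gamma>1 ^ 0 * \<gamma>4 ^ 3 + \<gamma>1 ^ 2 * \<gamma>4 ^ 1 + \<gamma>1 ^ 2 * \<gamma>4 ^ 1
      + \<gamma>1 ^ 2 * \<gamma>4 ^ 1 +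
      \<gamma>1 ^ 1 * \<gamma>4 ^ 2 + \<gamma>1 ^ 1 * \<gamma>4 ^ 2 + \<gamma>1 ^ 1 * \<gamma>4 ^ 2"
    unfolding X_def by algebra
  then show "U\<^sub>5 (X ^ 3) = 0"
    using cls[of 3 0] cls[of 0 3] cls[of 2 1] cls[of 1 2] by (simp only: U5_add) simp
  have "X ^ 4 = \<gamma>1 ^ 4 * \<gamma>4 ^ 0 + \<gamma>1 ^ 0 * \<gamma>4 ^ 4 + V 5 (4 * (- 1 / \<sigma>\<^sub>0)) * (\<gamma>1 ^ 2 * \<gamma>4 ^ 0) +
      V 5 (4 * (- 1 / \<sigma>\<^sub>0)) * (\<gamma>1 ^ 0 * \<gamma>4 ^ 2) + V 5 (6 * (- 1 / \<sigma>\<^sub>0) ^ 2)"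
  proof -
    have "V 5 (4 * (- 1 / \<sigma>\<^sub>0)) = 4 * (\<gamma>1 * \<gamma>4)" "V 5 (6 * (- 1 / \<sigma>\<^sub>0) ^ 2) = 6 * (\<gamma>1 * \<gamma>4) ^ 2"
      unfolding p by simp_all
    then show ?thesis
      unfolding X_def by algebra
  qed
  moreover have "U\<^sub>5 (\<gamma>1 ^ 4 * \<gamma>4 ^ 0) = 0" "U\<^sub>5 (\<gamma>1 ^ 0 * \<gamma>4 ^ 4) = 0"
    "U\<^sub>5 (V 5 f * (\<gamma>1 ^ 2 * \<gamma>4 ^ 0)) = 0" "U\<^sub>5 (V 5 f * (\<gamma>1 ^ 0 * \<gamma>4 ^ 2)) = 0" for f
    by (rule cls cls'; simp)+
  ultimately show "U\<^sub>5 (X ^ 4) = 6 / \<sigma>\<^sub>0\<^sup>2"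
    by (simp only: U5_add U5_V) (simp add: power_divide)
qed

text \<open>b2 and b4 are a2 and a4 with the denominators of \<open>U5_X_powers\<close> divided out
  beforehand, which makes the last hypothesis a polynomial identity modulo
  \<open>s * t = 1\<close>.\<close>

lemma U5_X_poly:
  assumes "f * V 5 d = V 5 a0 + V 5 a1 * X + V 5 a2 * X ^ 2 + V 5 a3 * X ^ 3 + V 5 a4 * X ^ 4"
    and "a2 = \<sigma>\<^sub>0 * b2" "a4 = \<sigma>\<^sub>0\<^sup>2 * b4" "d \<noteq> 0" "a0 - 2 * b2 + 6 * b4 = r * d"
  shows "U\<^sub>5 f = r"
proof -
  have "d * U\<^sub>5 f = U\<^sub>5 (f * V 5 d)"
    by (simp only: U5_V_mult mult.commute[of f])
  also have "\<dots> = a0 - 2 * b2 + 6 * b4"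
    unfolding assms(1-3) U5_add U5_V U5_V_mult U5_X_powers by simp
  finally have "d * U\<^sub>5 f = d * r"
    unfolding assms(5) by (simp add: mult.commute)
  with assms(4) show ?thesis by simp
qed

section \<open>The values of \<open>U\<^sub>5\<close> at \<open>F5 * s ^ i\<close> and
  \<open>G5 * s ^ i\<close> for i = 0, ..., 4\<close>

lemma U5_F_0: "U\<^sub>5 (F5) = - t"
proof (rule U5_X_poly)
  show "F5 * V 5 ((\<sigma>\<^sub>0\<^sup>2 + 4) * (1 + \<sigma>\<^sub>0) ^ 2) =
      V 5 (-20 - 11*\<sigma>\<^sub>0^2 - \<sigma>\<^sub>0^3) + V 5 (8 - 32*\<sigma>\<^sub>0 - 6*\<sigma>\<^sub>0^2 - \<sigma>\<^sub>0^3) * X +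
      V 5 (-8*\<sigma>\<^sub>0 + 20*\<sigma>\<^sub>0^2 - 2*\<sigma>\<^sub>0^3) * X ^ 2 + V 5 (-12*\<sigma>\<^sub>0^2 - 2*\<sigma>\<^sub>0^3) * X ^ 3 +
      V 5 (6*\<sigma>\<^sub>0^3 + \<sigma>\<^sub>0^4) * X ^ 4"
    using M.F_s_0 by (simp add: \<sigma>_def)
  show "-8*\<sigma>\<^sub>0 + 20*\<sigma>\<^sub>0^2 - 2*\<sigma>\<^sub>0^3 = \<sigma>\<^sub>0 * (-8 + 20*\<sigma>\<^sub>0 - 2*\<sigma>\<^sub>0^2)" "6*\<sigma>\<^sub>0^3 + \<sigma>\<^sub>0^4 = \<sigma>\<^sub>0\<^sup>2 * (6*\<sigma>\<^sub>0 + \<sigma>\<^sub>0^2)"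
    by algebra+
  show "(\<sigma>\<^sub>0\<^sup>2 + 4) * (1 + \<sigma>\<^sub>0) ^ 2 \<noteq> 0"
    using sigma_square_neq by simp
  show "-20 - 11*\<sigma>\<^sub>0^2 - \<sigma>\<^sub>0^3 - 2 * (-8 + 20*\<sigma>\<^sub>0 - 2*\<sigma>\<^sub>0^2) + 6 * (6*\<sigma>\<^sub>0 + \<sigma>\<^sub>0^2) =
      (- t) * ((\<sigma>\<^sub>0\<^sup>2 + 4) * (1 + \<sigma>\<^sub>0) ^ 2)"
    using s_t(1) by algebra
qed

lemma U5_F_1: "U\<^sub>5 (F5 * s) = - (5 * t ^ 2)"
proof (rule U5_X_poly)
  show "F5 * s * V 5 ((\<sigma>\<^sub>0\<^sup>2 + 4) * (1 + \<sigma>\<^sub>0) ^ 3) =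
      V 5 (-68 + 8*\<sigma>\<^sub>0 + 5*\<sigma>\<^sub>0^2 - 21*\<sigma>\<^sub>0^3) + V 5 (8 + 40*\<sigma>\<^sub>0 - 14*\<sigma>\<^sub>0^2 - 21*\<sigma>\<^sub>0^3) * X +
      V 5 (-72*\<sigma>\<^sub>0 + 116*\<sigma>\<^sub>0^2 + 8*\<sigma>\<^sub>0^3 - 5*\<sigma>\<^sub>0^4) * X ^ 2 + V 5 (20*\<sigma>\<^sub>0^2 - 6*\<sigma>\<^sub>0^3 - 2*\<sigma>\<^sub>0^4
      - \<sigma>\<^sub>0^5) * X ^ 3 +
      V 5 (-16*\<sigma>\<^sub>0^2 + 34*\<sigma>\<^sub>0^3 + \<sigma>\<^sub>0^4 + \<sigma>\<^sub>0^5) * X ^ 4"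
    using M.F_s_1 by (simp add: \<sigma>_def)
  show "-72*\<sigma>\<^sub>0 + 116*\<sigma>\<^sub>0^2 + 8*\<sigma>\<^sub>0^3 - 5*\<sigma>\<^sub>0^4 = \<sigma>\<^sub>0 * (-72 + 116*\<sigma>\<^sub>0 + 8*\<sigma>\<^sub>0^2 - 5*\<sigma>\<^sub>0^3)" "-16*\<sigma>\<^sub>0^2
      + 34*\<sigma>\<^sub>0^3 + \<sigma>\<^sub>0^4 + \<sigma>\<^sub>0^5 = \<sigma>\<^sub>0\<^sup>2 * (-16 + 34*\<sigma>\<^sub>0 + \<sigma>\<^sub>0^2 + \<sigma>\<^sub>0^3)"
    by algebra+
  show "(\<sigma>\<^sub>0\<^sup>2 + 4) * (1 + \<sigma>\<^sub>0) ^ 3 \<noteq> 0"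
    using sigma_square_neq by simp
  show "-68 + 8*\<sigma>\<^sub>0 + 5*\<sigma>\<^sub>0^2 - 21*\<sigma>\<^sub>0^3 - 2 * (-72 + 116*\<sigma>\<^sub>0 + 8*\<sigma>\<^sub>0^2 - 5*\<sigma>\<^sub>0^3) + 6 * (-16 + 34*\<sigma>\<^sub>0
      + \<sigma>\<^sub>0^2 + \<sigma>\<^sub>0^3) =
      (- (5 * t ^ 2)) * ((\<sigma>\<^sub>0\<^sup>2 + 4) * (1 + \<sigma>\<^sub>0) ^ 3)"
    using s_t(1) by algebra
qed

lemma U5_F_2: "U\<^sub>5 (F5 * s ^ 2) = - (25 * t ^ 3)"
proof (rule U5_X_poly)
  show "F5 * s ^ 2 * V 5 ((\<sigma>\<^sub>0\<^sup>2 + 4) * (1 + \<sigma>\<^sub>0) ^ 4) =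
      V 5 (-308 - 240*\<sigma>\<^sub>0 + 285*\<sigma>\<^sub>0^2 - 65*\<sigma>\<^sub>0^3 - 30*\<sigma>\<^sub>0^4 + 2*\<sigma>\<^sub>0^5) + V 5 (8 + 304*\<sigma>\<^sub>0 + 306*\<sigma>\<^sub>0^2
      - 141*\<sigma>\<^sub>0^3 - 24*\<sigma>\<^sub>0^4 + 2*\<sigma>\<^sub>0^5) * X +
      V 5 (-200*\<sigma>\<^sub>0 - 364*\<sigma>\<^sub>0^2 + 614*\<sigma>\<^sub>0^3 - 104*\<sigma>\<^sub>0^4 - 6*\<sigma>\<^sub>0^5 + \<sigma>\<^sub>0^6) * X ^ 2 + V 5 (52*\<sigma>\<^sub>0^2
      + 118*\<sigma>\<^sub>0^3 - 48*\<sigma>\<^sub>0^4 + 8*\<sigma>\<^sub>0^5 - 3*\<sigma>\<^sub>0^6) * X ^ 3 +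
      V 5 (-32*\<sigma>\<^sub>0^2 - 98*\<sigma>\<^sub>0^3 + 153*\<sigma>\<^sub>0^4 - 28*\<sigma>\<^sub>0^5 + 3*\<sigma>\<^sub>0^6) * X ^ 4"
    using M.F_s_2 by (simp add: \<sigma>_def)
  show "-200*\<sigma>\<^sub>0 - 364*\<sigma>\<^sub>0^2 + 614*\<sigma>\<^sub>0^3 - 104*\<sigma>\<^sub>0^4 - 6*\<sigma>\<^sub>0^5 + \<sigma>\<^sub>0^6 = \<sigma>\<^sub>0 * (-200 - 364*\<sigma>\<^sub>0 + 614*\<sigma>\<^sub>0^2
      - 104*\<sigma>\<^sub>0^3 - 6*\<sigma>\<^sub>0^4 + \<sigma>\<^sub>0^5)" "-32*\<sigma>\<^sub>0^2 - 98*\<sigma>\<^sub>0^3 + 153*\<sigma>\<^sub>0^4 - 28*\<sigma>\<^sub>0^5 + 3*\<sigma>\<^sub>0^6 = \<sigma>\<^sub>0\<^sup>2 * (-32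
      - 98*\<sigma>\<^sub>0 + 153*\<sigma>\<^sub>0^2 - 28*\<sigma>\<^sub>0^3 + 3*\<sigma>\<^sub>0^4)"
    by algebra+
  show "(\<sigma>\<^sub>0\<^sup>2 + 4) * (1 + \<sigma>\<^sub>0) ^ 4 \<noteq> 0"
    using sigma_square_neq by simp
  show "-308 - 240*\<sigma>\<^sub>0 + 285*\<sigma>\<^sub>0^2 - 65*\<sigma>\<^sub>0^3 - 30*\<sigma>\<^sub>0^4 + 2*\<sigma>\<^sub>0^5 - 2 * (-200 - 364*\<sigma>\<^sub>0 + 614*\<sigma>\<^sub>0^2
      - 104*\<sigma>\<^sub>0^3 - 6*\<sigma>\<^sub>0^4 + \<sigma>\<^sub>0^5) + 6 * (-32 - 98*\<sigma>\<^sub>0 + 153*\<sigma>\<^sub>0^2 - 28*\<sigma>\<^sub>0^3 + 3*\<sigma>\<^sub>0^4) =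
      (- (25 * t ^ 3)) * ((\<sigma>\<^sub>0\<^sup>2 + 4) * (1 + \<sigma>\<^sub>0) ^ 4)"
    using s_t(1) by algebra
qed

lemma U5_F_3: "U\<^sub>5 (F5 * s ^ 3) = - (125 * t ^ 4)"
proof (rule U5_X_poly)
  show "F5 * s ^ 3 * V 5 ((\<sigma>\<^sub>0\<^sup>2 + 4) * (1 + \<sigma>\<^sub>0) ^ 5) =
      V 5 (-996 - 4200*\<sigma>\<^sub>0 + 1245*\<sigma>\<^sub>0^2 + 635*\<sigma>\<^sub>0^3 - 150*\<sigma>\<^sub>0^4 - 76*\<sigma>\<^sub>0^5 + 10*\<sigma>\<^sub>0^6) + V 5 (8
      + 1784*\<sigma>\<^sub>0 + 634*\<sigma>\<^sub>0^2 + 1855*\<sigma>\<^sub>0^3 - 1220*\<sigma>\<^sub>0^4 + 158*\<sigma>\<^sub>0^5 - \<sigma>\<^sub>0^6 - \<sigma>\<^sub>0^7) * X +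
      V 5 (-392*\<sigma>\<^sub>0 - 4940*\<sigma>\<^sub>0^2 + 1240*\<sigma>\<^sub>0^3 + 1595*\<sigma>\<^sub>0^4 - 450*\<sigma>\<^sub>0^5 - 2*\<sigma>\<^sub>0^6 + 5*\<sigma>\<^sub>0^7) * X ^ 2
      + V 5 (340*\<sigma>\<^sub>0^2 + 50*\<sigma>\<^sub>0^3 + 550*\<sigma>\<^sub>0^4 - 325*\<sigma>\<^sub>0^5 + 75*\<sigma>\<^sub>0^6 - 10*\<sigma>\<^sub>0^7) * X ^ 3 +
      V 5 (-48*\<sigma>\<^sub>0^2 - 1030*\<sigma>\<^sub>0^3 + 185*\<sigma>\<^sub>0^4 + 405*\<sigma>\<^sub>0^5 - 125*\<sigma>\<^sub>0^6 + 12*\<sigma>\<^sub>0^7) * X ^ 4"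
    using M.F_s_3 by (simp add: \<sigma>_def)
  show "-392*\<sigma>\<^sub>0 - 4940*\<sigma>\<^sub>0^2 + 1240*\<sigma>\<^sub>0^3 + 1595*\<sigma>\<^sub>0^4 - 450*\<sigma>\<^sub>0^5 - 2*\<sigma>\<^sub>0^6 + 5*\<sigma>\<^sub>0^7 = \<sigma>\<^sub>0 * (-392
      - 4940*\<sigma>\<^sub>0 + 1240*\<sigma>\<^sub>0^2 + 1595*\<sigma>\<^sub>0^3 - 450*\<sigma>\<^sub>0^4 - 2*\<sigma>\<^sub>0^5 + 5*\<sigma>\<^sub>0^6)" "-48*\<sigma>\<^sub>0^2 - 1030*\<sigma>\<^sub>0^3
      + 185*\<sigma>\<^sub>0^4 + 405*\<sigma>\<^sub>0^5 - 125*\<sigma>\<^sub>0^6 + 12*\<sigma>\<^sub>0^7 = \<sigma>\<^sub>0\<^sup>2 * (-48 - 1030*\<sigma>\<^sub>0 + 185*\<sigma>\<^sub>0^2 + 405*\<sigma>\<^sub>0^3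
      - 125*\<sigma>\<^sub>0^4 + 12*\<sigma>\<^sub>0^5)"
    by algebra+
  show "(\<sigma>\<^sub>0\<^sup>2 + 4) * (1 + \<sigma>\<^sub>0) ^ 5 \<noteq> 0"
    using sigma_square_neq by simp
  show "-996 - 4200*\<sigma>\<^sub>0 + 1245*\<sigma>\<^sub>0^2 + 635*\<sigma>\<^sub>0^3 - 150*\<sigma>\<^sub>0^4 - 76*\<sigma>\<^sub>0^5 + 10*\<sigma>\<^sub>0^6 - 2 * (-392
      - 4940*\<sigma>\<^sub>0 + 1240*\<sigma>\<^sub>0^2 + 1595*\<sigma>\<^sub>0^3 - 450*\<sigma>\<^sub>0^4 - 2*\<sigma>\<^sub>0^5 + 5*\<sigma>\<^sub>0^6) + 6 * (-48 - 1030*\<sigma>\<^sub>0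
      + 185*\<sigma>\<^sub>0^2 + 405*\<sigma>\<^sub>0^3 - 125*\<sigma>\<^sub>0^4 + 12*\<sigma>\<^sub>0^5) =
      (- (125 * t ^ 4)) * ((\<sigma>\<^sub>0\<^sup>2 + 4) * (1 + \<sigma>\<^sub>0) ^ 5)"
    using s_t(1) by algebra
qed

lemma U5_F_4: "U\<^sub>5 (F5 * s ^ 4) = 1 + 5 * t - 250 * t ^ 2 + 1750 * t ^ 3 - 4375 * t ^ 4
      + 2500 * t ^ 5"
proof (rule U5_X_poly)
  show "F5 * s ^ 4 * V 5 ((\<sigma>\<^sub>0\<^sup>2 + 4) * (1 + \<sigma>\<^sub>0) ^ 5) =
      V 5 (-2388 - 29068*\<sigma>\<^sub>0 + 12081*\<sigma>\<^sub>0^2 - 930*\<sigma>\<^sub>0^3 + 990*\<sigma>\<^sub>0^4 - 518*\<sigma>\<^sub>0^5 + 52*\<sigma>\<^sub>0^6 + \<sigma>\<^sub>0^7)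
      + V 5 (8 + 8568*\<sigma>\<^sub>0 - 2542*\<sigma>\<^sub>0^2 + 10405*\<sigma>\<^sub>0^3 - 6605*\<sigma>\<^sub>0^4 + 1233*\<sigma>\<^sub>0^5 - 37*\<sigma>\<^sub>0^6 - 7*\<sigma>\<^sub>0^7) * X +
      V 5 (-648*\<sigma>\<^sub>0 - 26724*\<sigma>\<^sub>0^2 + 6530*\<sigma>\<^sub>0^3 + 5350*\<sigma>\<^sub>0^4 - 1650*\<sigma>\<^sub>0^5 + 2*\<sigma>\<^sub>0^6 + 21*\<sigma>\<^sub>0^7) * X ^ 2
      + V 5 (1652*\<sigma>\<^sub>0^2 - 1030*\<sigma>\<^sub>0^3 + 2710*\<sigma>\<^sub>0^4 - 1670*\<sigma>\<^sub>0^5 + 400*\<sigma>\<^sub>0^6 - 38*\<sigma>\<^sub>0^7) * X ^ 3 +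
      V 5 (-64*\<sigma>\<^sub>0^2 - 5130*\<sigma>\<^sub>0^3 + 795*\<sigma>\<^sub>0^4 + 1525*\<sigma>\<^sub>0^5 - 535*\<sigma>\<^sub>0^6 + 51*\<sigma>\<^sub>0^7) * X ^ 4"
    using M.F_s_4 by (simp add: \<sigma>_def)
  show "-648*\<sigma>\<^sub>0 - 26724*\<sigma>\<^sub>0^2 + 6530*\<sigma>\<^sub>0^3 + 5350*\<sigma>\<^sub>0^4 - 1650*\<sigma>\<^sub>0^5 + 2*\<sigma>\<^sub>0^6 + 21*\<sigma>\<^sub>0^7 = \<sigma>\<^sub>0 * (-648
      - 26724*\<sigma>\<^sub>0 + 6530*\<sigma>\<^sub>0^2 + 5350*\<sigma>\<^sub>0^3 - 1650*\<sigma>\<^sub>0^4 + 2*\<sigma>\<^sub>0^5 + 21*\<sigma>\<^sub>0^6)" "-64*\<sigma>\<^sub>0^2 - 5130*\<sigma>\<^sub>0^3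
      + 795*\<sigma>\<^sub>0^4 + 1525*\<sigma>\<^sub>0^5 - 535*\<sigma>\<^sub>0^6 + 51*\<sigma>\<^sub>0^7 = \<sigma>\<^sub>0\<^sup>2 * (-64 - 5130*\<sigma>\<^sub>0 + 795*\<sigma>\<^sub>0^2 + 1525*\<sigma>\<^sub>0^3
      - 535*\<sigma>\<^sub>0^4 + 51*\<sigma>\<^sub>0^5)"
    by algebra+
  show "(\<sigma>\<^sub>0\<^sup>2 + 4) * (1 + \<sigma>\<^sub>0) ^ 5 \<noteq> 0"
    using sigma_square_neq by simp
  show "-2388 - 29068*\<sigma>\<^sub>0 + 12081*\<sigma>\<^sub>0^2 - 930*\<sigma>\<^sub>0^3 + 990*\<sigma>\<^sub>0^4 - 518*\<sigma>\<^sub>0^5 + 52*\<sigma>\<^sub>0^6 + \<sigma>\<^sub>0^7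
      - 2 * (-648 - 26724*\<sigma>\<^sub>0 + 6530*\<sigma>\<^sub>0^2 + 5350*\<sigma>\<^sub>0^3 - 1650*\<sigma>\<^sub>0^4 + 2*\<sigma>\<^sub>0^5 + 21*\<sigma>\<^sub>0^6) + 6 * (-64
      - 5130*\<sigma>\<^sub>0 + 795*\<sigma>\<^sub>0^2 + 1525*\<sigma>\<^sub>0^3 - 535*\<sigma>\<^sub>0^4 + 51*\<sigma>\<^sub>0^5) =
      (1 + 5 * t - 250 * t ^ 2 + 1750 * t ^ 3 - 4375 * t ^ 4 + 2500 * t ^ 5) * ((\<sigma>\<^sub>0\<^sup>2 + 4) * (1
      + \<sigma>\<^sub>0) ^ 5)"
    using s_t(1) by algebra
qed

lemma U5_G_0: "U\<^sub>5 (G5) = t"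
proof (rule U5_X_poly)
  show "G5 * V 5 ((\<sigma>\<^sub>0\<^sup>2 + 4) * (1 + \<sigma>\<^sub>0) ^ 1) =
      V 5 (-4 + 4*\<sigma>\<^sub>0 + \<sigma>\<^sub>0^2) + V 5 (12*\<sigma>\<^sub>0) * X +
      V 5 (-4*\<sigma>\<^sub>0 + 2*\<sigma>\<^sub>0^2) * X ^ 2 + V 5 (4*\<sigma>\<^sub>0^2) * X ^ 3 +
      V 5 (0) * X ^ 4"
    using M.G_s_0 by (simp add: \<sigma>_def)
  show "-4*\<sigma>\<^sub>0 + 2*\<sigma>\<^sub>0^2 = \<sigma>\<^sub>0 * (-4 + 2*\<sigma>\<^sub>0)" "0 = \<sigma>\<^sub>0\<^sup>2 * (0)"
    by algebra+
  show "(\<sigma>\<^sub>0\<^sup>2 + 4) * (1 + \<sigma>\<^sub>0) ^ 1 \<noteq> 0"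
    using sigma_square_neq by simp
  show "-4 + 4*\<sigma>\<^sub>0 + \<sigma>\<^sub>0^2 - 2 * (-4 + 2*\<sigma>\<^sub>0) + 6 * (0) =
      (t) * ((\<sigma>\<^sub>0\<^sup>2 + 4) * (1 + \<sigma>\<^sub>0) ^ 1)"
    using s_t(1) by algebra
qed

lemma U5_G_1: "U\<^sub>5 (G5 * s) = t * (2 - 5 * t)"
proof (rule U5_X_poly)
  show "G5 * s * V 5 ((\<sigma>\<^sub>0\<^sup>2 + 4) * (1 + \<sigma>\<^sub>0) ^ 3) =
      V 5 (-20 - 64*\<sigma>\<^sub>0 + 9*\<sigma>\<^sub>0^2 + 5*\<sigma>\<^sub>0^3 + 2*\<sigma>\<^sub>0^4) + V 5 (28*\<sigma>\<^sub>0 + 28*\<sigma>\<^sub>0^2 + 22*\<sigma>\<^sub>0^3 - 3*\<sigma>\<^sub>0^4) * X +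
      V 5 (-4*\<sigma>\<^sub>0 - 102*\<sigma>\<^sub>0^2 + 8*\<sigma>\<^sub>0^3 + 6*\<sigma>\<^sub>0^4) * X ^ 2 + V 5 (4*\<sigma>\<^sub>0^2 + 8*\<sigma>\<^sub>0^3 + 4*\<sigma>\<^sub>0^4) * X ^ 3 +
      V 5 (-24*\<sigma>\<^sub>0^3 + 2*\<sigma>\<^sub>0^4 + \<sigma>\<^sub>0^5) * X ^ 4"
    using M.G_s_1 by (simp add: \<sigma>_def)
  show "-4*\<sigma>\<^sub>0 - 102*\<sigma>\<^sub>0^2 + 8*\<sigma>\<^sub>0^3 + 6*\<sigma>\<^sub>0^4 = \<sigma>\<^sub>0 * (-4 - 102*\<sigma>\<^sub>0 + 8*\<sigma>\<^sub>0^2 + 6*\<sigma>\<^sub>0^3)" "-24*\<sigma>\<^sub>0^3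
      + 2*\<sigma>\<^sub>0^4 + \<sigma>\<^sub>0^5 = \<sigma>\<^sub>0\<^sup>2 * (-24*\<sigma>\<^sub>0 + 2*\<sigma>\<^sub>0^2 + \<sigma>\<^sub>0^3)"
    by algebra+
  show "(\<sigma>\<^sub>0\<^sup>2 + 4) * (1 + \<sigma>\<^sub>0) ^ 3 \<noteq> 0"
    using sigma_square_neq by simp
  show "-20 - 64*\<sigma>\<^sub>0 + 9*\<sigma>\<^sub>0^2 + 5*\<sigma>\<^sub>0^3 + 2*\<sigma>\<^sub>0^4 - 2 * (-4 - 102*\<sigma>\<^sub>0 + 8*\<sigma>\<^sub>0^2 + 6*\<sigma>\<^sub>0^3)
      + 6 * (-24*\<sigma>\<^sub>0 + 2*\<sigma>\<^sub>0^2 + \<sigma>\<^sub>0^3) =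
      (t * (2 - 5 * t)) * ((\<sigma>\<^sub>0\<^sup>2 + 4) * (1 + \<sigma>\<^sub>0) ^ 3)"
    using s_t(1) by algebra
qed

lemma U5_G_2: "U\<^sub>5 (G5 * s ^ 2) = t * (8 - 40 * t + 25 * t ^ 2)"
proof (rule U5_X_poly)
  show "G5 * s ^ 2 * V 5 ((\<sigma>\<^sub>0\<^sup>2 + 4) * (1 + \<sigma>\<^sub>0) ^ 4) =
      V 5 (-36 - 592*\<sigma>\<^sub>0 - 307*\<sigma>\<^sub>0^2 + \<sigma>\<^sub>0^3 + 10*\<sigma>\<^sub>0^4 + 8*\<sigma>\<^sub>0^5) + V 5 (172*\<sigma>\<^sub>0 - 4*\<sigma>\<^sub>0^2 + 236*\<sigma>\<^sub>0^3
      + 22*\<sigma>\<^sub>0^4 - 15*\<sigma>\<^sub>0^5) * X +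
      V 5 (-4*\<sigma>\<^sub>0 - 522*\<sigma>\<^sub>0^2 - 382*\<sigma>\<^sub>0^3 + 36*\<sigma>\<^sub>0^4 + 25*\<sigma>\<^sub>0^5) * X ^ 2 + V 5 (36*\<sigma>\<^sub>0^2 - 28*\<sigma>\<^sub>0^3
      + 60*\<sigma>\<^sub>0^4 - 2*\<sigma>\<^sub>0^5 - \<sigma>\<^sub>0^6) * X ^ 3 +
      V 5 (-96*\<sigma>\<^sub>0^3 - 88*\<sigma>\<^sub>0^4 + 12*\<sigma>\<^sub>0^5 + 4*\<sigma>\<^sub>0^6) * X ^ 4"
    using M.G_s_2 by (simp add: \<sigma>_def)
  show "-4*\<sigma>\<^sub>0 - 522*\<sigma>\<^sub>0^2 - 382*\<sigma>\<^sub>0^3 + 36*\<sigma>\<^sub>0^4 + 25*\<sigma>\<^sub>0^5 = \<sigma>\<^sub>0 * (-4 - 522*\<sigma>\<^sub>0 - 382*\<sigma>\<^sub>0^2 + 36*\<sigma>\<^sub>0^3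
      + 25*\<sigma>\<^sub>0^4)" "-96*\<sigma>\<^sub>0^3 - 88*\<sigma>\<^sub>0^4 + 12*\<sigma>\<^sub>0^5 + 4*\<sigma>\<^sub>0^6 = \<sigma>\<^sub>0\<^sup>2 * (-96*\<sigma>\<^sub>0 - 88*\<sigma>\<^sub>0^2 + 12*\<sigma>\<^sub>0^3
      + 4*\<sigma>\<^sub>0^4)"
    by algebra+
  show "(\<sigma>\<^sub>0\<^sup>2 + 4) * (1 + \<sigma>\<^sub>0) ^ 4 \<noteq> 0"
    using sigma_square_neq by simp
  show "-36 - 592*\<sigma>\<^sub>0 - 307*\<sigma>\<^sub>0^2 + \<sigma>\<^sub>0^3 + 10*\<sigma>\<^sub>0^4 + 8*\<sigma>\<^sub>0^5 - 2 * (-4 - 522*\<sigma>\<^sub>0 - 382*\<sigma>\<^sub>0^2 + 36*\<sigma>\<^sub>0^3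
      + 25*\<sigma>\<^sub>0^4) + 6 * (-96*\<sigma>\<^sub>0 - 88*\<sigma>\<^sub>0^2 + 12*\<sigma>\<^sub>0^3 + 4*\<sigma>\<^sub>0^4) =
      (t * (8 - 40 * t + 25 * t ^ 2)) * ((\<sigma>\<^sub>0\<^sup>2 + 4) * (1 + \<sigma>\<^sub>0) ^ 4)"
    using s_t(1) by algebra
qed

lemma U5_G_3: "U\<^sub>5 (G5 * s ^ 3) = t * (34 - 170 * t + 125 * t ^ 3)"
proof (rule U5_X_poly)
  show "G5 * s ^ 3 * V 5 ((\<sigma>\<^sub>0\<^sup>2 + 4) * (1 + \<sigma>\<^sub>0) ^ 5) =
      V 5 (-52 - 2992*\<sigma>\<^sub>0 - 5087*\<sigma>\<^sub>0^2 - 1243*\<sigma>\<^sub>0^3 - 272*\<sigma>\<^sub>0^4 + 110*\<sigma>\<^sub>0^5 + 36*\<sigma>\<^sub>0^6) + V 5 (572*\<sigma>\<^sub>0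
      + 1644*\<sigma>\<^sub>0^2 + 506*\<sigma>\<^sub>0^3 + 1299*\<sigma>\<^sub>0^4 - 79*\<sigma>\<^sub>0^5 - 69*\<sigma>\<^sub>0^6) * X +
      V 5 (-4*\<sigma>\<^sub>0 - 2222*\<sigma>\<^sub>0^2 - 4272*\<sigma>\<^sub>0^3 - 1398*\<sigma>\<^sub>0^4 + 153*\<sigma>\<^sub>0^5 + 123*\<sigma>\<^sub>0^6 + \<sigma>\<^sub>0^7) * X ^ 2
      + V 5 (100*\<sigma>\<^sub>0^2 + 344*\<sigma>\<^sub>0^3 - 24*\<sigma>\<^sub>0^4 + 314*\<sigma>\<^sub>0^5 - 49*\<sigma>\<^sub>0^6 - 6*\<sigma>\<^sub>0^7) * X ^ 3 +
      V 5 (-408*\<sigma>\<^sub>0^3 - 782*\<sigma>\<^sub>0^4 - 323*\<sigma>\<^sub>0^5 + 68*\<sigma>\<^sub>0^6 + 17*\<sigma>\<^sub>0^7) * X ^ 4"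
    using M.G_s_3 by (simp add: \<sigma>_def)
  show "-4*\<sigma>\<^sub>0 - 2222*\<sigma>\<^sub>0^2 - 4272*\<sigma>\<^sub>0^3 - 1398*\<sigma>\<^sub>0^4 + 153*\<sigma>\<^sub>0^5 + 123*\<sigma>\<^sub>0^6 + \<sigma>\<^sub>0^7 = \<sigma>\<^sub>0 * (-4
      - 2222*\<sigma>\<^sub>0 - 4272*\<sigma>\<^sub>0^2 - 1398*\<sigma>\<^sub>0^3 + 153*\<sigma>\<^sub>0^4 + 123*\<sigma>\<^sub>0^5 + \<sigma>\<^sub>0^6)" "-408*\<sigma>\<^sub>0^3 - 782*\<sigma>\<^sub>0^4
      - 323*\<sigma>\<^sub>0^5 + 68*\<sigma>\<^sub>0^6 + 17*\<sigma>\<^sub>0^7 = \<sigma>\<^sub>0\<^sup>2 * (-408*\<sigma>\<^sub>0 - 782*\<sigma>\<^sub>0^2 - 323*\<sigma>\<^sub>0^3 + 68*\<sigma>\<^sub>0^4 + 17*\<sigma>\<^sub>0^5)"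
    by algebra+
  show "(\<sigma>\<^sub>0\<^sup>2 + 4) * (1 + \<sigma>\<^sub>0) ^ 5 \<noteq> 0"
    using sigma_square_neq by simp
  show "-52 - 2992*\<sigma>\<^sub>0 - 5087*\<sigma>\<^sub>0^2 - 1243*\<sigma>\<^sub>0^3 - 272*\<sigma>\<^sub>0^4 + 110*\<sigma>\<^sub>0^5 + 36*\<sigma>\<^sub>0^6 - 2 * (-4 - 2222*\<sigma>\<^sub>0
      - 4272*\<sigma>\<^sub>0^2 - 1398*\<sigma>\<^sub>0^3 + 153*\<sigma>\<^sub>0^4 + 123*\<sigma>\<^sub>0^5 + \<sigma>\<^sub>0^6) + 6 * (-408*\<sigma>\<^sub>0 - 782*\<sigma>\<^sub>0^2 - 323*\<sigma>\<^sub>0^3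
      + 68*\<sigma>\<^sub>0^4 + 17*\<sigma>\<^sub>0^5) =
      (t * (34 - 170 * t + 125 * t ^ 3)) * ((\<sigma>\<^sub>0\<^sup>2 + 4) * (1 + \<sigma>\<^sub>0) ^ 5)"
    using s_t(1) by algebra
qed

lemma U5_G_4: "U\<^sub>5 (G5 * s ^ 4) = t * (150 - 640 * t - 900 * t ^ 2 + 2000 * t ^ 3 - 625 * t ^ 4)"
proof (rule U5_X_poly)
  show "G5 * s ^ 4 * V 5 ((\<sigma>\<^sub>0\<^sup>2 + 4) * (1 + \<sigma>\<^sub>0) ^ 6) =
      V 5 (-68 - 12000*\<sigma>\<^sub>0 - 43179*\<sigma>\<^sub>0^2 - 30335*\<sigma>\<^sub>0^3 - 7620*\<sigma>\<^sub>0^4 - 1568*\<sigma>\<^sub>0^5 + 880*\<sigma>\<^sub>0^6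
      + 166*\<sigma>\<^sub>0^7) + V 5 (1356*\<sigma>\<^sub>0 + 14764*\<sigma>\<^sub>0^2 + 12024*\<sigma>\<^sub>0^3 + 8100*\<sigma>\<^sub>0^4 + 5830*\<sigma>\<^sub>0^5 - 854*\<sigma>\<^sub>0^6
      - 326*\<sigma>\<^sub>0^7 - \<sigma>\<^sub>0^8) * X +
      V 5 (-4*\<sigma>\<^sub>0 - 7954*\<sigma>\<^sub>0^2 - 36142*\<sigma>\<^sub>0^3 - 23400*\<sigma>\<^sub>0^4 - 7070*\<sigma>\<^sub>0^5 + 1246*\<sigma>\<^sub>0^6 + 616*\<sigma>\<^sub>0^7
      + 8*\<sigma>\<^sub>0^8) * X ^ 2 + V 5 (196*\<sigma>\<^sub>0^2 + 2980*\<sigma>\<^sub>0^3 + 2280*\<sigma>\<^sub>0^4 + 1140*\<sigma>\<^sub>0^5 + 1350*\<sigma>\<^sub>0^6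
      - 324*\<sigma>\<^sub>0^7 - 30*\<sigma>\<^sub>0^8) * X ^ 3 +
      V 5 (-1408*\<sigma>\<^sub>0^3 - 6880*\<sigma>\<^sub>0^4 - 4240*\<sigma>\<^sub>0^5 - 1520*\<sigma>\<^sub>0^6 + 450*\<sigma>\<^sub>0^7 + 77*\<sigma>\<^sub>0^8) * X ^ 4"
    using M.G_s_4 by (simp add: \<sigma>_def)
  show "-4*\<sigma>\<^sub>0 - 7954*\<sigma>\<^sub>0^2 - 36142*\<sigma>\<^sub>0^3 - 23400*\<sigma>\<^sub>0^4 - 7070*\<sigma>\<^sub>0^5 + 1246*\<sigma>\<^sub>0^6 + 616*\<sigma>\<^sub>0^7 + 8*\<sigma>\<^sub>0^8
      = \<sigma>\<^sub>0 * (-4 - 7954*\<sigma>\<^sub>0 - 36142*\<sigma>\<^sub>0^2 - 23400*\<sigma>\<^sub>0^3 - 7070*\<sigma>\<^sub>0^4 + 1246*\<sigma>\<^sub>0^5 + 616*\<sigma>\<^sub>0^6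
      + 8*\<sigma>\<^sub>0^7)" "-1408*\<sigma>\<^sub>0^3 - 6880*\<sigma>\<^sub>0^4 - 4240*\<sigma>\<^sub>0^5 - 1520*\<sigma>\<^sub>0^6 + 450*\<sigma>\<^sub>0^7 + 77*\<sigma>\<^sub>0^8
      = \<sigma>\<^sub>0\<^sup>2 * (-1408*\<sigma>\<^sub>0 - 6880*\<sigma>\<^sub>0^2 - 4240*\<sigma>\<^sub>0^3 - 1520*\<sigma>\<^sub>0^4 + 450*\<sigma>\<^sub>0^5 + 77*\<sigma>\<^sub>0^6)"
    by algebra+
  show "(\<sigma>\<^sub>0\<^sup>2 + 4) * (1 + \<sigma>\<^sub>0) ^ 6 \<noteq> 0"
    using sigma_square_neq by simp
  show "-68 - 12000*\<sigma>\<^sub>0 - 43179*\<sigma>\<^sub>0^2 - 30335*\<sigma>\<^sub>0^3 - 7620*\<sigma>\<^sub>0^4 - 1568*\<sigma>\<^sub>0^5 + 880*\<sigma>\<^sub>0^6 + 166*\<sigma>\<^sub>0^7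
      - 2 * (-4 - 7954*\<sigma>\<^sub>0 - 36142*\<sigma>\<^sub>0^2 - 23400*\<sigma>\<^sub>0^3 - 7070*\<sigma>\<^sub>0^4 + 1246*\<sigma>\<^sub>0^5 + 616*\<sigma>\<^sub>0^6 + 8*\<sigma>\<^sub>0^7)
      + 6 * (-1408*\<sigma>\<^sub>0 - 6880*\<sigma>\<^sub>0^2 - 4240*\<sigma>\<^sub>0^3 - 1520*\<sigma>\<^sub>0^4 + 450*\<sigma>\<^sub>0^5 + 77*\<sigma>\<^sub>0^6) =
      (t * (150 - 640 * t - 900 * t ^ 2 + 2000 * t ^ 3 - 625 * t ^ 4)) * ((\<sigma>\<^sub>0\<^sup>2 + 4) * (1 + \<sigma>\<^sub>0) ^ 6)"
    using s_t(1) by algebra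
qed

text \<open>The modular equation times \<open>(V 5 t) ^ 5 * t ^ 5\<close>, solved for
  \<open>t ^ 5\<close>. Its coefficients are then polynomials in \<open>V 5 t\<close>, which leave
  \<open>U\<^sub>5\<close> as polynomials in \<open>t\<close>.\<close>

lemma U5_rec:
  "U\<^sub>5 (f * t ^ (n + 5)) = (55 * t - 300 * t ^ 2 + 875 * t ^ 3 - 1250 * t ^ 4
      + 625 * t ^ 5) * U\<^sub>5 (f * t ^ (n + 4))
    - (60 * t - 175 * t ^ 2 + 250 * t ^ 3 - 125 * t ^ 4) * U\<^sub>5 (f * t ^ (n + 3))
    + (35 * t - 50 * t ^ 2 + 25 * t ^ 3) * U\<^sub>5 (f * t ^ (n + 2))
    - (10 * t - 5 * t ^ 2) * U\<^sub>5 (f * t ^ (n + 1)) + t * U\<^sub>5 (f * t ^ n)"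
proof -
  define T where "T = V 5 t"
  have "V 5 (s * t) = V 5 1"
    by (simp only: s_t)
  then have T: "(1 + \<sigma>) * T = 1"
    by (simp add: T_def \<sigma>_def)
  \<comment> \<open>Clears the powers of \<open>V 5 s\<close>, as fact \<open>3\<close> does for
    those of \<open>s\<close>. General S and r keep S T = 1 and r t = 1 the only relations in
    play.\<close>
  have 1: "(S ^ 4 * r ^ 5 - (10 * S ^ 4 - 5 * S ^ 3) * r ^ 4 +
      (35 * S ^ 4 - 50 * S ^ 3 + 25 * S ^ 2) * r ^ 3 -
      (60 * S ^ 4 - 175 * S ^ 3 + 250 * S ^ 2 - 125 * S) * r ^ 2 +
      (55 * S ^ 4 - 300 * S ^ 3 + 875 * S ^ 2 - 1250 * S + 625) * r - S ^ 5) * T ^ 5 =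
      T * r ^ 5 - (10 * T - 5 * T ^ 2) * r ^ 4 + (35 * T - 50 * T ^ 2 + 25 * T ^ 3) * r ^ 3 -
      (60 * T - 175 * T ^ 2 + 250 * T ^ 3 - 125 * T ^ 4) * r ^ 2 +
      (55 * T - 300 * T ^ 2 + 875 * T ^ 3 - 1250 * T ^ 4 + 625 * T ^ 5) * r - 1" if "S * T
      = 1" for S r :: "rat fls"
  proof -
    have "S ^ 5 * T ^ 5 = 1" "S ^ 4 * T ^ 5 = T" "S ^ 3 * T ^ 5 = T ^ 2" "S ^ 2 * T ^ 5
      = T ^ 3" "S * T ^ 5 = T ^ 4"
      using that by algebra+
    then show ?thesis
      by algebra
  qed
  have 2: "0 = T * s ^ 5 - (10 * T - 5 * T ^ 2) * s ^ 4 + (35 * T - 50 * T ^ 2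
      + 25 * T ^ 3) * s ^ 3 -
      (60 * T - 175 * T ^ 2 + 250 * T ^ 3 - 125 * T ^ 4) * s ^ 2 +
      (55 * T - 300 * T ^ 2 + 875 * T ^ 3 - 1250 * T ^ 4 + 625 * T ^ 5) * s - 1"
    using 1[OF T, of s] unfolding M.modular_equation mult_zero_left .
  have 3: "(T * r ^ 5 - (10 * T - 5 * T ^ 2) * r ^ 4 + (35 * T - 50 * T ^ 2 + 25 * T ^ 3) * r ^ 3 -
      (60 * T - 175 * T ^ 2 + 250 * T ^ 3 - 125 * T ^ 4) * r ^ 2 +
      (55 * T - 300 * T ^ 2 + 875 * T ^ 3 - 1250 * T ^ 4 + 625 * T ^ 5) * r - 1) * t ^ 5 =
      T - (10 * T - 5 * T ^ 2) * t + (35 * T - 50 * T ^ 2 + 25 * T ^ 3) * t ^ 2 -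
      (60 * T - 175 * T ^ 2 + 250 * T ^ 3 - 125 * T ^ 4) * t ^ 3 +
      (55 * T - 300 * T ^ 2 + 875 * T ^ 3 - 1250 * T ^ 4 + 625 * T ^ 5) * t ^ 4
      - t ^ 5" if "r * t = 1" for r
  proof -
    have "r ^ 5 * t ^ 5 = 1" "r ^ 4 * t ^ 5 = t" "r ^ 3 * t ^ 5 = t ^ 2" "r ^ 2 * t ^ 5
      = t ^ 3" "r * t ^ 5 = t ^ 4"
      using that by algebra+
    then show ?thesis
      by algebra
  qed
  have "t ^ 5 = T - (10 * T - 5 * T ^ 2) * t + (35 * T - 50 * T ^ 2 + 25 * T ^ 3) * t ^ 2 -
      (60 * T - 175 * T ^ 2 + 250 * T ^ 3 - 125 * T ^ 4) * t ^ 3 +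
      (55 * T - 300 * T ^ 2 + 875 * T ^ 3 - 1250 * T ^ 4 + 625 * T ^ 5) * t ^ 4"
    using 3[OF s_t(1)] unfolding 2[symmetric] mult_zero_left by (simp only: eq_iff_diff_eq_0[of _ "t ^ 5"] eq_commute[of "t ^ 5"])
  then have "f * t ^ (n + 5) = (f * t ^ n) * (T - (10 * T - 5 * T ^ 2) * t + (35 * T - 50 * T ^ 2
      + 25 * T ^ 3) * t ^ 2 -
      (60 * T - 175 * T ^ 2 + 250 * T ^ 3 - 125 * T ^ 4) * t ^ 3 +
      (55 * T - 300 * T ^ 2 + 875 * T ^ 3 - 1250 * T ^ 4 + 625 * T ^ 5) * t ^ 4)"
    by (simp only: power_add mult.assoc)
  also have "\<dots> = (55 * T - 300 * T ^ 2 + 875 * T ^ 3 - 1250 * T ^ 4 + 625 * T ^ 5) * (f * t ^ (n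
      + 4))
    + - ((60 * T - 175 * T ^ 2 + 250 * T ^ 3 - 125 * T ^ 4) * (f * t ^ (n + 3)))
    + (35 * T - 50 * T ^ 2 + 25 * T ^ 3) * (f * t ^ (n + 2))
    + - ((10 * T - 5 * T ^ 2) * (f * t ^ (n + 1))) + T * (f * t ^ n)"
    unfolding power_add power_one_right by algebra
  also have "\<dots> = V 5 (55 * t - 300 * t ^ 2 + 875 * t ^ 3 - 1250 * t ^ 4
      + 625 * t ^ 5) * (f * t ^ (n + 4))
    + - (V 5 (60 * t - 175 * t ^ 2 + 250 * t ^ 3 - 125 * t ^ 4) * (f * t ^ (n + 3)))
    + V 5 (35 * t - 50 * t ^ 2 + 25 * t ^ 3) * (f * t ^ (n + 2))
    + - (V 5 (10 * t - 5 * t ^ 2) * (f * t ^ (n + 1))) + V 5 t * (f * t ^ n)"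
    by (simp add: T_def)
  finally show ?thesis
    by (simp only: U5_add U5_uminus U5_V_mult) simp
qed

section \<open>5-adic valuations\<close>

text \<open>Integer polynomials in \<open>t\<close> carry the entries of the array: integrality and
  finite support are built in.\<close>

definition ev :: "int poly \<Rightarrow> rat fls" where "ev p = poly (map_poly of_int p) t"

lemma ev_0 [simp]: "ev 0 = 0"
  by (simp add: ev_def)

lemma ev_add: "ev (p + r) = ev p + ev r"
proof -
  have "map_poly of_int (p + r) = (map_poly of_int p + map_poly of_int r :: rat fls poly)"
    by (rule poly_eqI) (simp add: coeff_map_poly)
  then show ?thesis by (simp add: ev_def)
qed

lemma ev_mult: "ev (p * r) = ev p * ev r"
proof -
  have "map_poly of_int (p * r) = (map_poly of_int p * map_poly of_int r :: rat fls poly)"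
    by (rule poly_eqI) (simp add: coeff_map_poly coeff_mult)
  then show ?thesis by (simp add: ev_def)
qed

lemma ev_monom: "ev (monom a n) = of_int a * t ^ n"
  by (simp add: ev_def map_poly_monom poly_monom)

lemma ev_altdef: "ev p = (\<Sum>k\<le>degree p. of_int (coeff p k) * t ^ k)"
proof -
  have "ev p = ev (\<Sum>k\<le>degree p. monom (coeff p k) k)"
    by (simp add: poly_as_sum_of_monoms)
  also have "\<dots> = (\<Sum>k\<le>degree p. ev (monom (coeff p k) k))"
    by (induction rule: infinite_finite_induct) (auto simp: ev_add)
  finally show ?thesis by (simp add: ev_monom)
qed

text \<open>
  A bound of the form \<open>(3 n + c) div 4\<close> loses 3 in \<open>c\<close> under multiplication because of the two
  rounded quotients.
\<close>

definition val5 :: "int \<Rightarrow> nat \<Rightarrow> int poly \<Rightarrow> bool" where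
  "val5 c m p \<longleftrightarrow> (\<forall>n. 5 ^ nat ((3 * int n + c) div 4) dvd coeff p n) \<and> (\<forall>n<m. coeff p n = 0)"

definition rep :: "int \<Rightarrow> nat \<Rightarrow> rat fls \<Rightarrow> bool" where
  "rep c m f \<longleftrightarrow> (\<exists>p. f = ev p \<and> val5 c m p)"

lemma power_nat_dvd_mono: "c \<le> d \<Longrightarrow> 5 ^ nat d dvd (x::int) \<Longrightarrow> 5 ^ nat c dvd x"
  by (meson dvd_trans le_imp_power_dvd nat_mono)

lemma rep_mono: "rep c m f \<Longrightarrow> d \<le> c \<Longrightarrow> k \<le> m \<Longrightarrow> rep d k f"
proof -
  assume "rep c m f" "d \<le> c" "k \<le> m"
  then obtain p where p: "f = ev p" "val5 c m p"
    by (auto simp: rep_def)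
  have "5 ^ nat ((3 * int n + d) div 4) dvd coeff p n" for n
  proof (rule power_nat_dvd_mono)
    show "(3 * int n + d) div 4 \<le> (3 * int n + c) div 4"
      using \<open>d \<le> c\<close> by (intro zdiv_mono1) auto
  qed (use p(2) in \<open>simp add: val5_def\<close>)
  then have "val5 d k p"
    using p(2) \<open>k \<le> m\<close> by (auto simp: val5_def)
  with p(1) show "rep d k f"
    by (auto simp: rep_def)
qed

lemma rep_0: "rep c m 0"
  unfolding rep_def by (rule exI[of _ 0]) (simp add: val5_def)

lemma rep_add: "rep c m f \<Longrightarrow> rep c m g \<Longrightarrow> rep c m (f + g)"
proof -
  assume "rep c m f" "rep c m g"
  then obtain p r where p: "f = ev p" "val5 c m p" and r: "g = ev r" "val5 c m r"
    by (auto simp: rep_def)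
  then have "val5 c m (p + r)"
    by (auto simp: val5_def)
  with p(1) r(1) show "rep c m (f + g)"
    unfolding rep_def by (metis ev_add)
qed

lemma rep_monom:
  assumes "5 ^ nat ((3 * int n + c) div 4) dvd a" "m \<le> n"
  shows "rep c m (of_int a * t ^ n)"
  unfolding rep_def by (rule exI[of _ "monom a n"]) (use assms in \<open>auto simp: ev_monom val5_def\<close>)

text \<open>A constant shifts the quotient by whole units, so each factor 5 adds 4 to c without the
  loss of 3 in \<open>rep_mult\<close>.\<close>

lemma rep_scale:
  assumes "5 ^ k dvd a" "rep c m f"
  shows "rep (c + 4 * int k) m (of_int a * f)"
proof -
  obtain p where p: "f = ev p" "val5 c m p"
    using assms by (auto simp: rep_def)
  have "5 ^ nat ((3 * int n + (c + 4 * int k)) div 4) dvd a * coeff p n" for n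
  proof -
    have "5 ^ (k + nat ((3 * int n + c) div 4)) dvd a * coeff p n"
      unfolding power_add using assms(1) p(2) by (intro mult_dvd_mono) (auto simp: val5_def)
    moreover have "nat ((3 * int n + (c + 4 * int k)) div 4) \<le> k + nat ((3 * int n + c) div 4)"
      by linarith
    ultimately show ?thesis
      by (meson dvd_trans le_imp_power_dvd)
  qed
  moreover have "ev (smult a p) = of_int a * ev p"
    using ev_mult[of "[:a:]" p] ev_monom[of a 0] by (simp add: monom_0)
  ultimately show ?thesis
    unfolding rep_def using p by (intro exI[of _ "smult a p"]) (auto simp: val5_def)
qed

lemma rep_uminus: "rep c m f \<Longrightarrow> rep c m (- f)"
  using rep_scale[of 0 "-1" c m f] by simp

lemma rep_diff: "rep c m f \<Longrightarrow> rep c m g \<Longrightarrow> rep c m (f - g)"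
  using rep_add[of c m f "- g"] rep_uminus by simp

lemma rep_sum: "(\<And>i. i \<in> S \<Longrightarrow> rep c m (f i)) \<Longrightarrow> rep c m (sum f S)"
  by (induction S rule: infinite_finite_induct) (auto intro: rep_0 rep_add)

lemma rep_mult:
  assumes "rep c m f" "rep d k g"
  shows "rep (c + d - 3) (m + k) (f * g)"
proof -
  obtain p r where p: "f = ev p" "val5 c m p" and r: "g = ev r" "val5 d k r"
    using assms by (auto simp: rep_def)
  have "5 ^ nat ((3 * int n + (c + d - 3)) div 4) dvd coeff (p * r) n" for n
    unfolding coeff_mult
  proof (rule dvd_sum)
    fix i assume i: "i \<in> {..n}"
    have "5 ^ (nat ((3 * int i + c) div 4) + nat ((3 * int (n - i)
      + d) div 4)) dvd coeff p i * coeff r (n - i)"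
      unfolding power_add using p(2) r(2) by (intro mult_dvd_mono) (auto simp: val5_def)
    moreover have "(3 * int n + (c + d - 3)) div 4 \<le> (3 * int i + c) div 4 + (3 * int (n - i)
      + d) div 4"
      using i by simp
    then have "nat ((3 * int n + (c + d - 3)) div 4) \<le> nat ((3 * int i + c) div 4)
      + nat ((3 * int (n - i) + d) div 4)"
      by linarith
    ultimately show "5 ^ nat ((3 * int n + (c + d - 3)) div 4) dvd coeff p i * coeff r (n - i)"
      by (meson dvd_trans le_imp_power_dvd)
  qed
  moreover have "coeff (p * r) n = 0" if "n < m + k" for n
    unfolding coeff_mult
  proof (rule sum.neutral, intro ballI)
    fix i assume "i \<in> {..n}"
    then have "i < m \<or> n - i < k" using that by auto
    then show "coeff p i * coeff r (n - i) = 0"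
      using p(2) r(2) by (auto simp: val5_def)
  qed
  ultimately show ?thesis
    unfolding rep_def using p r by (intro exI[of _ "p * r"]) (auto simp: val5_def ev_mult)
qed

lemma rep_numeral_power:
  "5 ^ nat ((3 * int n + c) div 4) dvd (numeral a :: int) \<Longrightarrow> m \<le> n \<Longrightarrow> rep c m (numeral a * t ^ n)"
  using rep_monom[of n c "numeral a" m] by simp

lemma rep_numeral_t:
  "5 ^ nat ((3 + c) div 4) dvd (numeral a :: int) \<Longrightarrow> m \<le> 1 \<Longrightarrow> rep c m (numeral a * t)"
  using rep_monom[of 1 c "numeral a" m] by simp

lemma rep_numeral: "5 ^ nat (c div 4) dvd (numeral a :: int) \<Longrightarrow> rep c 0 (numeral a)"
  using rep_monom[of 0 c "numeral a" 0] by simp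

lemma rep_1: "5 ^ nat (c div 4) dvd (1 :: int) \<Longrightarrow> rep c 0 1"
  using rep_monom[of 0 c 1 0] by simp

lemma rep_t: "5 ^ nat ((3 + c) div 4) dvd (1 :: int) \<Longrightarrow> m \<le> 1 \<Longrightarrow> rep c m t"
  using rep_monom[of 1 c 1 m] by simp

lemmas rep_intros = rep_add rep_diff rep_uminus rep_numeral_power rep_numeral_t rep_numeral rep_t rep_1

text \<open>The coefficient of f (n + k) satisfies \<open>rep\<close> with c = k and order 1.
  Including the loss of 3, k + (c - (n + k)) - 3 = c + 2 - (n + 5) for every k, so all five terms
  gain 2 in c and 1 in the order.\<close>

lemma rep_recurrence:
  fixes f :: "nat \<Rightarrow> rat fls"
  assumes rec: "\<And>n. f (n + 5) =
      (55 * t - 300 * t ^ 2 + 875 * t ^ 3 - 1250 * t ^ 4 + 625 * t ^ 5) * f (n + 4)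
    - (60 * t - 175 * t ^ 2 + 250 * t ^ 3 - 125 * t ^ 4) * f (n + 3)
    + (35 * t - 50 * t ^ 2 + 25 * t ^ 3) * f (n + 2)
    - (10 * t - 5 * t ^ 2) * f (n + 1) + t * f n"
    and base: "\<And>n. n < 5 \<Longrightarrow> rep (c - int n) m (f n)"
  shows "n \<ge> 5 \<Longrightarrow> rep (c + 2 - int n) (m + 1) (f n)"
proof -
  have e1: "rep 4 1 (55 * t - 300 * t ^ 2 + 875 * t ^ 3 - 1250 * t ^ 4 + 625 * t ^ 5)"
    by (intro rep_intros) auto
  have e2: "rep 3 1 (60 * t - 175 * t ^ 2 + 250 * t ^ 3 - 125 * t ^ 4)"
    by (intro rep_intros) auto
  have e3: "rep 2 1 (35 * t - 50 * t ^ 2 + 25 * t ^ 3)"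
    by (intro rep_intros) auto
  have e4: "rep 1 1 (10 * t - 5 * t ^ 2)"
    by (intro rep_intros) auto
  have e5: "rep 0 1 t"
    by (intro rep_intros) auto
  have step: "rep (c + 2 - int (n + 5)) (m + 1) (f (n + 5))" if "\<And>k. k < n + 5 \<Longrightarrow> rep (c
      - int k) m (f k)" for n
    unfolding rec
    using rep_mult[OF e1 that[of "n + 4"]] rep_mult[OF e2 that[of "n
      + 3"]] rep_mult[OF e3 that[of "n + 2"]]
      rep_mult[OF e4 that[of "n + 1"]] rep_mult[OF e5 that[of n]]
    by (intro rep_add rep_diff) (simp_all add: algebra_simps)
  \<comment> \<open>Without the gain the bound reproduces itself; the gain is collected in one last
    step and does not accumulate.\<close>
  have all: "rep (c - int n) m (f n)" for n
  proof (induction n rule: less_induct)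
    case (less n)
    show ?case
    proof (cases "n < 5")
      case False
      then obtain k where k: "n = k + 5"
        by (metis add.commute le_Suc_ex linorder_not_less)
      have "rep (c + 2 - int (k + 5)) (m + 1) (f (k + 5))"
        by (rule step) (use less k in auto)
      then show ?thesis
        unfolding k by (rule rep_mono) auto
    qed (rule base)
  qed
  assume "n \<ge> 5"
  then obtain k where k: "n = k + 5"
    by (metis add.commute le_Suc_ex)
  show ?thesis
    unfolding k by (rule step) (rule all)
qed

text \<open>The initial values have exponents -4, ..., 0, so every n >= 1 gets the gain: c = 3
  becomes 3 + 2 - (n + 4) = 1 - n, and the order rises to 2. At n = 0 the value begins with
  \<open>t\<close> itself (\<open>f4\<close> in the proof), so that \<open>L 1\<close> only has
  order 1.\<close>

lemma U5_F_start: "rep (-1) 1 (U\<^sub>5 (F5 * t))"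
    and U5_F_rep: "n \<ge> 1 \<Longrightarrow> rep (1 - int n) 2 (U\<^sub>5 (F5 * t * t ^ n))"
proof -
  \<comment> \<open>\<open>f n\<close> belongs to \<open>P_A t\<^sup>j\<close> with \<open>j = n - 4\<close>\<close>
  define f where "f = (\<lambda>n. U\<^sub>5 ((F5 * s ^ 4 * t) * t ^ n))"
  have rec: "f (n + 5) =
      (55 * t - 300 * t ^ 2 + 875 * t ^ 3 - 1250 * t ^ 4 + 625 * t ^ 5) * f (n + 4)
    - (60 * t - 175 * t ^ 2 + 250 * t ^ 3 - 125 * t ^ 4) * f (n + 3)
    + (35 * t - 50 * t ^ 2 + 25 * t ^ 3) * f (n + 2)
    - (10 * t - 5 * t ^ 2) * f (n + 1) + t * f n" for n
    unfolding f_def by (rule U5_rec)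
  have shift: "s ^ (k + m) * t ^ k = s ^ m" for k m
    using s_t(1) by (simp add: power_add mult.assoc mult.left_commute flip: power_mult_distrib)
  have f: "f 0 = - (125 * t ^ 4)" "f 1 = - (25 * t ^ 3)" "f 2 = - (5 * t ^ 2)" "f 3 = - t"
    using shift[of 1 3] shift[of 2 2] shift[of 3 1] shift[of 4 0] U5_F_0 U5_F_1 U5_F_2 U5_F_3
    by (simp_all add: f_def mult.assoc eval_nat_numeral)
  \<comment> \<open>\<open>U\<^sub>5 (F5 * t)\<close> lies one exponent beyond the computed values,
    so one step of the recurrence is run, starting from \<open>F5 * s ^ 4\<close>.\<close>
  have f4: "f 4 = t - 50 * t ^ 2 + 350 * t ^ 3 - 875 * t ^ 4 + 625 * t ^ 5"
  proof -
    define h where "h = (\<lambda>n. U\<^sub>5 ((F5 * s ^ 4) * t ^ n))"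
    have h: "h (Suc n) = f n" for n
      by (simp add: h_def f_def mult_ac)
    have "h (0 + 5) = (55 * t - 300 * t ^ 2 + 875 * t ^ 3 - 1250 * t ^ 4 + 625 * t ^ 5) * h (0 + 4)
      - (60 * t - 175 * t ^ 2 + 250 * t ^ 3 - 125 * t ^ 4) * h (0 + 3)
      + (35 * t - 50 * t ^ 2 + 25 * t ^ 3) * h (0 + 2)
      - (10 * t - 5 * t ^ 2) * h (0 + 1) + t * h 0"
      unfolding h_def by (rule U5_rec)
    moreover have "h (0 + 5) = f 4" "h (0 + 4) = f 3" "h (0 + 3) = f 2" "h (0 + 2) = f 1" "h (0
      + 1) = f 0"
      using h[of 4] h[of 3] h[of 2] h[of 1] h[of 0] by (simp_all add: eval_nat_numeral)
    moreover have "h 0 = 1 + 5 * t - 250 * t ^ 2 + 1750 * t ^ 3 - 4375 * t ^ 4 + 2500 * t ^ 5"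
      using U5_F_4 by (simp add: h_def)
    ultimately show ?thesis
      unfolding f by algebra
  qed
  have base: "rep (3 - int n) 1 (f n)" if "n < 5" for n
  proof -
    from that consider "n = 0" | "n = 1" | "n = 2" | "n = 3" | "n = 4" by linarith
    then show ?thesis
    proof cases
      case 1 show ?thesis unfolding 1 f by (intro rep_intros) auto
    next
      case 2 show ?thesis unfolding 2 f by (intro rep_intros) auto
    next
      case 3 show ?thesis unfolding 3 f by (intro rep_intros) auto
    next
      case 4 show ?thesis unfolding 4 f by (intro rep_intros) auto
    next
      case 5 show ?thesis unfolding 5 f4 by (intro rep_intros) auto
    qed
  qed
  have fn: "f (n + 4) = U\<^sub>5 (F5 * t * t ^ n)" for n
    using shift[of 4 0] by (simp add: f_def power_add mult_ac)
  show "rep (-1) 1 (U\<^sub>5 (F5 * t))"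
    using base[of 4] fn[of 0] by simp
  show "rep (1 - int n) 2 (U\<^sub>5 (F5 * t * t ^ n))" if "n \<ge> 1"
    using rep_recurrence[of f 3 1 "n + 4", OF rec base] that by (simp add: fn numeral_2_eq_2)
qed

text \<open>Multiplication by \<open>s\<close> preserves the recurrence and cancels the factor
  \<open>t\<close> in the values \<open>U5_G_0\<close> to \<open>U5_G_4\<close>. With initial values
  at exponents -4, ..., 0, the order rises from 0 to 1 for n >= 1.\<close>

lemma U5_G_rep:
  assumes "n \<ge> 1"
  shows "rep (2 - int n) 1 (s * U\<^sub>5 (G5 * t ^ n))"
proof -
  define f where "f = (\<lambda>n. s * U\<^sub>5 ((G5 * s ^ 4) * t ^ n))"
  have rec: "f (n + 5) =
      (55 * t - 300 * t ^ 2 + 875 * t ^ 3 - 1250 * t ^ 4 + 625 * t ^ 5) * f (n + 4)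
    - (60 * t - 175 * t ^ 2 + 250 * t ^ 3 - 125 * t ^ 4) * f (n + 3)
    + (35 * t - 50 * t ^ 2 + 25 * t ^ 3) * f (n + 2)
    - (10 * t - 5 * t ^ 2) * f (n + 1) + t * f n" for n
    unfolding f_def U5_rec[of _ n] by algebra
  have shift: "s ^ (k + m) * t ^ k = s ^ m" for k m
    using s_t(1) by (simp add: power_add mult.assoc mult.left_commute flip: power_mult_distrib)
  have st: "s * (t * z) = z" for z
    using s_t(1) by (simp flip: mult.assoc)
  have f: "f 0 = 150 - 640 * t - 900 * t ^ 2 + 2000 * t ^ 3 - 625 * t ^ 4"
     "f 1 = 34 - 170 * t + 125 * t ^ 3" "f 2 = 8 - 40 * t + 25 * t ^ 2" "f 3 = 2 - 5 * t" "f 4 = 1"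
    using shift[of 1 3] shift[of 2 2] shift[of 3 1] shift[of 4 0] U5_G_0 U5_G_1 U5_G_2 U5_G_3 U5_G_4 s_t
    by (simp_all add: f_def mult.assoc st)
  have base: "rep (4 - int n) 0 (f n)" if "n < 5" for n
  proof -
    from that consider "n = 0" | "n = 1" | "n = 2" | "n = 3" | "n = 4" by linarith
    then show ?thesis
    proof cases
      case 1 show ?thesis unfolding 1 f by (intro rep_intros) auto
    next
      case 2 show ?thesis unfolding 2 f by (intro rep_intros) auto
    next
      case 3 show ?thesis unfolding 3 f by (intro rep_intros) auto
    next
      case 4 show ?thesis unfolding 4 f by (intro rep_intros) auto
    next
      case 5 show ?thesis unfolding 5 f by (intro rep_intros) auto
    qed
  qed
  have fn: "f (n + 4) = s * U\<^sub>5 (G5 * t ^ n)" for n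
    using shift[of 4 0] by (simp add: f_def power_add mult_ac)
  show ?thesis
    using rep_recurrence[of f 4 0 "n + 4", OF rec base] assms by (simp add: fn)
qed

section \<open>The operators on integer polynomials in \<open>t\<close>\<close>

lemma V_of_int: "V 5 (of_int z) = of_int z"
  by (simp add: fls_of_int)

lemma U_A_sum: "U_A (P_A * (\<Sum>k\<in>S. of_int (a k) * t ^ k))
      = P_B * (\<Sum>k\<in>S. of_int (a k) * U\<^sub>5 (F5 * t * t ^ k))"
proof -
  have "U_A (P_A * (\<Sum>k\<in>S. of_int (a k) * t ^ k)) = (\<Sum>k\<in>S. U\<^sub>5 (V 5 (of_int (a k)) * (A * (P_A
      * t ^ k))))"
    unfolding U_A_def sum_distrib_left U5_sum V_of_int by (simp only: mult_ac)
  also have "\<dots> = (\<Sum>k\<in>S. of_int (a k) * U_A (P_A * t ^ k))"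
    by (simp only: U5_V_mult U_A_def)
  finally show ?thesis
    by (simp add: U_A_t_power sum_distrib_left mult_ac)
qed

lemma U_B_sum: "U_B (P_B * (\<Sum>k\<in>S. of_int (a k) * t ^ k))
      = P_A * (\<Sum>k\<in>S. of_int (a k) * (s * U\<^sub>5 (G5 * t ^ k)))"
proof -
  have "U_B (P_B * (\<Sum>k\<in>S. of_int (a k) * t ^ k)) = (\<Sum>k\<in>S. U\<^sub>5 (V 5 (of_int (a k)) * (B * (P_B
      * t ^ k))))"
    unfolding U_B_def sum_distrib_left U5_sum V_of_int by (simp only: mult_ac)
  also have "\<dots> = (\<Sum>k\<in>S. of_int (a k) * U_B (P_B * t ^ k))"
    by (simp only: U5_V_mult U_B_def)
  finally show ?thesis
    by (simp add: U_B_t_power sum_distrib_left mult_ac)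
qed

lemma U_A_rep:
  assumes "rep (4 * int \<alpha> - 3) 1 f"
  shows "\<exists>g. rep (4 * int \<alpha> - 2) 2 g \<and> U_A (P_A * f) = P_B * g"
proof -
  obtain p where p: "f = ev p" "val5 (4 * int \<alpha> - 3) 1 p"
    using assms by (auto simp: rep_def)
  define g where "g = (\<Sum>k\<le>degree p. of_int (coeff p k) * U\<^sub>5 (F5 * t * t ^ k))"
  have "rep (4 * int \<alpha> - 2) 2 (of_int (coeff p k) * U\<^sub>5 (F5 * t * t ^ k))" for k
  proof (cases "k = 0")
    case True
    then show ?thesis using p(2) by (simp add: val5_def rep_0)
  next
    case False
    then have "rep (1 - int k + 4 * int (nat ((3 * int k + (4 * int \<alpha>
      - 3)) div 4))) 2 (of_int (coeff p k) * U\<^sub>5 (F5 * t * t ^ k))"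
      using p(2) by (intro rep_scale U5_F_rep) (auto simp: val5_def)
    then show ?thesis
    proof (rule rep_mono)
      \<comment> \<open>The right side is smallest at k = 2, where it is 4 \<alpha> - 1. Estimating
        4 (y div 4) by y - 3 would be too weak at k = 1, where the division is exact.\<close>
      have "4 * int \<alpha> - 2 \<le> 1 - int k + 4 * ((3 * int k + (4 * int \<alpha> - 3)) div 4)"
        using False by presburger
      then show "4 * int \<alpha> - 2 \<le> 1 - int k + 4 * int (nat ((3 * int k + (4 * int \<alpha> - 3)) div 4))"
        by linarith
    qed simp
  qed
  then have "rep (4 * int \<alpha> - 2) 2 g"
    unfolding g_def by (intro rep_sum)
  moreover have "U_A (P_A * f) = P_B * g"
    unfolding p(1) ev_altdef U_A_sum g_def ..
  ultimately show ?thesis by blast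
qed

text \<open>Stated for order 1 because \<open>L 1\<close> enters the induction with that order; the
  later odd members have order 2.\<close>

lemma U_B_rep:
  assumes "rep (4 * int \<alpha> - 2) 1 f"
  shows "\<exists>g. rep (4 * int (Suc \<alpha>) - 3) 1 g \<and> U_B (P_B * f) = P_A * g"
proof -
  obtain p where p: "f = ev p" "val5 (4 * int \<alpha> - 2) 1 p"
    using assms by (auto simp: rep_def)
  define g where "g = (\<Sum>k\<le>degree p. of_int (coeff p k) * (s * U\<^sub>5 (G5 * t ^ k)))"
  have "rep (4 * int (Suc \<alpha>) - 3) 1 (of_int (coeff p k) * (s * U\<^sub>5 (G5 * t ^ k)))" for k
  proof (cases "k = 0")
    case True
    then show ?thesis using p(2) by (simp add: val5_def rep_0)
  next
    case False
    then have "rep (2 - int k + 4 * int (nat ((3 * int k + (4 * int \<alpha>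
      - 2)) div 4))) 1 (of_int (coeff p k) * (s * U\<^sub>5 (G5 * t ^ k)))"
      using p(2) by (intro rep_scale U5_G_rep) (auto simp: val5_def)
    then show ?thesis
    proof (rule rep_mono)
      \<comment> \<open>Equality holds at k = 1, an exponent that does occur in
        \<open>L 1\<close>.\<close>
      have "4 * int (Suc \<alpha>) - 3 \<le> 2 - int k + 4 * ((3 * int k + (4 * int \<alpha> - 2)) div 4)"
        using False by presburger
      then show "4 * int (Suc \<alpha>) - 3 \<le> 2 - int k + 4 * int (nat ((3 * int k + (4 * int \<alpha>
      - 2)) div 4))"
        by linarith
    qed simp
  qed
  then have "rep (4 * int (Suc \<alpha>) - 3) 1 g"
    unfolding g_def by (intro rep_sum)
  moreover have "U_B (P_B * f) = P_A * g"
    unfolding p(1) ev_altdef U_B_sum g_def ..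
  ultimately show ?thesis by blast
qed

lemma L_rep:
  assumes "\<alpha> \<ge> 1"
  shows "\<exists>f g. L (2 * \<alpha>) = P_A * f \<and> rep (4 * int \<alpha> - 3) 1 f \<and> L (2 * \<alpha> + 1)
      = P_B * g \<and> rep (4 * int \<alpha> - 2) 2 g"
  using assms
proof (induction \<alpha> rule: dec_induct)
  case base
  have "L 1 = P_B * U\<^sub>5 (F5 * t)"
    using U_A_t_power[of 0] by simp
  \<comment> \<open>The odd bound at \<alpha> = 0, but with order 1 in place of 2, which is why the
    induction claim begins at \<alpha> = 1.\<close>
  moreover have "rep (4 * int 0 - 2) 1 (U\<^sub>5 (F5 * t))"
    by (rule rep_mono[OF U5_F_start]) auto
  ultimately obtain f where f: "rep (4 * int (Suc 0) - 3) 1 f" "U_B (L 1) = P_A * f"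
    using U_B_rep by metis
  obtain g where "rep (4 * int (Suc 0) - 2) 2 g" "U_A (P_A * f) = P_B * g"
    using U_A_rep[OF f(1)] by blast
  moreover have "L 2 = P_A * f"
    using f(2) by (simp add: numeral_2_eq_2)
  ultimately show ?case
    using f L_odd[of 1] by auto
next
  case (step \<alpha>)
  then obtain g where g: "L (2 * \<alpha> + 1) = P_B * g" "rep (4 * int \<alpha> - 2) 2 g"
    by blast
  obtain f where f: "rep (4 * int (Suc \<alpha>) - 3) 1 f" "U_B (P_B * g) = P_A * f"
    using U_B_rep[OF rep_mono[OF g(2)]] by auto
  obtain h where "rep (4 * int (Suc \<alpha>) - 2) 2 h" "U_A (P_A * f) = P_B * h"
    using U_A_rep[OF f(1)] by blast
  moreover have "L (2 * Suc \<alpha>) = P_A * f"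
    using f(2) g(1) L_even[of \<alpha>] by simp
  ultimately show ?case
    using f L_odd[of "Suc \<alpha>"] by metis
qed

section \<open>From polynomials in \<open>t\<close> to the array\<close>

lemma t_sum_ev:
  assumes "\<And>n. n \<ge> 0 \<Longrightarrow> l (i, n) = coeff p (nat n)" "\<And>n. n < m \<Longrightarrow> coeff p n = 0"
  shows "t_sum l i (int m) = ev p"
proof -
  have "t_sum l i (int m) = (\<Sum>k | k \<ge> m \<and> coeff p k \<noteq> 0. of_int (coeff p k) * t ^ k)"
    unfolding t_sum_def
    by (rule sum.reindex_bij_witness[of _ int nat]) (auto simp: assms(1) le_nat_iff power_int_def)
  also have "\<dots> = (\<Sum>k\<le>degree p. of_int (coeff p k) * t ^ k)"
  proof (rule sum.mono_neutral_left)
    show "\<forall>k\<in>{..degree p} - {k. m \<le> k \<and> coeff p k \<noteq> 0}. of_int (coeff p k) * t ^ k = 0"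
    proof
      fix k assume "k \<in> {..degree p} - {k. m \<le> k \<and> coeff p k \<noteq> 0}"
      then have "coeff p k = 0"
        using assms(2)[of k] by (cases "k < m") auto
      then show "of_int (coeff p k) * t ^ k = 0" by simp
    qed
  qed (auto intro: le_degree)
  finally show ?thesis
    by (simp add: ev_altdef)
qed

lemma nu5_ge:
  assumes "5 ^ nat k dvd x"
  shows "ereal (real_of_int k) \<le> \<nu>\<^sub>5 x"
proof (cases "x = 0")
  case False
  have "\<not> is_unit (5 :: int)" by simp
  then have "nat k \<le> multiplicity 5 x"
    using False assms by (metis multiplicity_geI)
  then have "k \<le> int (multiplicity 5 x)"
    by linarith
  then have "real_of_int k \<le> real_of_int (int (multiplicity 5 x))"
    by (simp only: of_int_le_iff)
  with False show ?thesis
    by (simp add: \<nu>\<^sub>5_def)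
qed (simp add: \<nu>\<^sub>5_def)

lemma floor_div_4: "\<lfloor>(3 * real_of_int n - real_of_int c) / 4\<rfloor> = (3 * n - c) div 4"
proof -
  have "(3 * real_of_int n - real_of_int c) / 4 = real_of_int (3 * n - c) / real_of_int 4"
    by simp
  then show ?thesis
    by (simp only: floor_divide_of_int_eq)
qed

theorem theorem3p8:
  shows "\<exists>l. discrete_array l \<and>
    (\<forall>\<alpha>::nat. \<alpha> \<ge> 1 \<longrightarrow>
      L (2 * \<alpha>) = P_A * t_sum l (2 * int \<alpha>) 1 \<and>
      (\<forall>n\<ge>1. \<nu>\<^sub>5 (l (2 * int \<alpha>, n))
                \<ge> of_int (int \<alpha> + \<lfloor>(3 * real_of_int n - 3) / 4\<rfloor>)) \<and>
      L (2 * \<alpha> + 1) = P_B * t_sum l (2 * int \<alpha> + 1) 2 \<and>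
      (\<forall>n\<ge>2. \<nu>\<^sub>5 (l (2 * int \<alpha> + 1, n))
                \<ge> of_int (int \<alpha> + 1 + \<lfloor>(3 * real_of_int n - 6) / 4\<rfloor>)))"
proof -
  have "\<forall>\<alpha>. \<exists>p r. \<alpha> \<ge> 1 \<longrightarrow> L (2 * \<alpha>) = P_A * ev p \<and> val5 (4 * int \<alpha> - 3) 1 p \<and>
      L (2 * \<alpha> + 1) = P_B * ev r \<and> val5 (4 * int \<alpha> - 2) 2 r"
    using L_rep unfolding rep_def by metis
  then obtain p r where pr: "\<And>\<alpha>. \<alpha> \<ge> 1 \<Longrightarrow> L (2 * \<alpha>) = P_A * ev (p \<alpha>) \<and> val5 (4 * int \<alpha>
      - 3) 1 (p \<alpha>) \<and>
      L (2 * \<alpha> + 1) = P_B * ev (r \<alpha>) \<and> val5 (4 * int \<alpha> - 2) 2 (r \<alpha>)"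
    by metis
  \<comment> \<open>Rows with index 0, 1 or below come from unspecified polynomials, so discreteness
    holds for every i.\<close>
  define P where "P = (\<lambda>i::int. if even i then p (nat (i div 2)) else r (nat (i div 2)))"
  define l where "l = (\<lambda>(i, n). if n \<ge> 0 then coeff (P i) (nat n) else 0)"
  have P: "P (2 * int \<alpha>) = p \<alpha>" "P (2 * int \<alpha> + 1) = r \<alpha>" for \<alpha>
    by (simp_all add: P_def)
  have l: "l (i, n) = coeff (P i) (nat n)" if "n \<ge> 0" for i n
    using that by (simp add: l_def)
  show ?thesis
  proof (intro exI[of _ l] conjI allI impI)
    show "discrete_array l"
      unfolding discrete_array_def
    proof
      fix i
      have "{n. l (i, n) \<noteq> 0} \<subseteq> {0..int (degree (P i))}"
        by (auto simp: l_def nat_le_iff dest!: le_degree split: if_splits)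
      then show "finite {n. l (i, n) \<noteq> 0}"
        by (rule finite_subset) simp
    qed
  next
    fix \<alpha> :: nat assume \<alpha>: "\<alpha> \<ge> 1"
    have "t_sum l (2 * int \<alpha>) (int 1) = ev (p \<alpha>)"
      using pr[OF \<alpha>] by (intro t_sum_ev) (auto simp: l P val5_def)
    then show "L (2 * \<alpha>) = P_A * t_sum l (2 * int \<alpha>) 1"
      using pr[OF \<alpha>] by simp
    have "t_sum l (2 * int \<alpha> + 1) (int 2) = ev (r \<alpha>)"
      using pr[OF \<alpha>] by (intro t_sum_ev) (auto simp: l P val5_def)
    moreover have "L (2 * \<alpha> + 1) = P_B * ev (r \<alpha>)"
      using pr[OF \<alpha>] by blast
    ultimately show "L (2 * \<alpha> + 1) = P_B * t_sum l (2 * int \<alpha> + 1) 2"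
      by (simp only: of_nat_numeral)
    fix n :: int
    {
      assume n: "1 \<le> n"
      have "5 ^ nat (int \<alpha> + (3 * n - 3) div 4) dvd coeff (p \<alpha>) (nat n)"
      proof -
        have "int \<alpha> + (3 * n - 3) div 4 = (3 * n + (4 * int \<alpha> - 3)) div 4"
          by presburger
        moreover have "5 ^ nat ((3 * int (nat n) + (4 * int \<alpha> - 3)) div 4) dvd coeff (p \<alpha>) (nat n)"
          using pr[OF \<alpha>] unfolding val5_def by blast
        ultimately show ?thesis using n by simp
      qed
      from nu5_ge[OF this] show "of_int (int \<alpha> + \<lfloor>(3 * real_of_int n
      - 3) / 4\<rfloor>) \<le> \<nu>\<^sub>5 (l (2 * int \<alpha>, n))"
        using n floor_div_4[of n 3] by (simp add: l P)
    next
      assume n: "2 \<le> n"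
      have "5 ^ nat (int \<alpha> + 1 + (3 * n - 6) div 4) dvd coeff (r \<alpha>) (nat n)"
      proof -
        \<comment> \<open>4 \<alpha> - 2 = 4 (\<alpha> + 1) - 6, the source of the 6 in the
          bound.\<close>
        have "int \<alpha> + 1 + (3 * n - 6) div 4 = (3 * n + (4 * int \<alpha> - 2)) div 4"
          by presburger
        moreover have "5 ^ nat ((3 * int (nat n) + (4 * int \<alpha> - 2)) div 4) dvd coeff (r \<alpha>) (nat n)"
          using pr[OF \<alpha>] unfolding val5_def by blast
        ultimately show ?thesis using n by simp
      qed
      from nu5_ge[OF this] show "of_int (int \<alpha> + 1 + \<lfloor>(3 * real_of_int n
      - 6) / 4\<rfloor>) \<le> \<nu>\<^sub>5 (l (2 * int \<alpha> + 1, n))"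
        using n floor_div_4[of n 6] by (simp add: l P)
    }
  qed
qed

end
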